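(* Let $n\ge 1$, $s>0$, $1<p<\infty$ and $\lambda>1$. If $s=\frac12\bigl(\frac{n}{p}+m\bigr)$ for an integer $m\ge 0$, then there is a continuous embedding $$\mathcal{L}^{p}_{s+\ln,\lambda}(\mathbb R^n)\hookrightarrow C_0^m(\mathbb R^n).$$ Moreover, for any $u\in\mathcal{L}^{p}_{s+\ln,\lambda}(\mathbb R^n)$ and any multi-index $\gamma$ with $|\gamma|=m$, the weak derivative $\partial^\gamma u$ belongs to $C_0(\mathbb R^n)$ and satisfies the logarithmic modulus of continuity $$\|\partial^\gamma u(\cdot+h)-\partial^\gamma u(\cdot)\|_{L^\infty}\le C\,\|u\|_{\mathcal L^{p}_{s+\ln,\lambda}}\,|\ln|h||^{-\frac1p}$$ for $|h|$ sufficiently small, where $C=C(n,p,s,\lambda)>0$.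
   Context: The Fourier transform is $\widehat u(\xi)=\int_{\mathbb{R}^n}u(x)e^{-2\pi i x\cdot\xi}\,dx$, extended to $\mathcal S'(\mathbb R^n)$. For $s>0$, $\lambda>1$, $(\lambda I-\Delta)^{s+\ln}$ is the Fourier multiplier on $\mathcal S'(\mathbb R^n)$ with symbol $(\lambda+4\pi^2|\xi|^2)^s\ln(\lambda+4\pi^2|\xi|^2)$, and $\mathcal L^{p}_{s+\ln,\lambda}(\mathbb R^n)=\{u\in\mathcal S'(\mathbb R^n):(\lambda I-\Delta)^{s+\ln}u\in L^p(\mathbb R^n)\}$ with norm $\|u\|_{\mathcal L^{p}_{s+\ln,\lambda}}=\|(\lambda I-\Delta)^{s+\ln}u\|_{L^p}$. $C_0(\mathbb R^n)$ is the space of continuous functions on $\mathbb R^n$ vanishing at infinity with the supremum norm; $C_0^m(\mathbb R^n)$ is the space of $C^m$ functions all of whose derivatives of order at most $m$ belong to $C_0(\mathbb R^n)$, with the norm $\sum_{|\gamma|\le m}\|\partial^\gamma u\|_{L^\infty}$ (so $C_0^0=C_0$). *)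

theory Defs
  imports "HOL-Analysis.Analysis"
begin

section \<open>Multi-indices and classical partial derivatives\<close>

type_synonym 'n scalar_field = "real ^ 'n \<Rightarrow> complex"
type_synonym 'n multi_index = "'n \<Rightarrow> nat"

definition mi_order :: "'n::finite multi_index \<Rightarrow> nat" where
  "mi_order \<gamma> = (\<Sum>i\<in>UNIV. \<gamma> i)"

definition mi_power :: "real ^ 'n \<Rightarrow> 'n::finite multi_index \<Rightarrow> real" where
  "mi_power x \<gamma> = (\<Prod>i\<in>UNIV. (x $ i) ^ \<gamma> i)"

definition partial_deriv :: "'n::finite \<Rightarrow> 'n scalar_field \<Rightarrow> 'n scalar_field" where
  "partial_deriv i f x = vector_derivative (\<lambda>t. f (x + t *\<^sub>R axis i 1)) (at 0)"

primrec C_diff :: "nat \<Rightarrow> 'n::finite scalar_field \<Rightarrow> bool" where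
  "C_diff 0 f \<longleftrightarrow> continuous_on UNIV f"
| "C_diff (Suc k) f \<longleftrightarrow> continuous_on UNIV f \<and>
     (\<forall>i. (\<forall>x. (\<lambda>t. f (x + t *\<^sub>R axis i 1)) differentiable (at 0)) \<and>
          C_diff k (partial_deriv i f))"

text \<open>An enumeration of the coordinates. It only fixes the order in which the partial
  derivatives in \<open>mi_deriv\<close> are taken; this order is immaterial for \<open>C\<^sup>m\<close> functions and
  derivatives of order at most \<open>m\<close>, the only ones to which \<open>mi_deriv\<close> is applied.\<close>

definition coords :: "'n::finite list" where
  "coords = (SOME is. distinct is \<and> set is = UNIV)"

definition mi_deriv :: "'n::finite multi_index \<Rightarrow> 'n scalar_field \<Rightarrow> 'n scalar_field" where
  "mi_deriv \<gamma> f = foldr (\<lambda>i. partial_deriv i ^^ \<gamma> i) coords f"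


section \<open>The spaces \<open>C\<^sub>0\<close>, \<open>C\<^sub>0\<^sup>m\<close> and \<open>L\<^sup>p\<close>\<close>

definition sup_norm :: "'n::finite scalar_field \<Rightarrow> real" where
  "sup_norm f = (SUP x. norm (f x))"

definition C0 :: "'n::finite scalar_field set" where
  "C0 = {f. continuous_on UNIV f \<and> (f \<longlongrightarrow> 0) at_infinity}"

definition C0m :: "nat \<Rightarrow> 'n::finite scalar_field set" where
  "C0m m = {f. C_diff m f \<and> (\<forall>\<gamma>. mi_order \<gamma> \<le> m \<longrightarrow> mi_deriv \<gamma> f \<in> C0)}"

definition C0m_norm :: "nat \<Rightarrow> 'n::finite scalar_field \<Rightarrow> real" where
  "C0m_norm m f = (\<Sum>\<gamma> | mi_order \<gamma> \<le> m. sup_norm (mi_deriv \<gamma> f))"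

text \<open>\<open>Lp p\<close> consists of functions rather than almost-everywhere classes.\<close>

definition Lp :: "real \<Rightarrow> 'n::finite scalar_field set" where
  "Lp p = {g. g \<in> borel_measurable lborel \<and> integrable lborel (\<lambda>x. norm (g x) powr p)}"

definition Lp_norm :: "real \<Rightarrow> 'n::finite scalar_field \<Rightarrow> real" where
  "Lp_norm p g = (LINT x|lborel. norm (g x) powr p) powr (1 / p)"


section \<open>Schwartz functions and tempered distributions\<close>

definition schwartz :: "'n::finite scalar_field set" where
  "schwartz = {\<phi>. (\<forall>k. C_diff k \<phi>) \<and>
     (\<forall>\<alpha> \<beta>. bounded (range (\<lambda>x. mi_power x \<alpha> *\<^sub>R mi_deriv \<beta> \<phi> x)))}"

definition schwartz_seminorm ::
    "'n::finite multi_index \<Rightarrow> 'n multi_index \<Rightarrow> 'n scalar_field \<Rightarrow> real" where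
  "schwartz_seminorm \<alpha> \<beta> \<phi> = sup_norm (\<lambda>x. mi_power x \<alpha> *\<^sub>R mi_deriv \<beta> \<phi> x)"

text \<open>A tempered distribution is a linear functional on \<open>schwartz\<close> that is continuous for the
  topology defined by the seminorms, i.e. bounded by finitely many of them. Being
  \<open>extensional\<close> makes equality of distributions the equality on Schwartz functions.\<close>

type_synonym 'n functional = "'n scalar_field \<Rightarrow> complex"

definition tempered :: "'n::finite functional set" where
  "tempered = {T. T \<in> extensional schwartz \<and>
     (\<forall>\<phi>\<in>schwartz. \<forall>\<psi>\<in>schwartz. T (\<lambda>x. \<phi> x + \<psi> x) = T \<phi> + T \<psi>) \<and>
     (\<forall>c. \<forall>\<phi>\<in>schwartz. T (\<lambda>x. c * \<phi> x) = c * T \<phi>) \<and>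
     (\<exists>C N. \<forall>\<phi>\<in>schwartz. norm (T \<phi>) \<le>
        C * (\<Sum>\<alpha> | mi_order \<alpha> \<le> N. \<Sum>\<beta> | mi_order \<beta> \<le> N. schwartz_seminorm \<alpha> \<beta> \<phi>))}"

definition fun_distr :: "'n::finite scalar_field \<Rightarrow> 'n functional" where
  "fun_distr f = (\<lambda>\<phi>\<in>schwartz. LINT x|lborel. f x * \<phi> x)"

definition weak_deriv :: "'n::finite multi_index \<Rightarrow> 'n functional \<Rightarrow> 'n functional" where
  "weak_deriv \<gamma> T = (\<lambda>\<phi>\<in>schwartz. (-1) ^ mi_order \<gamma> * T (mi_deriv \<gamma> \<phi>))"


section \<open>Fourier transform and Fourier multipliers\<close>

definition fourier :: "'n::finite scalar_field \<Rightarrow> 'n scalar_field" where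
  "fourier f \<xi> = (LINT x|lborel. f x * cis (- (2 * pi * (x \<bullet> \<xi>))))"

definition inv_fourier :: "'n::finite scalar_field \<Rightarrow> 'n scalar_field" where
  "inv_fourier f x = (LINT \<xi>|lborel. f \<xi> * cis (2 * pi * (x \<bullet> \<xi>)))"

definition fourier_distr :: "'n::finite functional \<Rightarrow> 'n functional" where
  "fourier_distr T = (\<lambda>\<phi>\<in>schwartz. T (fourier \<phi>))"

definition inv_fourier_distr :: "'n::finite functional \<Rightarrow> 'n functional" where
  "inv_fourier_distr T = (\<lambda>\<phi>\<in>schwartz. T (inv_fourier \<phi>))"

text \<open>Multiplication of a tempered distribution by a function \<open>\<sigma>\<close>, meaningful when \<open>\<sigma>\<close> is smooth
  with all derivatives of at most polynomial growth, so that \<open>\<sigma> \<phi>\<close> is again Schwartz.\<close>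

definition mult_distr :: "'n::finite scalar_field \<Rightarrow> 'n functional \<Rightarrow> 'n functional" where
  "mult_distr \<sigma> T = (\<lambda>\<phi>\<in>schwartz. T (\<lambda>x. \<sigma> x * \<phi> x))"

definition fourier_multiplier :: "'n::finite scalar_field \<Rightarrow> 'n functional \<Rightarrow> 'n functional" where
  "fourier_multiplier \<sigma> T = inv_fourier_distr (mult_distr \<sigma> (fourier_distr T))"


section \<open>The logarithmic Bessel potential spaces\<close>

definition log_symbol :: "real \<Rightarrow> real \<Rightarrow> 'n::finite scalar_field" where
  "log_symbol s lam \<xi> = complex_of_real
     ((lam + 4 * pi\<^sup>2 * (norm \<xi>)\<^sup>2) powr s * ln (lam + 4 * pi\<^sup>2 * (norm \<xi>)\<^sup>2))"

definition log_bessel_op :: "real \<Rightarrow> real \<Rightarrow> 'n::finite functional \<Rightarrow> 'n functional" where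
  "log_bessel_op s lam = fourier_multiplier (log_symbol s lam)"

definition log_bessel_space :: "real \<Rightarrow> real \<Rightarrow> real \<Rightarrow> 'n::finite functional set" where
  "log_bessel_space p s lam = {u \<in> tempered. log_bessel_op s lam u \<in> fun_distr ` Lp p}"

text \<open>The \<open>L\<^sup>p\<close> function representing a distribution is unique up to null sets, so the norm does
  not depend on the choice of representative.\<close>

definition log_bessel_norm :: "real \<Rightarrow> real \<Rightarrow> real \<Rightarrow> 'n::finite functional \<Rightarrow> real" where
  "log_bessel_norm p s lam u =
     Lp_norm p (SOME g. g \<in> Lp p \<and> log_bessel_op s lam u = fun_distr g)"

end

theory Submission
  imports Defs "HOL-Probability.Characteristic_Functions" "HOL-Probability.Sinc_Integral"
begin

text \<open>The operator is inverted by an explicit kernel. Put \<open>A = lam + 4 \<pi>\<^sup>2 |\<xi>|\<^sup>2\<close>. Then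
  \<open>1 / (A\<^sup>s ln A)\<close> is the integral of \<open>A\<close> to the power \<open>-t\<close> over \<open>t > s\<close>, and this power is a Gamma
  integral of \<open>exp (- (A * \<tau>))\<close> over \<open>\<tau> > 0\<close>. Hence the inverse symbol is the Laplace transform of a
  positive weight \<open>wt s\<close> (\<open>wt_laplace\<close>), and \<open>u\<close> is a superposition of heat semigroups: with \<open>g\<close> the
  \<open>L\<^sup>p\<close> function that represents the operator applied to \<open>u\<close>, the function \<open>rep g []\<close>, which integrates
  \<open>exp (- (lam * \<tau>)) * wt s \<tau>\<close> times the convolution of \<open>g\<close> with the heat kernel at time \<open>\<tau>\<close>, represents
  \<open>u\<close> (\<open>log_bessel_potential_eq_rep\<close>). The weight is at most a constant times
  \<open>\<tau> powr (s - 1) / ln (1 / \<tau>)\<close> near \<open>0\<close> and grows more slowly than \<open>exp (lam * \<tau>)\<close> at infinity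
  (\<open>weight_bound\<close>).

  Let \<open>1 / p + 1 / q = 1\<close>. A derivative of order \<open>m\<close> of the heat kernel has norm
  \<open>\<tau> powr (- m / 2 - n / (2 * p))\<close> in \<open>L\<^sup>q\<close>, so at the critical index the sum of the norms is the
  integral of \<open>1 / (\<tau> * ln (1 / \<tau>))\<close>, which diverges. The logarithm pays off only when Hoelder's
  inequality is applied jointly in time and space, with a power of \<open>|x - y|\<close> moved from one factor to
  the other (\<open>kernel_Holder\<close>). By scaling, the factor with \<open>g\<close> integrates in time to a constant, and the
  other factor leaves the integral of \<open>\<omega> \<tau> powr q / \<tau>\<close>, where \<open>\<omega> \<tau> = 1 / ln (1 / \<tau>)\<close> near \<open>0\<close>; this
  converges because \<open>q > 1\<close>.

  The modulus of continuity comes from the same estimate (\<open>rep_modulus\<close>). Times below \<open>|h|\<close> contribute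
  the \<open>q\<close>-th root of the integral of \<open>\<omega> \<tau> powr q / \<tau>\<close> over \<open>\<tau> < |h|\<close>, which is a multiple of
  \<open>ln (1 / |h|) powr (- 1 / p)\<close>; for later times the mean value theorem gains \<open>|h| * \<tau> powr (- 1 / 2)\<close>
  and the contribution is only of order \<open>|h| powr (1 / 2)\<close>. Continuity follows from the modulus, and
  decay at infinity from a truncation of \<open>g\<close> (\<open>rep_vanishes\<close>). Derivatives of \<open>rep g []\<close> of order at most
  \<open>m\<close> fall on the heat kernel (\<open>rep_has_pd\<close>), which gives classical and weak derivatives at once.

  To identify \<open>u\<close> with \<open>rep g []\<close>, every Schwartz function must be reached by the transposed operator.
  This needs Fourier inversion and the stability of Schwartz functions under the Fourier transform and
  under multiplication by the symbol and its inverse. All of this is organised around families of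
  derivatives indexed by lists of directions; the only derivatives of a given Schwartz function used
  before the inversion theorem are those in a single direction, so that the symmetry of mixed
  derivatives is a consequence of the inversion theorem (\<open>schwartz_imp_ctrl\<close>).\<close>

section \<open>Directional derivatives and families of derivatives\<close>

text \<open>A relation rather than the function \<open>partial_deriv\<close>, so that existence of the derivative and its
  value are carried by one fact.\<close>

definition has_pd :: "'n::finite scalar_field \<Rightarrow> 'n \<Rightarrow> 'n scalar_field \<Rightarrow> bool" where
  "has_pd f i f' \<longleftrightarrow> (\<forall>x. ((\<lambda>t. f (x + t *\<^sub>R axis i 1)) has_vector_derivative f' x) (at 0))"

lemma has_pd_partial_deriv: "has_pd f i f' \<Longrightarrow> partial_deriv i f = f'"
  unfolding has_pd_def partial_deriv_def by (auto intro!: ext vector_derivative_at)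

lemma has_pd_differentiable:
  "has_pd f i f' \<Longrightarrow> (\<lambda>t. f (x + t *\<^sub>R axis i 1)) differentiable (at 0)"
  unfolding has_pd_def by (auto intro: differentiableI_vector)

lemma has_pd_of_differentiable:
  "(\<And>x. (\<lambda>t. f (x + t *\<^sub>R axis i 1)) differentiable (at 0)) \<Longrightarrow> has_pd f i (partial_deriv i f)"
  unfolding has_pd_def partial_deriv_def by (simp add: vector_derivative_works)

lemma has_pd_line:
  assumes "has_pd f i f'"
  shows "((\<lambda>t. f (x + t *\<^sub>R axis i 1)) has_vector_derivative f' (x + t *\<^sub>R axis i 1)) (at t within S)"
proof -
  have "((\<lambda>r. f ((x + t *\<^sub>R axis i 1) + r *\<^sub>R axis i 1)) has_vector_derivative f' (x + t *\<^sub>R axis i 1)) (at (t - t))"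
    using assms unfolding has_pd_def by simp
  moreover have "((\<lambda>r. r - t) has_vector_derivative 1) (at t)"
    by (auto intro!: derivative_eq_intros)
  ultimately have "((\<lambda>r. f ((x + t *\<^sub>R axis i 1) + (r - t) *\<^sub>R axis i 1)) has_vector_derivative f' (x + t *\<^sub>R axis i 1)) (at t)"
    using vector_diff_chain_at[of "\<lambda>r. r - t" 1 t] by (fastforce simp: o_def)
  thus ?thesis by (auto simp: algebra_simps intro: has_vector_derivative_at_within)
qed

lemma has_pd_add: "has_pd f i f' \<Longrightarrow> has_pd g i g' \<Longrightarrow> has_pd (\<lambda>x. f x + g x) i (\<lambda>x. f' x + g' x)"
  unfolding has_pd_def by (auto intro!: derivative_intros)

lemma has_pd_mult:
  assumes "has_pd f i f'" "has_pd g i g'"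
  shows "has_pd (\<lambda>x. f x * g x) i (\<lambda>x. f' x * g x + f x * g' x)"
  unfolding has_pd_def
proof
  fix x
  show "((\<lambda>t. f (x + t *\<^sub>R axis i 1) * g (x + t *\<^sub>R axis i 1)) has_vector_derivative f' x * g x + f x * g' x) (at 0)"
    using has_vector_derivative_mult[of "\<lambda>t. f (x + t *\<^sub>R axis i 1)" "f' x" 0 UNIV "\<lambda>t. g (x + t *\<^sub>R axis i 1)" "g' x"] assms
    unfolding has_pd_def by (simp add: add.commute)
qed

lemma has_pd_const: "has_pd (\<lambda>x. c) i (\<lambda>x. 0)"
  unfolding has_pd_def by (auto intro!: derivative_eq_intros)

lemma has_pd_coord: "has_pd (\<lambda>x. complex_of_real (x $ j)) (i :: 'n::finite) (\<lambda>x. if i = j then 1 else 0)"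
proof -
  have "(\<lambda>t. complex_of_real ((x + t *\<^sub>R axis i 1) $ j)) = (\<lambda>t. complex_of_real (x $ j) + t *\<^sub>R (if i = j then 1 else 0))"
    for x :: "real^'n"
    by (auto simp: axis_def fun_eq_iff scaleR_conv_of_real[where ?'a = complex])
  thus ?thesis unfolding has_pd_def by (auto intro!: derivative_eq_intros)
qed

text \<open>If all derivatives are exhibited at once, indexed by the list of directions in which they are taken,
  smoothness and the values of \<open>mi_deriv\<close> need no computation with \<open>partial_deriv\<close>. The same device
  serves for Fourier transforms and for the potentials \<open>rep g\<close>.\<close>

lemma C_diff_family:
  assumes "\<And>ds. length ds \<le> k \<Longrightarrow> continuous_on UNIV (F ds)"
    and "\<And>ds i. length ds < k \<Longrightarrow> has_pd (F ds) i (F (i # ds))"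
  shows "length ds + j \<le> k \<Longrightarrow> C_diff j (F ds)"
proof (induction j arbitrary: ds)
  case 0 thus ?case using assms(1) by simp
next
  case (Suc j)
  have "has_pd (F ds) i (F (i # ds))" for i using Suc.prems by (intro assms(2)) simp
  moreover have "C_diff j (F (i # ds))" for i using Suc.prems by (intro Suc.IH) simp
  ultimately show ?case using Suc.prems
    by (simp add: assms(1)) (metis has_pd_differentiable has_pd_partial_deriv)
qed

text \<open>The directions in the order in which \<open>mi_deriv\<close> uses them.\<close>

definition mi_list :: "'n::finite multi_index \<Rightarrow> 'n list" where
  "mi_list \<gamma> = concat (map (\<lambda>i. replicate (\<gamma> i) i) coords)"

lemma coords: "distinct (coords :: 'n::finite list)" "set (coords :: 'n list) = UNIV"
proof -
  have "\<exists>is :: 'n list. distinct is \<and> set is = UNIV"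
    using finite_distinct_list[of "UNIV :: 'n set"] by auto
  from someI_ex[OF this] show "distinct (coords :: 'n::finite list)" "set (coords :: 'n list) = UNIV"
    unfolding coords_def by auto
qed

lemma foldr_funpow: "foldr (\<lambda>i. f i ^^ \<gamma> i) is z = foldr f (concat (map (\<lambda>i. replicate (\<gamma> i) i) is)) z"
proof (induction "is")
  case (Cons a "is")
  have "foldr f (replicate m a) z = (f a ^^ m) z" for m z by (induction m) auto
  thus ?case using Cons by simp
qed simp

lemma mi_deriv_foldr: "mi_deriv \<gamma> f = foldr partial_deriv (mi_list \<gamma>) f"
  unfolding mi_deriv_def mi_list_def by (rule foldr_funpow)

lemma length_mi_list: "length (mi_list \<gamma>) = mi_order (\<gamma> :: 'n::finite multi_index)"
  unfolding mi_list_def mi_order_def length_concat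
  by (simp add: o_def sum_list_distinct_conv_sum_set[OF coords(1)] coords(2))

lemma foldr_partial_family:
  assumes "\<And>ds i. length ds < k \<Longrightarrow> has_pd (F ds) i (F (i # ds))" "length ds \<le> k"
  shows "foldr partial_deriv ds (F []) = F ds"
  using assms(2)
proof (induction ds)
  case (Cons i ds)
  thus ?case using assms(1)[of ds i] by (simp add: has_pd_partial_deriv)
qed simp

section \<open>Rapidly decreasing and slowly increasing functions\<close>

definition rapid0 :: "'n::finite scalar_field \<Rightarrow> bool" where
  "rapid0 f \<longleftrightarrow> continuous_on UNIV f \<and> (\<forall>N::nat. \<exists>C. \<forall>x. (1 + norm x) ^ N * norm (f x) \<le> C)"

definition slow0 :: "'n::finite scalar_field \<Rightarrow> bool" where
  "slow0 f \<longleftrightarrow> continuous_on UNIV f \<and> (\<exists>N::nat. \<exists>C. \<forall>x. norm (f x) \<le> C * (1 + norm x) ^ N)"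

text \<open>\<open>D\<close> is the set of directions in which derivatives are taken and \<open>P\<close> a growth condition on all of them
  up to order \<open>k\<close>. For \<open>D = UNIV\<close> and \<open>P = rapid0\<close> these are the Schwartz functions
  (\<open>schwartz_iff\<close>). The case \<open>D = {i}\<close> is weaker and is all that integration by parts against a
  character requires.\<close>

primrec ctrl :: "'n::finite set \<Rightarrow> ('n scalar_field \<Rightarrow> bool) \<Rightarrow> nat \<Rightarrow> 'n scalar_field \<Rightarrow> bool" where
  "ctrl D P 0 f \<longleftrightarrow> P f"
| "ctrl D P (Suc k) f \<longleftrightarrow> P f \<and> (\<forall>i\<in>D. \<exists>f'. has_pd f i f' \<and> ctrl D P k f')"

lemma ctrl_base: "ctrl D P k f \<Longrightarrow> P f"
  by (cases k) auto

lemma ctrl_SucD: "ctrl D P (Suc k) f \<Longrightarrow> ctrl D P k f"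
  by (induction k arbitrary: f) (auto, blast)

lemma ctrl_subset: "ctrl D P k f \<Longrightarrow> D' \<subseteq> D \<Longrightarrow> ctrl D' P k f"
  by (induction k arbitrary: f) (auto, blast)

lemma ctrl_add:
  assumes "\<And>f g. P f \<Longrightarrow> P g \<Longrightarrow> P (\<lambda>x. f x + g x)"
  shows "ctrl D P k f \<Longrightarrow> ctrl D P k g \<Longrightarrow> ctrl D P k (\<lambda>x. f x + g x)"
proof (induction k arbitrary: f g)
  case (Suc k)
  have "\<exists>h. has_pd (\<lambda>x. f x + g x) i h \<and> ctrl D P k h" if i: "i \<in> D" for i
  proof -
    obtain f' where "has_pd f i f'" "ctrl D P k f'" using Suc.prems(1) i by auto
    moreover obtain g' where "has_pd g i g'" "ctrl D P k g'" using Suc.prems(2) i by auto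
    ultimately show ?thesis using Suc.IH[of f' g'] has_pd_add by blast
  qed
  thus ?case using Suc.prems assms by simp
qed (simp add: assms)

lemma ctrl_mult:
  assumes add: "\<And>f g. Q f \<Longrightarrow> Q g \<Longrightarrow> Q (\<lambda>x. f x + g x)"
    and mult: "\<And>f g. P f \<Longrightarrow> Q g \<Longrightarrow> Q (\<lambda>x. f x * g x)"
  shows "ctrl D P k f \<Longrightarrow> ctrl D Q k g \<Longrightarrow> ctrl D Q k (\<lambda>x. f x * g x)"
proof (induction k arbitrary: f g)
  case (Suc k)
  have "\<exists>h. has_pd (\<lambda>x. f x * g x) i h \<and> ctrl D Q k h" if "i \<in> D" for i
  proof -
    obtain f' where "has_pd f i f'" "ctrl D P k f'" using Suc.prems(1) \<open>i \<in> D\<close> unfolding ctrl.simps by blast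
    moreover obtain g' where "has_pd g i g'" "ctrl D Q k g'" using Suc.prems(2) \<open>i \<in> D\<close> unfolding ctrl.simps by blast
    ultimately have *: "has_pd f i f'" "ctrl D P k f'" "has_pd g i g'" "ctrl D Q k g'" by auto
    have "ctrl D Q k (\<lambda>x. f' x * g x + f x * g' x)"
      using Suc.IH[OF *(2) ctrl_SucD[OF Suc.prems(2)]] Suc.IH[OF ctrl_SucD[OF Suc.prems(1)] *(4)] add
      by (intro ctrl_add) auto
    thus ?thesis using has_pd_mult[OF *(1,3)] by blast
  qed
  thus ?case using Suc.prems mult by auto
qed (simp add: mult)

lemma ctrl_family:
  assumes "\<And>ds. P (F ds)" "\<And>ds i. i \<in> D \<Longrightarrow> has_pd (F ds) i (F (i # ds))"
  shows "ctrl D P k (F ds)"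
proof (induction k arbitrary: ds)
  case (Suc k)
  thus ?case using assms by (simp, blast)
qed (simp add: assms)

lemma slow0_add: assumes "slow0 f" "slow0 g" shows "slow0 (\<lambda>x. f x + g x)"
proof -
  obtain N C M B where *: "\<And>x. norm (f x) \<le> C * (1 + norm x) ^ N" "\<And>x. norm (g x) \<le> B * (1 + norm x) ^ M"
    using assms unfolding slow0_def by blast
  have "norm (f x + g x) \<le> (\<bar>C\<bar> + \<bar>B\<bar>) * (1 + norm x) ^ (N + M)" for x
  proof -
    have "norm (f x) \<le> \<bar>C\<bar> * (1 + norm x) ^ (N + M)"
      by (rule order.trans[OF *(1)]) (intro mult_mono power_increasing, auto)
    moreover have "norm (g x) \<le> \<bar>B\<bar> * (1 + norm x) ^ (N + M)"
      by (rule order.trans[OF *(2)]) (intro mult_mono power_increasing, auto)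
    ultimately show ?thesis using norm_triangle_ineq[of "f x" "g x"] by (simp add: algebra_simps)
  qed
  thus ?thesis using assms unfolding slow0_def by (blast intro: continuous_intros)
qed

lemma slow0_mult: assumes "slow0 f" "slow0 g" shows "slow0 (\<lambda>x. f x * g x)"
proof -
  obtain N C M B where *: "\<And>x. norm (f x) \<le> C * (1 + norm x) ^ N" "\<And>x. norm (g x) \<le> B * (1 + norm x) ^ M"
    using assms unfolding slow0_def by blast
  have "norm (f x * g x) \<le> (C * B) * (1 + norm x) ^ (N + M)" for x
  proof -
    have "norm (f x) * norm (g x) \<le> (C * (1 + norm x) ^ N) * (B * (1 + norm x) ^ M)"
      by (intro mult_mono *) (use order.trans[OF norm_ge_zero *(1)] in auto)
    thus ?thesis by (simp add: norm_mult power_add algebra_simps)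
  qed
  thus ?thesis using assms unfolding slow0_def by (blast intro: continuous_intros)
qed

lemma rapid0_add: assumes "rapid0 f" "rapid0 g" shows "rapid0 (\<lambda>x. f x + g x)"
  unfolding rapid0_def
proof (intro conjI allI)
  show "continuous_on UNIV (\<lambda>x. f x + g x)"
    using assms unfolding rapid0_def by (auto intro: continuous_intros)
  fix N
  obtain C B where *: "\<And>x. (1 + norm x) ^ N * norm (f x) \<le> C" "\<And>x. (1 + norm x) ^ N * norm (g x) \<le> B"
    using assms unfolding rapid0_def by metis
  have "(1 + norm x) ^ N * norm (f x + g x) \<le> C + B" for x
  proof -
    have "(1 + norm x) ^ N * norm (f x + g x) \<le> (1 + norm x) ^ N * (norm (f x) + norm (g x))"
      by (intro mult_left_mono norm_triangle_ineq) auto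
    thus ?thesis using *[of x] by (simp add: algebra_simps)
  qed
  thus "\<exists>C. \<forall>x. (1 + norm x) ^ N * norm (f x + g x) \<le> C" by blast
qed

lemma slow0_rapid0_mult: assumes "slow0 f" "rapid0 g" shows "rapid0 (\<lambda>x. f x * g x)"
  unfolding rapid0_def
proof (intro conjI allI)
  show "continuous_on UNIV (\<lambda>x. f x * g x)"
    using assms unfolding rapid0_def slow0_def by (auto intro: continuous_intros)
  fix K
  obtain N C where 1: "\<And>x. norm (f x) \<le> C * (1 + norm x) ^ N"
    using assms(1) unfolding slow0_def by blast
  obtain B where 2: "\<And>x. (1 + norm x) ^ (K + N) * norm (g x) \<le> B"
    using assms(2) unfolding rapid0_def by metis
  have C: "C \<ge> 0" using order.trans[OF norm_ge_zero 1[of 0]] by simp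
  have "(1 + norm x) ^ K * norm (f x * g x) \<le> C * B" for x
  proof -
    have "(1 + norm x) ^ K * norm (f x * g x) \<le> (1 + norm x) ^ K * ((C * (1 + norm x) ^ N) * norm (g x))"
      unfolding norm_mult by (intro mult_left_mono mult_right_mono 1) auto
    also have "\<dots> = C * ((1 + norm x) ^ (K + N) * norm (g x))" by (simp add: power_add)
    also have "\<dots> \<le> C * B" by (intro mult_left_mono 2 C)
    finally show ?thesis .
  qed
  thus "\<exists>C. \<forall>x. (1 + norm x) ^ K * norm (f x * g x) \<le> C" by blast
qed

lemma rapid0_bounded: "rapid0 f \<Longrightarrow> \<exists>C. \<forall>x. norm (f x) \<le> C"
  unfolding rapid0_def by (metis mult_1 power_0)

lemma slow0_const: "slow0 (\<lambda>x. c)"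
  unfolding slow0_def by (auto intro!: exI[of _ "0::nat"] exI[of _ "norm c"])

lemma slow0_coord: "slow0 (\<lambda>x. complex_of_real (x $ (j :: 'n::finite)))"
proof -
  have *: "norm (complex_of_real (x $ j)) \<le> 1 * (1 + norm x) ^ 1" for x :: "real^'n"
    using component_le_norm_cart[of x j] by simp
  show ?thesis unfolding slow0_def
    by (intro conjI exI[of _ 1] allI *) (intro continuous_intros)
qed

lemma ctrl_slow_const: "ctrl D slow0 k (\<lambda>x. c)"
proof (induction k arbitrary: c)
  case (Suc k)
  have "has_pd (\<lambda>x. c) i (\<lambda>x. 0) \<and> ctrl D slow0 k (\<lambda>x. 0)" for i using has_pd_const Suc by blast
  thus ?case using slow0_const[of c] by (simp, blast)
qed (simp add: slow0_const)

lemma ctrl_slow_coord: "ctrl D slow0 k (\<lambda>x. complex_of_real (x $ j))"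
proof (cases k)
  case (Suc l)
  have "has_pd (\<lambda>x. complex_of_real (x $ j)) i (\<lambda>x. if i = j then 1 else 0) \<and> ctrl D slow0 l (\<lambda>x. if i = j then 1 else 0)" for i
    using has_pd_coord ctrl_slow_const by blast
  thus ?thesis unfolding Suc using slow0_coord[of j] by (simp, blast)
qed (simp add: slow0_coord)

lemmas ctrl_slow_mult = ctrl_mult[of slow0 slow0, OF slow0_add slow0_mult]
lemmas ctrl_slow_add = ctrl_add[of slow0, OF slow0_add]
lemmas ctrl_slow_rapid_mult = ctrl_mult[of rapid0 slow0, OF rapid0_add slow0_rapid0_mult]

lemma C_diff_ctrl: "ctrl UNIV rapid0 k f \<Longrightarrow> C_diff k f"
proof (induction k arbitrary: f)
  case (Suc k)
  have "(\<forall>x. (\<lambda>t. f (x + t *\<^sub>R axis i 1)) differentiable (at 0)) \<and> C_diff k (partial_deriv i f)" for i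
  proof -
    obtain f' where "has_pd f i f'" "ctrl UNIV rapid0 k f'" using Suc.prems by auto
    thus ?thesis using Suc.IH[of f'] by (simp add: has_pd_partial_deriv has_pd_differentiable)
  qed
  thus ?case using ctrl_base[OF Suc.prems] by (simp add: rapid0_def)
qed (simp add: rapid0_def)

lemma ctrl_foldr_partial:
  "ctrl UNIV rapid0 (length ds + k) f \<Longrightarrow> ctrl UNIV rapid0 k (foldr partial_deriv ds f)"
proof (induction ds arbitrary: k)
  case (Cons i ds)
  have "ctrl UNIV rapid0 (Suc k) (foldr partial_deriv ds f)" using Cons.prems by (intro Cons.IH) simp
  then obtain g where "has_pd (foldr partial_deriv ds f) i g" "ctrl UNIV rapid0 k g" by auto
  thus ?case by (simp add: has_pd_partial_deriv)
qed simp

lemma mi_power_le: "\<bar>mi_power x \<alpha>\<bar> \<le> (1 + norm x) ^ mi_order \<alpha>"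
  unfolding mi_power_def mi_order_def power_sum abs_prod power_abs
  by (intro prod_mono conjI power_mono) (auto intro: order.trans[OF component_le_norm_cart])

lemma ctrl_imp_schwartz:
  assumes "\<And>k. ctrl UNIV rapid0 k f"
  shows "(f :: 'n::finite scalar_field) \<in> schwartz"
  unfolding schwartz_def
proof (safe)
  show "C_diff k f" for k by (rule C_diff_ctrl[OF assms])
  fix \<alpha> \<beta> :: "'n multi_index"
  have "rapid0 (mi_deriv \<beta> f)"
    unfolding mi_deriv_foldr using ctrl_foldr_partial[of "mi_list \<beta>" 0 f] assms by simp
  then obtain C where C: "\<And>x. (1 + norm x) ^ mi_order \<alpha> * norm (mi_deriv \<beta> f x) \<le> C"
    unfolding rapid0_def by metis
  have "norm (mi_power x \<alpha> *\<^sub>R mi_deriv \<beta> f x) \<le> C" for x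
    by (rule order.trans[OF _ C[of x]]) (auto intro!: mult_right_mono mi_power_le)
  thus "bounded (range (\<lambda>x. mi_power x \<alpha> *\<^sub>R mi_deriv \<beta> f x))"
    unfolding bounded_iff by auto
qed

lemma one_plus_norm_power_le:
  fixes x :: "real^'n::finite"
  shows "(1 + norm x) ^ N \<le> (real CARD('n) + 1) ^ N * (1 + (\<Sum>j\<in>UNIV. \<bar>x $ j\<bar> ^ N))"
proof -
  define M where "M = Max (insert 1 (range (\<lambda>j. \<bar>x $ j\<bar>)))"
  have M1: "1 \<le> M" and Mj: "\<bar>x $ j\<bar> \<le> M" for j unfolding M_def by (auto intro!: Max_ge simp del: Max_insert)
  have "norm x \<le> (\<Sum>j\<in>UNIV. \<bar>x $ j\<bar>)" by (rule norm_le_l1_cart)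
  also have "\<dots> \<le> real CARD('n) * M" using sum_bounded_above[of UNIV "\<lambda>j. \<bar>x $ j\<bar>" M] Mj by simp
  finally have "1 + norm x \<le> (real CARD('n) + 1) * M" using M1 by (simp add: algebra_simps)
  hence "(1 + norm x) ^ N \<le> (real CARD('n) + 1) ^ N * M ^ N"
    by (metis add_nonneg_nonneg norm_ge_zero power_mono power_mult_distrib zero_le_one)
  moreover have "M ^ N \<le> 1 + (\<Sum>j\<in>UNIV. \<bar>x $ j\<bar> ^ N)"
  proof -
    have "M \<in> insert 1 (range (\<lambda>j. \<bar>x $ j\<bar>))" unfolding M_def by (intro Max_in) auto
    then consider "M = 1" | j where "M = \<bar>x $ j\<bar>" by auto
    thus ?thesis
    proof cases
      case 2
      show ?thesis unfolding 2 using member_le_sum[of j UNIV "\<lambda>j. \<bar>x $ j\<bar> ^ N"] by simp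
    qed (simp add: sum_nonneg)
  qed
  ultimately show ?thesis by (meson mult_left_mono order_trans zero_le_power add_nonneg_nonneg of_nat_0_le_iff zero_le_one)
qed

text \<open>Decay in each coordinate separately is what integration by parts yields for a Fourier transform.\<close>

lemma rapid0I:
  assumes "continuous_on UNIV f" "\<And>j N. \<exists>C. \<forall>x. \<bar>x $ j\<bar> ^ N * norm (f x) \<le> C"
  shows "rapid0 (f :: 'n::finite scalar_field)"
  unfolding rapid0_def
proof (intro conjI allI)
  fix N
  obtain C where C: "\<And>j x. \<bar>x $ j\<bar> ^ N * norm (f x) \<le> C j" using assms(2)[of _ N] by metis
  obtain B where B: "\<And>x. norm (f x) \<le> B" using assms(2)[of _ 0] by auto
  have "(1 + norm x) ^ N * norm (f x) \<le> (real CARD('n) + 1) ^ N * (B + (\<Sum>j\<in>UNIV. C j))" for x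
  proof -
    have "(1 + norm x) ^ N * norm (f x) \<le> ((real CARD('n) + 1) ^ N * (1 + (\<Sum>j\<in>UNIV. \<bar>x $ j\<bar> ^ N))) * norm (f x)"
      by (intro mult_right_mono one_plus_norm_power_le) auto
    also have "\<dots> = (real CARD('n) + 1) ^ N * (norm (f x) + (\<Sum>j\<in>UNIV. \<bar>x $ j\<bar> ^ N * norm (f x)))"
      by (simp add: algebra_simps sum_distrib_right sum_distrib_left)
    also have "\<dots> \<le> (real CARD('n) + 1) ^ N * (B + (\<Sum>j\<in>UNIV. C j))"
      by (intro mult_left_mono add_mono sum_mono B C) auto
    finally show ?thesis .
  qed
  thus "\<exists>C. \<forall>x. (1 + norm x) ^ N * norm (f x) \<le> C" by blast
qed fact

lemma prod_power_single: "(\<Prod>i\<in>UNIV. f i ^ (if i = (j::'n::finite) then N else 0)) = (f j :: 'b :: comm_monoid_mult) ^ N"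
proof -
  have "(\<Prod>i\<in>UNIV. f i ^ (if i = j then N else 0)) = (\<Prod>i\<in>UNIV. if i = j then f j ^ N else 1)"
    by (rule prod.cong) auto
  thus ?thesis by simp
qed

lemma mi_deriv_single:
  "mi_deriv (\<lambda>i::'n::finite. if i = j then k else 0) f = (partial_deriv j ^^ k) f"
proof -
  have *: "foldr (\<lambda>i. partial_deriv i ^^ (if i = j then k else 0)) is f = (if j \<in> set is then (partial_deriv j ^^ k) f else f)"
    if "distinct is" for "is"
    using that by (induction "is") auto
  show ?thesis unfolding mi_deriv_def by (simp add: *[OF coords(1)] coords(2))
qed

text \<open>For a multi-index supported in one coordinate, \<open>mi_deriv\<close> is an iterated partial derivative whatever
  the order of \<open>coords\<close>. Mixed derivatives in another order than that of \<open>coords\<close> are not accessible at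
  this point.\<close>

lemma schwartz_imp_ctrl_pure:
  assumes "f \<in> schwartz"
  shows "ctrl {i} rapid0 k f"
proof -
  let ?F = "\<lambda>m. (partial_deriv i ^^ m) f"
  have C: "C_diff l (?F m)" for l m
  proof (induction m arbitrary: l)
    case 0 thus ?case using assms unfolding schwartz_def by simp
  next
    case (Suc m)
    show ?case using Suc.IH[of "Suc l"] unfolding C_diff.simps(2) by simp
  qed
  have pd: "has_pd (?F m) i (?F (Suc m))" for m
    using C[of "Suc 0" m] by (auto intro!: has_pd_of_differentiable)
  have rap: "rapid0 (?F m)" for m
  proof (rule rapid0I)
    show "continuous_on UNIV (?F m)" using C[of 0 m] by simp
    fix j N
    have "bounded (range (\<lambda>x. mi_power x (\<lambda>i. if i = j then N else 0) *\<^sub>R mi_deriv (\<lambda>j. if j = i then m else 0) f x))"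
      using assms unfolding schwartz_def by blast
    thus "\<exists>C. \<forall>x. \<bar>x $ j\<bar> ^ N * norm (?F m x) \<le> C"
      unfolding mi_deriv_single mi_power_def prod_power_single bounded_iff by (auto simp: power_abs)
  qed
  have "ctrl {i} rapid0 k (?F m)" for m
  proof (induction k arbitrary: m)
    case (Suc k)
    have "has_pd (?F m) i (?F (Suc m)) \<and> ctrl {i} rapid0 k (?F (Suc m))" using pd Suc by blast
    thus ?case using rap[of m] unfolding ctrl.simps by blast
  qed (simp only: rap ctrl.simps)
  from this[of 0] show ?thesis by simp
qed

section \<open>Affine substitution and product integrals\<close>

lemma lborel_affine_integrable:
  fixes f :: "'a::euclidean_space \<Rightarrow> 'b::{banach,second_countable_topology}"
  assumes "integrable lborel f" "r \<noteq> 0"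
  shows "integrable lborel (\<lambda>x. f (t + r *\<^sub>R x))"
proof -
  have [measurable]: "f \<in> borel_measurable borel" using borel_measurable_integrable[OF assms(1)] by simp
  have "integrable (density (distr lborel borel (\<lambda>x. t + r *\<^sub>R x)) (\<lambda>_. ennreal (\<bar>r\<bar>^DIM('a)))) f"
    using assms lborel_affine[OF assms(2), of t] by (simp add: ennreal_power)
  hence "integrable lborel (\<lambda>x. \<bar>r\<bar>^DIM('a) *\<^sub>R f (t + r *\<^sub>R x))"
    by (simp add: integrable_density integrable_distr_eq)
  from integrable_scaleR_right[OF this, of "inverse (\<bar>r\<bar>^DIM('a))"] show ?thesis using assms(2) by simp
qed

lemma lborel_affine_integral:
  fixes f :: "'a::euclidean_space \<Rightarrow> 'b::{banach,second_countable_topology}"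
  assumes [measurable]: "f \<in> borel_measurable borel" and "r \<noteq> 0"
  shows "(LINT x|lborel. f x) = \<bar>r\<bar>^DIM('a) *\<^sub>R (LINT x|lborel. f (t + r *\<^sub>R x))"
proof -
  have "(LINT x|lborel. f x) = (LINT x|density (distr lborel borel (\<lambda>x. t + r *\<^sub>R x)) (\<lambda>_. ennreal (\<bar>r\<bar>^DIM('a))). f x)"
    using assms lborel_affine[OF assms(2), of t] by (simp add: ennreal_power)
  thus ?thesis by (simp add: integral_density integral_distr)
qed

lemma lborel_affine_nn_integral:
  fixes f :: "'a::euclidean_space \<Rightarrow> ennreal"
  assumes [measurable]: "f \<in> borel_measurable borel" and "r \<noteq> 0"
  shows "(\<integral>\<^sup>+x. f x \<partial>lborel) = ennreal (\<bar>r\<bar>^DIM('a)) * (\<integral>\<^sup>+x. f (t + r *\<^sub>R x) \<partial>lborel)"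
proof -
  have "(\<integral>\<^sup>+x. f x \<partial>lborel) = (\<integral>\<^sup>+x. f x \<partial>density (distr lborel borel (\<lambda>x. t + r *\<^sub>R x)) (\<lambda>_. ennreal (\<bar>r\<bar>^DIM('a))))"
    using assms lborel_affine[OF assms(2), of t] by (simp add: ennreal_power)
  thus ?thesis by (simp add: nn_integral_density nn_integral_distr nn_integral_cmult)
qed

text \<open>Fubini's theorem for a product of functions of one coordinate each, transported from the product
  measure along the basis.\<close>

lemma lborel_prod_cart:
  fixes f :: "'n::finite \<Rightarrow> real \<Rightarrow> 'b::{real_normed_field,banach,second_countable_topology}"
  assumes int: "\<And>i. integrable lborel (f i)"
  shows "integrable lborel (\<lambda>x::real^'n. \<Prod>i\<in>UNIV. f i (x $ i))"
    and "(LINT x|(lborel::(real^'n) measure). (\<Prod>i\<in>UNIV. f i (x $ i))) = (\<Prod>i\<in>UNIV. (LINT t|lborel. f i t))"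
proof -
  interpret product_sigma_finite "\<lambda>b::real^'n. lborel :: real measure" ..
  have [measurable]: "f i \<in> borel_measurable borel" for i using borel_measurable_integrable[OF int[of i]] by simp
  define ax where "ax = (\<lambda>i::'n. axis i (1::real) :: real^'n)"
  have B: "Basis = range ax" by (auto simp: Basis_vec_def ax_def)
  have inj: "inj ax" by (auto simp: inj_on_def ax_def axis_eq_axis)
  define g where "g = (\<lambda>b. f (inv ax b))"
  have gi: "g (ax i) = f i" for i using inj by (simp add: g_def)
  have intg: "integrable lborel (g b)" for b unfolding g_def by (rule int)
  have comp: "(\<Sum>b\<in>Basis. \<omega> b *\<^sub>R b) $ i = \<omega> (ax i)" for \<omega> :: "real^'n \<Rightarrow> real" and i
  proof -
    have "(\<Sum>b\<in>Basis. \<omega> b *\<^sub>R b) $ i = (\<Sum>j\<in>UNIV. if j = i then \<omega> (ax j) else 0)"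
      unfolding B sum.reindex[OF inj] sum_component o_def
      by (rule sum.cong) (auto simp: ax_def axis_def)
    thus ?thesis by simp
  qed
  have eq: "(\<Prod>i\<in>UNIV. f i ((\<Sum>b\<in>Basis. \<omega> b *\<^sub>R b) $ i)) = (\<Prod>b\<in>Basis. g b (\<omega> b))" for \<omega> :: "real^'n \<Rightarrow> real"
    unfolding comp unfolding B prod.reindex[OF inj] by (simp add: gi)
  have [measurable]: "(\<lambda>x::real^'n. \<Prod>i\<in>UNIV. f i (x $ i)) \<in> borel_measurable borel" by measurable
  show "integrable lborel (\<lambda>x::real^'n. \<Prod>i\<in>UNIV. f i (x $ i))"
  proof (subst lborel_eq, subst integrable_distr_eq)
    show "integrable (Pi\<^sub>M Basis (\<lambda>b. lborel)) (\<lambda>\<omega>. \<Prod>i\<in>UNIV. f i ((\<Sum>b\<in>Basis. \<omega> b *\<^sub>R b) $ i))"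
      unfolding eq by (rule product_integrable_prod) (auto intro: intg)
  qed measurable
  have "(LINT x|(lborel::(real^'n) measure). (\<Prod>i\<in>UNIV. f i (x $ i))) = (LINT \<omega>|Pi\<^sub>M Basis (\<lambda>b. lborel). (\<Prod>b\<in>Basis. g b (\<omega> b)))"
    by (subst lborel_eq, subst integral_distr) (simp_all only: eq, measurable)
  also have "\<dots> = (\<Prod>b\<in>Basis. (LINT t|lborel. g b t))" by (rule product_integral_prod) (auto intro: intg)
  also have "\<dots> = (\<Prod>i\<in>UNIV. (LINT t|lborel. f i t))" unfolding B prod.reindex[OF inj] by (simp add: gi)
  finally show "(LINT x|(lborel::(real^'n) measure). (\<Prod>i\<in>UNIV. f i (x $ i))) = (\<Prod>i\<in>UNIV. (LINT t|lborel. f i t))" .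
qed

lemma rapid0_measurable [measurable_dest]: "rapid0 f \<Longrightarrow> f \<in> borel_measurable borel"
  unfolding rapid0_def by (auto intro: borel_measurable_continuous_onI)

text \<open>The function \<open>(1 + |x|)\<close> to the power \<open>2 n\<close> dominates the product of the \<open>1 + (x $ i)\<^sup>2\<close>, whose
  inverse is integrable.\<close>

lemma rapid0_integrable:
  fixes f :: "'n::finite scalar_field"
  assumes "rapid0 f"
  shows "integrable lborel f"
proof -
  obtain C where C: "\<And>x. (1 + norm x) ^ (2 * CARD('n)) * norm (f x) \<le> C"
    using assms unfolding rapid0_def by metis
  have C0: "C \<ge> 0" using order.trans[OF _ C[of 0]] by simp
  let ?h = "\<lambda>x::real^'n. \<Prod>i\<in>UNIV. inverse (1 + (x $ i)\<^sup>2)"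
  have "integrable lborel (\<lambda>t::real. inverse (1 + t\<^sup>2))"
    using integrable_inverse_1_plus_square unfolding set_integrable_def by simp
  from lborel_prod_cart(1)[of "\<lambda>i. \<lambda>t. inverse (1 + t\<^sup>2)", OF this]
  have "integrable lborel ?h" .
  hence "integrable lborel (\<lambda>x. C * ?h x)" by simp
  thus ?thesis
  proof (rule Bochner_Integration.integrable_bound)
    show "f \<in> borel_measurable lborel" using rapid0_measurable[OF assms] by simp
    have "norm (f x) \<le> C * ?h x" for x
    proof -
      have "(\<Prod>i\<in>UNIV. 1 + (x $ i)\<^sup>2) \<le> (\<Prod>i\<in>(UNIV::'n set). (1 + norm x)\<^sup>2)"
      proof (intro prod_mono conjI)
        fix i
        have "(x $ i)\<^sup>2 \<le> (norm x)\<^sup>2" by (metis component_le_norm_cart norm_ge_zero power2_abs power_mono abs_ge_zero)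
        hence "(x $ i)\<^sup>2 + 0 \<le> (norm x)\<^sup>2 + 2 * norm x" by (rule add_mono) simp
        thus "1 + (x $ i)\<^sup>2 \<le> (1 + norm x)\<^sup>2" by (simp add: power2_sum)
      qed (auto intro: add_nonneg_nonneg)
      hence "(\<Prod>i\<in>UNIV. 1 + (x $ i)\<^sup>2) * norm (f x) \<le> (1 + norm x) ^ (2 * CARD('n)) * norm (f x)"
        by (intro mult_right_mono) (auto simp: power_mult)
      also note C
      finally have "(\<Prod>i\<in>UNIV. 1 + (x $ i)\<^sup>2) * norm (f x) \<le> C" .
      moreover have "(\<Prod>i\<in>UNIV. 1 + (x $ i)\<^sup>2) > 0" by (intro prod_pos) (auto intro: add_pos_nonneg)
      moreover have "?h x = inverse (\<Prod>i\<in>UNIV. 1 + (x $ i)\<^sup>2)"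
        using prod_inversef[of "\<lambda>i. 1 + (x $ i)\<^sup>2" UNIV] by (simp only: o_def)
      ultimately show ?thesis by (metis divide_inverse mult.commute pos_le_divide_eq)
    qed
    thus "AE x in lborel. norm (f x) \<le> norm (C * ?h x)"
      by (intro AE_I2) (rule order.trans, assumption, simp)
  qed
qed

section \<open>Differentiation under the integral and integration by parts\<close>

text \<open>The increment of the integral is the integral of \<open>J r = (LINT y|N. k' r y)\<close> by Fubini's theorem, so
  the fundamental theorem of calculus applies once \<open>J\<close> is continuous. Only the integral of \<open>|k'|\<close> has to
  be bounded, uniformly in \<open>r\<close>; a majorant of \<open>k'\<close> that is uniform in \<open>r\<close> would fail for heat kernels at
  small times.\<close>

lemma has_vector_derivative_lebesgue_integral:
  fixes k k' :: "real \<Rightarrow> 'b \<Rightarrow> complex"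
  assumes N: "sigma_finite_measure N"
    and meas [measurable]: "(\<lambda>(r, y). k' r y) \<in> borel_measurable (borel \<Otimes>\<^sub>M N)"
    and der: "\<And>y r. y \<in> space N \<Longrightarrow> ((\<lambda>r. k r y) has_vector_derivative k' r y) (at r)"
    and cont: "\<And>y. y \<in> space N \<Longrightarrow> continuous_on UNIV (\<lambda>r. k' r y)"
    and int: "\<And>r. integrable N (k r)"
    and int': "\<And>r. integrable N (k' r)"
    and bound: "\<And>r. (LINT y|N. norm (k' r y)) \<le> B"
    and contJ: "continuous_on UNIV (\<lambda>r. LINT y|N. k' r y)"
  shows "((\<lambda>r. LINT y|N. k r y) has_vector_derivative (LINT y|N. k' 0 y)) (at 0)"
proof -
  interpret N: sigma_finite_measure N by fact
  interpret P: pair_sigma_finite "lborel :: real measure" N ..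
  define I where "I = (\<lambda>r. LINT y|N. k r y)"
  define J where "J = (\<lambda>r. LINT y|N. k' r y)"
  have Jm [measurable]: "J \<in> borel_measurable borel"
    unfolding J_def by (rule borel_measurable_continuous_onI[OF contJ])
  have FTC: "I b - I a = integral {a..b} J" if "a \<le> b" for a b
  proof -
    let ?f = "\<lambda>r y. indicator {a..b} r *\<^sub>R k' r y"
    have fm [measurable]: "case_prod ?f \<in> borel_measurable (lborel \<Otimes>\<^sub>M N)" by measurable
    have integ: "integrable (lborel \<Otimes>\<^sub>M N) (case_prod ?f)"
    proof (rule P.Fubini_integrable[OF fm])
      have "integrable lborel (\<lambda>r. indicator {a..b} r *\<^sub>R B)" by (intro integrable_scaleR_left integrable_real_indicator) (auto simp: emeasure_lborel_Icc_eq)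
      thus "integrable lborel (\<lambda>r. LINT y|N. norm (case_prod ?f (r, y)))"
      proof (rule Bochner_Integration.integrable_bound)
        have "norm (LINT y|N. norm (case_prod ?f (r, y))) \<le> norm (indicator {a..b} r *\<^sub>R B)" for r
          using order.trans[OF bound[of r] abs_ge_self] by (cases "r \<in> {a..b}") auto
        thus "AE r in lborel. norm (LINT y|N. norm (case_prod ?f (r, y))) \<le> norm (indicator {a..b} r *\<^sub>R B)"
          by (intro AE_I2)
      qed measurable
      show "AE r in lborel. integrable N (\<lambda>y. case_prod ?f (r, y))"
        by (intro AE_I2) (auto intro: int')
    qed
    have "I b - I a = (LINT y|N. k b y - k a y)" unfolding I_def by (simp add: int)
    also have "\<dots> = (LINT y|N. LINT r|lborel. ?f r y)"
    proof (rule Bochner_Integration.integral_cong[OF refl])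
      fix y assume y: "y \<in> space N"
      show "k b y - k a y = (LINT r|lborel. ?f r y)"
        by (rule integral_FTC_Icc[symmetric, OF that])
          (use der[OF y] cont[OF y] in \<open>auto intro: has_vector_derivative_at_within continuous_on_subset\<close>)
    qed
    also have "\<dots> = (LINT r|lborel. LINT y|N. ?f r y)" by (rule P.Fubini_integral[OF integ])
    also have "\<dots> = (LINT r:{a..b}|lborel. J r)" unfolding J_def set_lebesgue_integral_def by simp
    also have "\<dots> = integral {a..b} J"
      by (rule set_borel_integral_eq_integral(2), unfold set_integrable_def,
          rule borel_integrable_compact) (use contJ in \<open>auto simp: J_def intro: continuous_on_subset\<close>)
    finally show ?thesis .
  qed
  have "((\<lambda>r. integral {-1..r} J) has_vector_derivative J 0) (at 0 within {-1..1})"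
    by (rule integral_has_vector_derivative[OF continuous_on_subset[OF contJ[folded J_def]]]) auto
  hence "((\<lambda>r. integral {-1..r} J) has_vector_derivative J 0) (at 0)"
    by (simp add: at_within_Icc_at)
  hence "((\<lambda>r. I (-1) + integral {-1..r} J) has_vector_derivative J 0) (at 0)"
    by (auto intro!: derivative_eq_intros)
  hence "(I has_vector_derivative J 0) (at 0)"
    by (rule has_vector_derivative_transform_within_open[where S="{-1<..<1}"]) (simp_all add: FTC[symmetric])
  thus ?thesis unfolding I_def J_def .
qed

text \<open>The integral of \<open>F (x + r e)\<close> does not depend on \<open>r\<close>, so its derivative at \<open>r = 0\<close> vanishes.\<close>

lemma integral_partial_deriv_eq_0:
  fixes F :: "'n::finite scalar_field"
  assumes pd: "has_pd F i F'" and int: "integrable lborel F" "integrable lborel F'"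
    and cont: "continuous_on UNIV F'"
  shows "(LINT x|lborel. F' x) = 0"
proof -
  let ?e = "axis i 1 :: real^'n"
  have [measurable]: "F' \<in> borel_measurable borel" "F \<in> borel_measurable borel"
    using int[THEN borel_measurable_integrable] by auto
  have sh: "(LINT x|lborel. g (x + r *\<^sub>R ?e)) = (LINT x|lborel. g x)"
    if [measurable]: "g \<in> borel_measurable borel" for g :: "real^'n \<Rightarrow> 'b::{banach,second_countable_topology}" and r
    using lborel_affine_integral[of g 1 "r *\<^sub>R ?e"] by (simp add: add.commute)
  have shi: "integrable lborel (\<lambda>x. g (x + r *\<^sub>R ?e))" if "integrable lborel g" for g :: "real^'n \<Rightarrow> complex" and r
    using lborel_affine_integrable[of g 1 "r *\<^sub>R ?e"] that by (simp add: add.commute)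
  have "((\<lambda>r. LINT x|lborel. F (x + r *\<^sub>R ?e)) has_vector_derivative (LINT x|lborel. F' (x + 0 *\<^sub>R ?e))) (at 0)"
  proof (rule has_vector_derivative_lebesgue_integral[where B = "LINT x|lborel. norm (F' x)"])
    show "((\<lambda>r. F (x + r *\<^sub>R ?e)) has_vector_derivative F' (x + r *\<^sub>R ?e)) (at r)" for x r
      by (rule has_pd_line[OF pd])
    show "continuous_on UNIV (\<lambda>r. F' (x + r *\<^sub>R ?e))" for x
      by (rule continuous_on_compose2[OF cont]) (auto intro!: continuous_intros)
    show "continuous_on UNIV (\<lambda>r. LINT x|lborel. F' (x + r *\<^sub>R ?e))" by (subst sh) auto
    show "(LINT x|lborel. norm (F' (x + r *\<^sub>R ?e))) \<le> (LINT x|lborel. norm (F' x))" for r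
      using sh[of "\<lambda>x. norm (F' x)"] by simp
  qed (auto intro!: shi int lborel.sigma_finite_measure_axioms)
  hence "((\<lambda>r. LINT x|lborel. F x) has_vector_derivative (LINT x|lborel. F' x)) (at 0)"
    by (subst (asm) sh) auto
  moreover have "((\<lambda>r. LINT x|lborel. F x) has_vector_derivative 0) (at (0::real))"
    by (auto intro!: derivative_eq_intros)
  ultimately show ?thesis using vector_derivative_unique_at by blast
qed

lemma rapid0_bounded_mult:
  assumes "rapid0 f" "continuous_on UNIV g" "\<And>x. norm (g x) \<le> B"
  shows "rapid0 (\<lambda>x. g x * f x)"
  by (rule slow0_rapid0_mult) (use assms in \<open>auto simp: slow0_def intro!: exI[of _ "0::nat"] exI[of _ B]\<close>)

lemma integration_by_parts:
  fixes f :: "'n::finite scalar_field"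
  assumes "has_pd f i f'" "has_pd g i g'" "rapid0 f" "rapid0 f'"
    and "continuous_on UNIV g" "continuous_on UNIV g'"
    and "\<And>x. norm (g x) \<le> B" "\<And>x. norm (g' x) \<le> B'"
  shows "(LINT x|lborel. g' x * f x) = - (LINT x|lborel. g x * f' x)"
proof -
  have i: "rapid0 (\<lambda>x. g x * f x)" "rapid0 (\<lambda>x. g' x * f x)" "rapid0 (\<lambda>x. g x * f' x)"
    using assms by (auto intro: rapid0_bounded_mult)
  have "(LINT x|lborel. g' x * f x + g x * f' x) = 0"
    by (rule integral_partial_deriv_eq_0[OF has_pd_mult[OF assms(2,1)]])
      (use i in \<open>auto intro!: rapid0_integrable rapid0_add, auto simp: rapid0_def intro: continuous_on_add\<close>)
  thus ?thesis using i by (simp add: rapid0_integrable add_eq_0_iff)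
qed

section \<open>The heat kernel and its derivatives\<close>

text \<open>Hermite polynomials in the scaling for which the \<open>k\<close>-th derivative of \<open>exp (- u\<^sup>2 / 4)\<close> is
  \<open>poly (heat_poly k) u * exp (- u\<^sup>2 / 4)\<close>.\<close>

primrec heat_poly :: "nat \<Rightarrow> real poly" where
  "heat_poly 0 = 1"
| "heat_poly (Suc k) = pderiv (heat_poly k) - smult (1/2) (pCons 0 (heat_poly k))"

definition heat1 :: "nat \<Rightarrow> real \<Rightarrow> real \<Rightarrow> real" where
  "heat1 k \<tau> t = (1 / sqrt (4 * pi * \<tau>)) * (1 / sqrt \<tau>) ^ k * poly (heat_poly k) (t / sqrt \<tau>) * exp (- t\<^sup>2 / (4 * \<tau>))"

text \<open>The derivative in the directions \<open>ds\<close> of the \<open>n\<close>-dimensional heat kernel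
  \<open>exp (- (norm x)\<^sup>2 / (4 * \<tau>)) / sqrt (4 * pi * \<tau>) ^ n\<close>.\<close>

definition heat :: "'n::finite list \<Rightarrow> real \<Rightarrow> real^'n \<Rightarrow> real" where
  "heat ds \<tau> x = (\<Prod>i\<in>UNIV. heat1 (count_list ds i) \<tau> (x $ i))"

lemma heat1_deriv:
  assumes "\<tau> > 0"
  shows "(heat1 k \<tau> has_real_derivative heat1 (Suc k) \<tau> t) (at t)"
proof -
  have t: "t / sqrt \<tau> / sqrt \<tau> = t / \<tau>" using assms by (simp add: divide_divide_eq_left)
  have D1: "((\<lambda>t. poly (heat_poly k) (t / sqrt \<tau>)) has_real_derivative poly (pderiv (heat_poly k)) (t / sqrt \<tau>) * (1 / sqrt \<tau>)) (at t)"
    by (rule DERIV_chain2[OF poly_DERIV]) (rule DERIV_cdivide[OF DERIV_ident])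
  have D2: "((\<lambda>t. exp (- t\<^sup>2 / (4 * \<tau>))) has_real_derivative exp (- t\<^sup>2 / (4 * \<tau>)) * (- (t / \<tau>) / 2)) (at t)"
    by (rule DERIV_chain2[OF DERIV_exp]) (use assms in \<open>auto intro!: derivative_eq_intros simp: field_simps\<close>)
  have "(heat1 k \<tau> has_real_derivative
      (1 / sqrt (4 * pi * \<tau>)) * (1 / sqrt \<tau>) ^ k *
      (poly (pderiv (heat_poly k)) (t / sqrt \<tau>) * (1 / sqrt \<tau>) * exp (- t\<^sup>2 / (4 * \<tau>))
       + poly (heat_poly k) (t / sqrt \<tau>) * (exp (- t\<^sup>2 / (4 * \<tau>)) * (- (t / \<tau>) / 2)))) (at t)"
    using DERIV_cmult[OF DERIV_mult[OF D1 D2], of "(1 / sqrt (4 * pi * \<tau>)) * (1 / sqrt \<tau>) ^ k"]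
    unfolding heat1_def[abs_def] by (simp add: mult_ac add_ac)
  also have "(1 / sqrt (4 * pi * \<tau>)) * (1 / sqrt \<tau>) ^ k *
      (poly (pderiv (heat_poly k)) (t / sqrt \<tau>) * (1 / sqrt \<tau>) * exp (- t\<^sup>2 / (4 * \<tau>))
       + poly (heat_poly k) (t / sqrt \<tau>) * (exp (- t\<^sup>2 / (4 * \<tau>)) * (- (t / \<tau>) / 2))) = heat1 (Suc k) \<tau> t"
    unfolding heat1_def heat_poly.simps t[symmetric] by (simp add: algebra_simps)
  finally show ?thesis .
qed

lemma continuous_heat1: "\<tau> > 0 \<Longrightarrow> continuous_on S (heat1 k \<tau>)"
  using DERIV_continuous_on[of S "heat1 k \<tau>"] heat1_deriv has_field_derivative_at_within by blast

lemma continuous_heat: "\<tau> > 0 \<Longrightarrow> continuous_on S (heat ds \<tau>)"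
  unfolding heat_def[abs_def]
  by (intro continuous_intros continuous_on_compose2[OF continuous_heat1[of _ UNIV]]) auto

lemma measurable_poly [measurable]: "(\<lambda>x. poly (p::real poly) x) \<in> borel_measurable borel"
  by (intro borel_measurable_continuous_onI continuous_intros)

lemma measurable_heat1 [measurable]: "(\<lambda>(\<tau>, t). heat1 k \<tau> t) \<in> borel_measurable (borel \<Otimes>\<^sub>M borel)"
  unfolding heat1_def by measurable

lemma measurable_vec_component [measurable]: "(\<lambda>x::real^'n::finite. x $ i) \<in> borel_measurable borel"
  by (intro borel_measurable_continuous_onI continuous_intros)

lemma measurable_heat [measurable]: "(\<lambda>(\<tau>, x). heat ds \<tau> x) \<in> borel_measurable (borel \<Otimes>\<^sub>M borel)"
  unfolding heat_def by measurable

lemma poly_le_exp_square: "\<epsilon> > 0 \<Longrightarrow> \<exists>C>0. \<forall>u. \<bar>poly p u\<bar> \<le> C * exp (\<epsilon> * u\<^sup>2)" for p :: "real poly"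
proof (induction p arbitrary: \<epsilon>)
  case 0
  show ?case by (rule exI[of _ 1]) simp
next
  case (pCons a p)
  obtain C where C: "C > 0" "\<And>u. \<bar>poly p u\<bar> \<le> C * exp (\<epsilon> / 2 * u\<^sup>2)"
    using pCons.IH[of "\<epsilon>/2"] pCons.prems by auto
  have "\<bar>poly (pCons a p) u\<bar> \<le> (\<bar>a\<bar> + (1 + 2 / \<epsilon>) * C) * exp (\<epsilon> * u\<^sup>2)" for u
  proof -
    have u: "\<bar>u\<bar> \<le> (1 + 2 / \<epsilon>) * exp (\<epsilon> / 2 * u\<^sup>2)"
    proof -
      have "\<bar>u\<bar> \<le> 1 + u\<^sup>2"
        using zero_le_power2[of "\<bar>u\<bar> - 1"] abs_ge_zero[of u] unfolding power2_diff by simp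
      also have "\<dots> \<le> (1 + 2 / \<epsilon>) * (1 + \<epsilon> / 2 * u\<^sup>2)" using pCons.prems by (simp add: field_simps)
      also have "\<dots> \<le> (1 + 2 / \<epsilon>) * exp (\<epsilon> / 2 * u\<^sup>2)"
        using pCons.prems by (intro mult_left_mono exp_ge_add_one_self) auto
      finally show ?thesis .
    qed
    have "\<bar>poly (pCons a p) u\<bar> \<le> \<bar>a\<bar> + \<bar>u\<bar> * \<bar>poly p u\<bar>"
      by (simp add: abs_mult[symmetric] abs_triangle_ineq)
    also have "\<dots> \<le> \<bar>a\<bar> * exp (\<epsilon> * u\<^sup>2) + ((1 + 2 / \<epsilon>) * exp (\<epsilon> / 2 * u\<^sup>2)) * (C * exp (\<epsilon> / 2 * u\<^sup>2))"
      using pCons.prems by (intro add_mono mult_mono C u) (auto simp: mult_le_cancel_left1)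
    also have "\<dots> = (\<bar>a\<bar> + (1 + 2 / \<epsilon>) * C) * exp (\<epsilon> * u\<^sup>2)"
    proof -
      have "exp (\<epsilon> / 2 * u\<^sup>2) * exp (\<epsilon> / 2 * u\<^sup>2) = exp (\<epsilon> * u\<^sup>2)" by (simp add: exp_add[symmetric])
      thus ?thesis by (simp add: algebra_simps)
    qed
    finally show ?thesis .
  qed
  moreover have "\<bar>a\<bar> + (1 + 2 / \<epsilon>) * C > 0" using C(1) pCons.prems by (simp add: add_nonneg_pos add_pos_pos)
  ultimately show ?case by blast
qed

lemma heat1_bound: "\<exists>C>0. \<forall>\<tau>>0. \<forall>t. \<bar>heat1 k \<tau> t\<bar> \<le> C * \<tau> powr (- (1 + real k) / 2) * exp (- t\<^sup>2 / (8 * \<tau>))"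
proof -
  obtain C where C: "C > 0" "\<And>u. \<bar>poly (heat_poly k) u\<bar> \<le> C * exp (1/8 * u\<^sup>2)"
    using poly_le_exp_square[of "1/8" "heat_poly k"] by auto
  have "\<bar>heat1 k \<tau> t\<bar> \<le> C * \<tau> powr (- (1 + real k) / 2) * exp (- t\<^sup>2 / (8 * \<tau>))" if \<tau>: "\<tau> > 0" for \<tau> t
  proof -
    have p: "(1 / sqrt \<tau>) ^ k = \<tau> powr (- real k / 2)" using \<tau>
      by (simp add: powr_half_sqrt[symmetric] powr_minus_divide[symmetric] powr_powr powr_realpow[symmetric])
    have q: "1 / sqrt (4 * pi * \<tau>) \<le> \<tau> powr (- 1 / 2)"
    proof -
      have "1 / sqrt (4 * pi * \<tau>) \<le> 1 / sqrt \<tau>" using \<tau> pi_gt3 by (intro divide_left_mono) auto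
      thus ?thesis using \<tau> by (simp add: powr_half_sqrt[symmetric] powr_minus_divide)
    qed
    have "\<bar>heat1 k \<tau> t\<bar> = (1 / sqrt (4 * pi * \<tau>)) * \<tau> powr (- real k / 2) * \<bar>poly (heat_poly k) (t / sqrt \<tau>)\<bar> * exp (- t\<^sup>2 / (4 * \<tau>))"
      unfolding heat1_def p using \<tau> by (simp add: abs_mult)
    also have "\<dots> \<le> \<tau> powr (- 1 / 2) * \<tau> powr (- real k / 2) * (C * exp (1/8 * (t / sqrt \<tau>)\<^sup>2)) * exp (- t\<^sup>2 / (4 * \<tau>))"
      using \<tau> by (intro mult_right_mono mult_mono q C) auto
    also have "\<dots> = C * \<tau> powr (- (1 + real k) / 2) * exp (- t\<^sup>2 / (8 * \<tau>))"
    proof -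
      have "\<tau> powr (- 1 / 2) * \<tau> powr (- real k / 2) = \<tau> powr (- (1 + real k) / 2)"
        by (simp add: powr_add[symmetric] field_simps)
      moreover have "exp (1/8 * (t / sqrt \<tau>)\<^sup>2) * exp (- t\<^sup>2 / (4 * \<tau>)) = exp (- t\<^sup>2 / (8 * \<tau>))"
        using \<tau> by (simp add: exp_add[symmetric] power_divide field_simps)
      ultimately show ?thesis by (simp add: algebra_simps)
    qed
    finally show ?thesis .
  qed
  thus ?thesis using C(1) by blast
qed

lemma norm_sq_cart: "(norm x)\<^sup>2 = (\<Sum>i\<in>UNIV. (x $ i)\<^sup>2)" for x :: "real^'n::finite"
  by (simp add: norm_vec_def L2_set_def sum_nonneg)

lemma sum_count_list_UNIV: "(\<Sum>i\<in>UNIV. count_list ds i) = length (ds :: 'n::finite list)"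
  using sum_count_set[of ds UNIV] by simp

text \<open>Half of the Gaussian exponent absorbs the polynomial factor.\<close>

lemma heat_bound:
  "\<exists>C>0. \<forall>\<tau>>0. \<forall>x. \<bar>heat ds \<tau> x\<bar>
     \<le> C * \<tau> powr (- (real CARD('n) + real (length ds)) / 2) * exp (- (norm x)\<^sup>2 / (8 * \<tau>))"
  for ds :: "'n::finite list"
proof -
  obtain C where C: "\<And>k. C k > 0" "\<And>k \<tau> t. \<tau> > 0 \<Longrightarrow> \<bar>heat1 k \<tau> t\<bar> \<le> C k * \<tau> powr (- (1 + real k) / 2) * exp (- t\<^sup>2 / (8 * \<tau>))"
    using heat1_bound by metis
  have "\<bar>heat ds \<tau> x\<bar> \<le> (\<Prod>i\<in>UNIV. C (count_list ds i)) * \<tau> powr (- (real CARD('n) + real (length ds)) / 2) * exp (- (norm x)\<^sup>2 / (8 * \<tau>))"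
    if \<tau>: "\<tau> > 0" for \<tau> and x :: "real^'n"
  proof -
    have "\<bar>heat ds \<tau> x\<bar> \<le> (\<Prod>i\<in>UNIV. C (count_list ds i) * \<tau> powr (- (1 + real (count_list ds i)) / 2) * exp (- (x $ i)\<^sup>2 / (8 * \<tau>)))"
      unfolding heat_def abs_prod by (intro prod_mono conjI C(2) \<tau>) auto
    also have "\<dots> = (\<Prod>i\<in>UNIV. C (count_list ds i)) * (\<Prod>i\<in>UNIV. \<tau> powr (- (1 + real (count_list ds i)) / 2)) * (\<Prod>i\<in>UNIV. exp (- (x $ i)\<^sup>2 / (8 * \<tau>)))"
      by (simp add: prod.distrib)
    also have "(\<Prod>i\<in>UNIV. \<tau> powr (- (1 + real (count_list ds i)) / 2)) = \<tau> powr (\<Sum>i\<in>UNIV. - (1 + real (count_list ds i)) / 2)"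
      using \<tau> by (simp add: powr_sum)
    also have "(\<Sum>i\<in>UNIV. - (1 + real (count_list ds i)) / 2) = - (real CARD('n) + real (length ds)) / 2"
      unfolding sum_count_list_UNIV[symmetric] by (simp add: sum_divide_distrib[symmetric] sum_negf sum.distrib sum_subtractf)
    also have "(\<Prod>i\<in>UNIV. exp (- (x $ i)\<^sup>2 / (8 * \<tau>))) = exp (- (norm x)\<^sup>2 / (8 * \<tau>))"
      unfolding norm_sq_cart by (simp add: exp_sum[symmetric] sum_divide_distrib sum_negf)
    finally show ?thesis .
  qed
  moreover have "(\<Prod>i\<in>UNIV. C (count_list ds i)) > 0" using C(1) by (intro prod_pos) auto
  ultimately show ?thesis by blast
qed

lemma heat_nonneg: "\<tau> > 0 \<Longrightarrow> heat [] \<tau> x \<ge> 0"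
  unfolding heat_def heat1_def by (intro prod_nonneg) auto

lemma heat1_0_integral:
  assumes "\<tau> > 0"
  shows "integrable lborel (heat1 0 \<tau>)" "(LINT t|lborel. heat1 0 \<tau> t) = 1"
proof -
  have "heat1 0 \<tau> = normal_density 0 (sqrt (2 * \<tau>))"
    using assms by (auto simp: fun_eq_iff heat1_def normal_density_def)
  thus "integrable lborel (heat1 0 \<tau>)" "(LINT t|lborel. heat1 0 \<tau> t) = 1"
    using assms integrable_normal_density[of "sqrt (2 * \<tau>)" 0] integral_normal_density[of "sqrt (2 * \<tau>)" 0] by auto
qed

lemma heat_integral:
  assumes "\<tau> > 0"
  shows "integrable lborel (heat [] \<tau> :: real^'n::finite \<Rightarrow> real)" "(LINT x|lborel. heat [] \<tau> (x :: real^'n)) = 1"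
  using lborel_prod_cart[of "\<lambda>i::'n. heat1 0 \<tau>"] heat1_0_integral[OF assms]
  unfolding heat_def by simp_all

text \<open>A rescaled form of the characteristic function of the standard normal distribution.\<close>

lemma gaussian_fourier1:
  assumes "\<tau> > 0"
  shows "integrable lborel (\<lambda>t. complex_of_real (exp (- (4 * pi\<^sup>2 * \<tau> * t\<^sup>2))) * cis (2 * pi * z * t))"
    and "(LINT t|lborel. complex_of_real (exp (- (4 * pi\<^sup>2 * \<tau> * t\<^sup>2))) * cis (2 * pi * z * t)) = heat1 0 \<tau> z"
proof -
  define c where "c = 2 * pi * sqrt (2 * \<tau>)"
  have c: "c > 0" using assms by (simp add: c_def)
  let ?g = "\<lambda>y. std_normal_density y *\<^sub>R iexp (z / sqrt (2 * \<tau>) * y)"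
  have g: "?g (0 + c * t) = (1 / sqrt (2 * pi)) *\<^sub>R (complex_of_real (exp (- (4 * pi\<^sup>2 * \<tau> * t\<^sup>2))) * cis (2 * pi * z * t))" for t
  proof -
    have "(c * t)\<^sup>2 / 2 = 4 * pi\<^sup>2 * \<tau> * t\<^sup>2" using assms by (simp add: c_def power_mult_distrib)
    moreover have "z / sqrt (2 * \<tau>) * (c * t) = 2 * pi * z * t" using assms by (simp add: c_def)
    ultimately show ?thesis unfolding std_normal_density_def cis_conv_exp by (simp add: scaleR_conv_of_real)
  qed
  have gi: "integrable lborel ?g"
  proof (rule Bochner_Integration.integrable_bound)
    show "integrable lborel std_normal_density" by simp
  qed (auto simp: norm_mult)
  have "(LINT y|lborel. ?g y) = char std_normal_distribution (z / sqrt (2 * \<tau>))"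
    unfolding char_def by (subst integral_density) (auto intro!: normal_density_nonneg)
  also have "\<dots> = exp (- z\<^sup>2 / (4 * \<tau>))"
    unfolding char_std_normal_distribution using assms by (simp add: power_divide)
  finally have I: "(LINT y|lborel. ?g y) = exp (- z\<^sup>2 / (4 * \<tau>))" .
  let ?h = "\<lambda>t. complex_of_real (exp (- (4 * pi\<^sup>2 * \<tau> * t\<^sup>2))) * cis (2 * pi * z * t)"
  have "integrable lborel (\<lambda>t. ?g (0 + c * t))" by (rule lborel_integrable_real_affine[OF gi]) (use c in simp)
  hence "integrable lborel (\<lambda>t. (1 / sqrt (2 * pi)) *\<^sub>R ?h t)" by (simp only: g)
  from integrable_scaleR_right[OF this, of "sqrt (2 * pi)"] show "integrable lborel ?h" by simp
  have "exp (- z\<^sup>2 / (4 * \<tau>)) = c *\<^sub>R (LINT t|lborel. ?g (0 + c * t))"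
    unfolding I[symmetric] using lborel_integral_real_affine[of c ?g 0] c by simp
  also have "\<dots> = (c / sqrt (2 * pi)) *\<^sub>R (LINT t|lborel. ?h t)" unfolding g by simp
  finally have E: "complex_of_real (exp (- z\<^sup>2 / (4 * \<tau>))) = (c / sqrt (2 * pi)) *\<^sub>R (LINT t|lborel. ?h t)" .
  have cc: "c / sqrt (2 * pi) = sqrt (4 * pi * \<tau>)"
    unfolding c_def using assms by (simp add: real_sqrt_mult field_simps)
  show "(LINT t|lborel. ?h t) = heat1 0 \<tau> z"
    using E assms unfolding cc heat1_def by (simp add: scaleR_conv_of_real field_simps)
qed

lemma cis_sum: "cis (\<Sum>i\<in>A. f i) = (\<Prod>i\<in>A. cis (f i))"
  by (induction A rule: infinite_finite_induct) (auto simp: cis_mult[symmetric])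

lemma gaussian_fourier:
  fixes z :: "real^'n::finite"
  assumes "\<tau> > 0"
  shows "integrable lborel (\<lambda>\<xi>::real^'n. complex_of_real (exp (- (4 * pi\<^sup>2 * \<tau> * (norm \<xi>)\<^sup>2))) * cis (2 * pi * (z \<bullet> \<xi>)))"
    and "(LINT \<xi>|lborel. complex_of_real (exp (- (4 * pi\<^sup>2 * \<tau> * (norm \<xi>)\<^sup>2))) * cis (2 * pi * (z \<bullet> \<xi>))) = heat [] \<tau> z"
proof -
  have *: "complex_of_real (exp (- (4 * pi\<^sup>2 * \<tau> * (norm \<xi>)\<^sup>2))) * cis (2 * pi * (z \<bullet> \<xi>))
    = (\<Prod>i\<in>UNIV. complex_of_real (exp (- (4 * pi\<^sup>2 * \<tau> * (\<xi> $ i)\<^sup>2))) * cis (2 * pi * z $ i * \<xi> $ i))" for \<xi> :: "real^'n"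
    unfolding prod.distrib cis_sum[symmetric] of_real_prod[symmetric] exp_sum[symmetric, OF finite] norm_sq_cart inner_vec_def
    by (simp add: sum_distrib_left sum_negf mult.assoc)
  show "integrable lborel (\<lambda>\<xi>::real^'n. complex_of_real (exp (- (4 * pi\<^sup>2 * \<tau> * (norm \<xi>)\<^sup>2))) * cis (2 * pi * (z \<bullet> \<xi>)))"
    unfolding * by (rule lborel_prod_cart(1)) (rule gaussian_fourier1[OF assms])
  show "(LINT \<xi>|lborel. complex_of_real (exp (- (4 * pi\<^sup>2 * \<tau> * (norm \<xi>)\<^sup>2))) * cis (2 * pi * (z \<bullet> \<xi>))) = heat [] \<tau> z"
    unfolding * by (subst lborel_prod_cart(2)) (simp_all add: gaussian_fourier1[OF assms] heat_def)
qed

section \<open>The Fourier transform on Schwartz functions\<close>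

lemma inv_fourier_eq: "inv_fourier f x = fourier f (- x)"
  unfolding inv_fourier_def fourier_def by (simp add: inner_commute)

lemma measurable_cis [measurable]: "cis \<in> borel_measurable borel"
  by (intro borel_measurable_continuous_onI continuous_intros)

lemma has_vector_derivative_cis: "(cis has_vector_derivative \<i> * cis y) (at y)"
  using has_vector_derivative_real_field[of "\<lambda>z. exp (\<i> * z)" "\<i> * exp (\<i> * y)" y UNIV]
  unfolding cis_conv_exp by (auto intro!: derivative_eq_intros simp: mult.commute)

lemma fourier_integrand_integrable:
  assumes "integrable lborel f"
  shows "integrable lborel (\<lambda>x. f x * cis (- (2 * pi * (x \<bullet> \<xi>))))"
proof (rule Bochner_Integration.integrable_bound[OF assms])
  have [measurable]: "f \<in> borel_measurable borel" using borel_measurable_integrable[OF assms] by simp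
  show "(\<lambda>x. f x * cis (- (2 * pi * (x \<bullet> \<xi>)))) \<in> borel_measurable lborel" by measurable
qed (simp add: norm_mult)

lemma fourier_bounded: "integrable lborel f \<Longrightarrow> norm (fourier f \<xi>) \<le> (LINT x|lborel. norm (f x))"
  unfolding fourier_def by (rule order.trans[OF integral_norm_bound]) (simp add: norm_mult)

lemma continuous_fourier:
  fixes f :: "'n::finite scalar_field"
  assumes "integrable lborel f"
  shows "continuous_on UNIV (fourier f)"
proof (rule continuous_on_sequentiallyI)
  have [measurable]: "f \<in> borel_measurable borel" using borel_measurable_integrable[OF assms] by simp
  fix u :: "nat \<Rightarrow> real^'n" and a assume u: "u \<longlonglongrightarrow> a"
  show "(\<lambda>n. fourier f (u n)) \<longlonglongrightarrow> fourier f a"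
    unfolding fourier_def
  proof (rule integral_dominated_convergence[where w = "\<lambda>x. norm (f x)"])
    show "AE x in lborel. (\<lambda>n. f x * cis (- (2 * pi * (x \<bullet> u n)))) \<longlonglongrightarrow> f x * cis (- (2 * pi * (x \<bullet> a)))"
      by (intro AE_I2 tendsto_intros isCont_tendsto_compose[of _ cis] u)
  qed (use assms in \<open>auto simp: norm_mult\<close>)
qed

lemma fourier_has_pd:
  assumes f: "integrable lborel f" and f': "integrable lborel f'"
    and f'_eq: "\<And>x. f' x = - (2 * pi * \<i>) * complex_of_real (x $ i) * f x"
  shows "has_pd (fourier f) i (fourier f')"
  unfolding has_pd_def
proof
  fix \<xi>
  let ?l = "\<lambda>r. \<xi> + r *\<^sub>R axis i (1::real)"
  have [measurable]: "f' \<in> borel_measurable borel" using borel_measurable_integrable[OF f'] by simp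
  have [measurable]: "f \<in> borel_measurable borel" using borel_measurable_integrable[OF f] by simp
  have ax: "x \<bullet> axis i 1 = x $ i" for x :: "real^'a" by (simp add: inner_axis)
  have "((\<lambda>r. fourier f (?l r)) has_vector_derivative (LINT x|lborel. f' x * cis (- (2 * pi * (x \<bullet> ?l 0))))) (at 0)"
    unfolding fourier_def
  proof (rule has_vector_derivative_lebesgue_integral[where B = "LINT x|lborel. norm (f' x)"])
    show "((\<lambda>r. f x * cis (- (2 * pi * (x \<bullet> ?l r)))) has_vector_derivative
        f' x * cis (- (2 * pi * (x \<bullet> ?l r)))) (at r)" for x r
    proof -
      have "((\<lambda>r. - (2 * pi * (x \<bullet> ?l r))) has_real_derivative - (2 * pi * (x $ i))) (at r)"
        unfolding inner_add_right inner_scaleR_right ax by (auto intro!: derivative_eq_intros)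
      hence "((\<lambda>r. - (2 * pi * (x \<bullet> ?l r))) has_vector_derivative - (2 * pi * (x $ i))) (at r)"
        by (simp add: has_real_derivative_iff_has_vector_derivative)
      moreover note has_vector_derivative_cis
      ultimately have "((\<lambda>r. cis (- (2 * pi * (x \<bullet> ?l r)))) has_vector_derivative
          (- (2 * pi * (x $ i))) *\<^sub>R (\<i> * cis (- (2 * pi * (x \<bullet> ?l r))))) (at r)"
        using vector_diff_chain_at[of "\<lambda>r. - (2 * pi * (x \<bullet> ?l r))"] by (fastforce simp: o_def)
      from has_vector_derivative_mult_right[OF this, of "f x"]
      show ?thesis by (simp add: f'_eq scaleR_conv_of_real mult_ac)
    qed
    show "continuous_on UNIV (\<lambda>r. f' x * cis (- (2 * pi * (x \<bullet> ?l r))))" for x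
      by (intro continuous_intros)
    show "continuous_on UNIV (\<lambda>r. LINT x|lborel. f' x * cis (- (2 * pi * (x \<bullet> ?l r))))"
      by (rule continuous_on_compose2[OF continuous_fourier[OF f', unfolded fourier_def[abs_def]]])
        (auto intro!: continuous_intros)
    show "(LINT x|lborel. norm (f' x * cis (- (2 * pi * (x \<bullet> ?l r))))) \<le> (LINT x|lborel. norm (f' x))" for r
      by (simp add: norm_mult)
  qed (auto intro!: fourier_integrand_integrable f f' lborel.sigma_finite_measure_axioms simp: split_def)
  thus "((\<lambda>r. fourier f (?l r)) has_vector_derivative fourier f' \<xi>) (at 0)"
    by (simp add: fourier_def)
qed

lemma fourier_of_partial:
  assumes "has_pd f i f'" "rapid0 f" "rapid0 f'"
  shows "fourier f' \<xi> = (2 * pi * \<i>) * complex_of_real (\<xi> $ i) * fourier f \<xi>"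
proof -
  let ?c = "- (2 * pi * \<i>) * complex_of_real (\<xi> $ i)"
  have "((\<lambda>r. cis (- (2 * pi * ((x + r *\<^sub>R axis i 1) \<bullet> \<xi>)))) has_vector_derivative ?c * cis (- (2 * pi * (x \<bullet> \<xi>)))) (at 0)" for x
  proof -
    have "((\<lambda>r. - (2 * pi * ((x + r *\<^sub>R axis i 1) \<bullet> \<xi>))) has_real_derivative - (2 * pi * (\<xi> $ i))) (at 0)"
      unfolding inner_add_left inner_scaleR_left inner_axis' by (auto intro!: derivative_eq_intros)
    hence "((\<lambda>r. - (2 * pi * ((x + r *\<^sub>R axis i 1) \<bullet> \<xi>))) has_vector_derivative - (2 * pi * (\<xi> $ i))) (at 0)"
      by (simp add: has_real_derivative_iff_has_vector_derivative)
    moreover note has_vector_derivative_cis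
    ultimately have "((\<lambda>r. cis (- (2 * pi * ((x + r *\<^sub>R axis i 1) \<bullet> \<xi>)))) has_vector_derivative
          (- (2 * pi * (\<xi> $ i))) *\<^sub>R (\<i> * cis (- (2 * pi * ((x + 0 *\<^sub>R axis i 1) \<bullet> \<xi>))))) (at 0)"
      using vector_diff_chain_at[of "\<lambda>r. - (2 * pi * ((x + r *\<^sub>R axis i 1) \<bullet> \<xi>))"] by (fastforce simp: o_def)
    thus ?thesis by (simp add: scaleR_conv_of_real mult_ac)
  qed
  hence pd: "has_pd (\<lambda>x. cis (- (2 * pi * (x \<bullet> \<xi>)))) i (\<lambda>x. ?c * cis (- (2 * pi * (x \<bullet> \<xi>))))"
    unfolding has_pd_def by blast
  have "(LINT x|lborel. ?c * cis (- (2 * pi * (x \<bullet> \<xi>))) * f x) = - (LINT x|lborel. cis (- (2 * pi * (x \<bullet> \<xi>))) * f' x)"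
    by (rule integration_by_parts[OF assms(1) pd assms(2,3), where B = 1 and B' = "norm ?c"])
      (auto intro!: continuous_intros simp: norm_mult)
  moreover have "c * fourier f \<xi> = (LINT x|lborel. c * cis (- (2 * pi * (x \<bullet> \<xi>))) * f x)" for c
    unfolding fourier_def by (subst integral_mult_right_zero[symmetric]) (simp only: mult_ac)
  moreover have "(LINT x|lborel. cis (- (2 * pi * (x \<bullet> \<xi>))) * f' x) = fourier f' \<xi>"
    unfolding fourier_def by (simp only: mult.commute)
  ultimately have "- fourier f' \<xi> = ?c * fourier f \<xi>" by metis
  thus ?thesis by (simp only: mult_minus_left neg_equal_iff_equal)
qed

text \<open>Each power of \<open>\<xi> $ i\<close> costs one integration by parts in direction \<open>i\<close>, and no other direction.\<close>

lemma fourier_decay: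
  "ctrl {i} rapid0 N f \<Longrightarrow> \<exists>C. \<forall>\<xi>. \<bar>\<xi> $ i\<bar> ^ N * norm (fourier f \<xi>) \<le> C"
proof (induction N arbitrary: f)
  case 0
  thus ?case using fourier_bounded[OF rapid0_integrable] by auto
next
  case (Suc N)
  obtain f' where f': "has_pd f i f'" "ctrl {i} rapid0 N f'" using Suc.prems by auto
  obtain C where C: "\<And>\<xi>. \<bar>\<xi> $ i\<bar> ^ N * norm (fourier f' \<xi>) \<le> C" using Suc.IH[OF f'(2)] by blast
  have "\<bar>\<xi> $ i\<bar> ^ Suc N * norm (fourier f \<xi>) \<le> C" for \<xi>
  proof -
    have "norm (fourier f' \<xi>) = 2 * pi * \<bar>\<xi> $ i\<bar> * norm (fourier f \<xi>)"
      using fourier_of_partial[OF f'(1) ctrl_base[OF Suc.prems] ctrl_base[OF f'(2)], of \<xi>]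
      by (simp add: norm_mult)
    moreover have "1 * (\<bar>\<xi> $ i\<bar> * norm (fourier f \<xi>)) \<le> 2 * pi * (\<bar>\<xi> $ i\<bar> * norm (fourier f \<xi>))"
      using pi_gt3 by (intro mult_right_mono) auto
    ultimately have "\<bar>\<xi> $ i\<bar> * norm (fourier f \<xi>) \<le> norm (fourier f' \<xi>)" by simp
    hence "\<bar>\<xi> $ i\<bar> ^ N * (\<bar>\<xi> $ i\<bar> * norm (fourier f \<xi>)) \<le> \<bar>\<xi> $ i\<bar> ^ N * norm (fourier f' \<xi>)"
      by (intro mult_left_mono) auto
    also note C
    finally show ?thesis by (simp add: mult_ac)
  qed
  thus ?case by blast
qed

text \<open>The factor that differentiation of the Fourier transform in the directions \<open>ds\<close> puts in front of the
  integrand.\<close>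

definition fourier_mono :: "'n::finite list \<Rightarrow> 'n scalar_field" where
  "fourier_mono ds x = (\<Prod>j\<leftarrow>ds. - (2 * pi * \<i>) * complex_of_real (x $ j))"

lemma ctrl_slow_fourier_mono: "ctrl D slow0 k (fourier_mono ds)"
proof (induction ds)
  case Nil show ?case unfolding fourier_mono_def by (simp add: ctrl_slow_const)
next
  case (Cons j ds)
  have "ctrl D slow0 k (\<lambda>x. (- (2 * pi * \<i>) * complex_of_real (x $ j)) * fourier_mono ds x)"
    by (intro ctrl_slow_mult Cons ctrl_slow_const ctrl_slow_coord)
  thus ?case unfolding fourier_mono_def by simp
qed

text \<open>Derivatives of the transform, in any order, are multiplications before the transform, and pure
  derivatives of the product give the decay. Control of pure derivatives is thus turned into control of
  all mixed ones.\<close>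

lemma ctrl_fourier:
  assumes pure: "\<And>i k. ctrl {i} rapid0 k f"
  shows "ctrl UNIV rapid0 k (fourier f)"
proof -
  let ?F = "\<lambda>ds. fourier (\<lambda>x. fourier_mono ds x * f x)"
  have c: "ctrl {i} rapid0 k (\<lambda>x. fourier_mono ds x * f x)" for i k ds
    by (intro ctrl_slow_rapid_mult ctrl_slow_fourier_mono pure)
  have int: "integrable lborel (\<lambda>x. fourier_mono ds x * f x)" for ds
    using ctrl_base[OF c] by (rule rapid0_integrable)
  have "ctrl UNIV rapid0 k (?F [])"
  proof (rule ctrl_family[of rapid0 ?F])
    show "rapid0 (?F ds)" for ds
      using fourier_decay[OF c] by (intro rapid0I continuous_fourier int) blast
    show "has_pd (?F ds) i (?F (i # ds))" for ds i
      by (rule fourier_has_pd[OF int int]) (simp add: fourier_mono_def mult_ac)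
  qed
  thus ?thesis by (simp add: fourier_mono_def)
qed

lemma rapid0_reflect:
  assumes "rapid0 f"
  shows "rapid0 (\<lambda>x. f (- x))"
  unfolding rapid0_def
proof (intro conjI allI)
  have c: "continuous_on UNIV f" using assms unfolding rapid0_def by blast
  show "continuous_on UNIV (\<lambda>x. f (- x))"
    by (rule continuous_on_compose2[OF c continuous_on_minus[OF continuous_on_id]]) simp
  fix N
  obtain C where C: "\<And>x. (1 + norm x) ^ N * norm (f x) \<le> C" using assms unfolding rapid0_def by metis
  show "\<exists>C. \<forall>x. (1 + norm x) ^ N * norm (f (- x)) \<le> C"
    using C[of "- x" for x] by (intro exI[of _ C] allI) simp
qed

lemma ctrl_reflect: "ctrl D rapid0 k f \<Longrightarrow> ctrl D rapid0 k (\<lambda>x. f (- x))"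
proof (induction k arbitrary: f)
  case (Suc k)
  have "\<exists>g. has_pd (\<lambda>x. f (- x)) i g \<and> ctrl D rapid0 k g" if "i \<in> D" for i
  proof -
    obtain f' where f': "has_pd f i f'" "ctrl D rapid0 k f'" using Suc.prems \<open>i \<in> D\<close> unfolding ctrl.simps by blast
    have "has_pd (\<lambda>x. f (- x)) i (\<lambda>x. (-1) * f' (- x))"
      unfolding has_pd_def
    proof
      fix x
      have A: "((\<lambda>t. f (- x + t *\<^sub>R axis i 1)) has_vector_derivative f' (- x)) (at (- 0))"
        using f'(1)[unfolded has_pd_def, rule_format, of "- x"] by simp
      have B: "(uminus has_vector_derivative -1) (at (0::real))" by (auto intro!: derivative_eq_intros)
      have "((\<lambda>t. f (- x + (- t) *\<^sub>R axis i 1)) has_vector_derivative (-1) *\<^sub>R f' (- x)) (at 0)"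
        using vector_diff_chain_at[OF B A] by (simp only: o_def)
      thus "((\<lambda>t. f (- (x + t *\<^sub>R axis i 1))) has_vector_derivative (-1) * f' (- x)) (at 0)" by simp
    qed
    moreover have "ctrl D rapid0 k (\<lambda>x. (-1) * f' (- x))"
      by (intro ctrl_slow_rapid_mult ctrl_slow_const Suc.IH f'(2))
    ultimately show ?thesis by blast
  qed
  with rapid0_reflect[OF ctrl_base[OF Suc.prems]] show ?case unfolding ctrl.simps by blast
qed (simp only: ctrl.simps, rule rapid0_reflect)

lemma ctrl_inv_fourier: "(\<And>i k. ctrl {i} rapid0 k f) \<Longrightarrow> ctrl UNIV rapid0 k (inv_fourier f)"
  using ctrl_reflect[OF ctrl_fourier] unfolding inv_fourier_eq[abs_def] by blast

section \<open>Fourier inversion\<close>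

lemma heat_minus: "heat [] \<tau> (- x) = heat [] \<tau> x"
  unfolding heat_def heat1_def by simp

text \<open>Fubini's theorem and the Fourier transform of the Gaussian. For \<open>\<tau>\<close> tending to \<open>0\<close> this is Fourier
  inversion; for fixed \<open>\<tau>\<close> it expresses the heat multiplier as a convolution.\<close>

lemma fourier_gauss_inv_fourier:
  assumes int: "integrable lborel \<psi>" and \<tau>: "\<tau> > 0"
  shows "fourier (\<lambda>\<xi>. complex_of_real (exp (- (4 * pi\<^sup>2 * \<tau> * (norm \<xi>)\<^sup>2))) * inv_fourier \<psi> \<xi>) x
    = (LINT y|lborel. complex_of_real (heat [] \<tau> (x - y)) * \<psi> y)"
proof -
  have [measurable]: "\<psi> \<in> borel_measurable borel" using borel_measurable_integrable[OF int] by simp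
  let ?g = "\<lambda>\<xi>::real^'a. exp (- (4 * pi\<^sup>2 * \<tau> * (norm \<xi>)\<^sup>2))"
  let ?k = "\<lambda>\<xi> y. complex_of_real (?g \<xi>) * \<psi> y * cis (2 * pi * ((y - x) \<bullet> \<xi>))"
  have gi: "integrable lborel ?g"
    using gaussian_fourier(1)[OF \<tau>, of 0, THEN integrable_norm] by (simp add: norm_mult)
  have ki: "integrable (lborel \<Otimes>\<^sub>M lborel) (case_prod ?k)"
  proof (rule lborel_pair.Fubini_integrable)
    show "case_prod ?k \<in> borel_measurable (lborel \<Otimes>\<^sub>M lborel)" by measurable
    show "integrable lborel (\<lambda>\<xi>. LINT y|lborel. norm (case_prod ?k (\<xi>, y)))"
      using gi by (simp add: norm_mult)
    have "integrable lborel (\<lambda>y. ?k \<xi> y)" for \<xi>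
      by (rule Bochner_Integration.integrable_bound[of _ "\<lambda>y. ?g \<xi> *\<^sub>R \<psi> y"])
        (use int in \<open>auto simp: norm_mult\<close>)
    thus "AE \<xi> in lborel. integrable lborel (\<lambda>y. case_prod ?k (\<xi>, y))" by simp
  qed
  have "fourier (\<lambda>\<xi>. ?g \<xi> * inv_fourier \<psi> \<xi>) x = (LINT \<xi>|lborel. LINT y|lborel. ?k \<xi> y)"
    unfolding fourier_def
  proof (rule Bochner_Integration.integral_cong[OF refl])
    fix \<xi>
    have "?g \<xi> * inv_fourier \<psi> \<xi> * cis (- (2 * pi * (\<xi> \<bullet> x)))
      = (?g \<xi> * cis (- (2 * pi * (\<xi> \<bullet> x)))) * inv_fourier \<psi> \<xi>" by (simp only: mult_ac)
    also have "\<dots> = (LINT y|lborel. (?g \<xi> * cis (- (2 * pi * (\<xi> \<bullet> x)))) * (\<psi> y * cis (2 * pi * (\<xi> \<bullet> y))))"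
      unfolding inv_fourier_def by (rule integral_mult_right_zero[symmetric])
    also have "\<dots> = (LINT y|lborel. ?k \<xi> y)"
    proof (rule Bochner_Integration.integral_cong[OF refl])
      fix y
      have "cis (2 * pi * ((y - x) \<bullet> \<xi>)) = cis (- (2 * pi * (\<xi> \<bullet> x))) * cis (2 * pi * (\<xi> \<bullet> y))"
        by (simp add: cis_mult inner_diff_left inner_commute algebra_simps)
      thus "(?g \<xi> * cis (- (2 * pi * (\<xi> \<bullet> x)))) * (\<psi> y * cis (2 * pi * (\<xi> \<bullet> y))) = ?k \<xi> y" by simp
    qed
    finally show "?g \<xi> * inv_fourier \<psi> \<xi> * cis (- (2 * pi * (\<xi> \<bullet> x))) = (LINT y|lborel. ?k \<xi> y)" .
  qed
  also have "\<dots> = (LINT y|lborel. LINT \<xi>|lborel. ?k \<xi> y)"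
    by (rule lborel_pair.Fubini_integral[OF ki, symmetric])
  also have "\<dots> = (LINT y|lborel. complex_of_real (heat [] \<tau> (x - y)) * \<psi> y)"
  proof (rule Bochner_Integration.integral_cong[OF refl])
    fix y
    have "(LINT \<xi>|lborel. ?k \<xi> y) = (LINT \<xi>|lborel. \<psi> y * (complex_of_real (?g \<xi>) * cis (2 * pi * ((y - x) \<bullet> \<xi>))))"
      by (simp add: mult_ac)
    also have "\<dots> = \<psi> y * complex_of_real (heat [] \<tau> (y - x))"
      unfolding integral_mult_right_zero gaussian_fourier(2)[OF \<tau>] ..
    finally show "(LINT \<xi>|lborel. ?k \<xi> y) = complex_of_real (heat [] \<tau> (x - y)) * \<psi> y"
      using heat_minus[of \<tau> "y - x"] by simp
  qed
  finally show ?thesis .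
qed

lemma heat_scale:
  assumes "\<tau> > 0"
  shows "sqrt \<tau> ^ CARD('n) * heat [] \<tau> (sqrt \<tau> *\<^sub>R z) = heat [] 1 (z :: real^'n::finite)"
proof -
  have "sqrt \<tau> * heat1 0 \<tau> (sqrt \<tau> * t) = heat1 0 1 t" for t
    using assms by (simp add: heat1_def real_sqrt_mult power_mult_distrib)
  hence "(\<Prod>i\<in>UNIV. sqrt \<tau> * heat1 0 \<tau> (sqrt \<tau> * z $ i)) = (\<Prod>i\<in>UNIV. heat1 0 1 (z $ i))" by simp
  thus ?thesis unfolding heat_def by (simp add: prod.distrib)
qed

text \<open>After the substitution \<open>y = x - sqrt \<tau> z\<close> the kernel no longer depends on \<open>\<tau>\<close> and dominated convergence
  applies.\<close>

lemma heat_approximate_identity: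
  fixes \<psi> :: "'n::finite scalar_field"
  assumes cont: "continuous_on UNIV \<psi>" and bd: "\<And>x. norm (\<psi> x) \<le> B"
    and \<tau>: "\<And>j::nat. \<tau> j > 0" "\<tau> \<longlonglongrightarrow> 0"
  shows "(\<lambda>j. LINT y|lborel. complex_of_real (heat [] (\<tau> j) (x - y)) * \<psi> y) \<longlonglongrightarrow> \<psi> x"
proof -
  have [measurable]: "\<psi> \<in> borel_measurable borel" by (rule borel_measurable_continuous_onI[OF cont])
  have [measurable]: "heat [] 1 \<in> borel_measurable borel" by (rule borel_measurable_continuous_onI[OF continuous_heat]) simp
  have eq: "(LINT y|lborel. complex_of_real (heat [] \<tau> (x - y)) * \<psi> y) = (LINT z|lborel. complex_of_real (heat [] 1 z) * \<psi> (x - sqrt \<tau> *\<^sub>R z))"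
    if \<tau>: "\<tau> > 0" for \<tau>
  proof -
    have [measurable]: "heat [] \<tau> \<in> borel_measurable borel" by (rule borel_measurable_continuous_onI[OF continuous_heat]) fact
    have "(LINT y|lborel. complex_of_real (heat [] \<tau> (x - y)) * \<psi> y)
       = \<bar>- sqrt \<tau>\<bar> ^ DIM(real^'n) *\<^sub>R (LINT z|lborel. complex_of_real (heat [] \<tau> (x - (x + (- sqrt \<tau>) *\<^sub>R z))) * \<psi> (x + (- sqrt \<tau>) *\<^sub>R z))"
      by (rule lborel_affine_integral) (use \<tau> in \<open>auto, measurable\<close>)
    also have "\<dots> = (LINT z|lborel. (sqrt \<tau> ^ CARD('n) * heat [] \<tau> (sqrt \<tau> *\<^sub>R z)) *\<^sub>R \<psi> (x - sqrt \<tau> *\<^sub>R z))"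
      using \<tau> by (simp add: scaleR_conv_of_real mult_ac)
    finally show ?thesis unfolding heat_scale[OF \<tau>] by (simp add: scaleR_conv_of_real)
  qed
  have "(\<lambda>j. LINT z|lborel. complex_of_real (heat [] 1 z) * \<psi> (x - sqrt (\<tau> j) *\<^sub>R z)) \<longlonglongrightarrow> (LINT z|(lborel::(real^'n) measure). complex_of_real (heat [] 1 z) * \<psi> x)"
  proof (rule integral_dominated_convergence[where w = "\<lambda>z::real^'n. heat [] 1 z * B"])
    show "integrable lborel (\<lambda>z::real^'n. heat [] 1 z * B)" using heat_integral(1)[of 1, where ?'n='n] by simp
    have "(\<lambda>j. x - sqrt (\<tau> j) *\<^sub>R z) \<longlonglongrightarrow> x - sqrt 0 *\<^sub>R z" for z
      by (intro tendsto_intros \<tau>(2))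
    hence "(\<lambda>j. \<psi> (x - sqrt (\<tau> j) *\<^sub>R z)) \<longlonglongrightarrow> \<psi> (x - sqrt 0 *\<^sub>R z)" for z
      by (rule continuous_on_tendsto_compose[OF cont]) auto
    thus "AE z in lborel. (\<lambda>j. complex_of_real (heat [] 1 z) * \<psi> (x - sqrt (\<tau> j) *\<^sub>R z)) \<longlonglongrightarrow> complex_of_real (heat [] 1 z) * \<psi> x"
      by (intro AE_I2 tendsto_intros) simp
    show "AE z in lborel. norm (complex_of_real (heat [] 1 z) * \<psi> (x - sqrt (\<tau> j) *\<^sub>R z)) \<le> heat [] 1 z * B" for j
      by (intro AE_I2) (use heat_nonneg[of 1] bd in \<open>auto simp: norm_mult intro!: mult_mono\<close>)
  qed measurable
  moreover have "(LINT z|lborel. complex_of_real (heat [] 1 (z::real^'n)) * \<psi> x) = \<psi> x"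
    using heat_integral[where ?'n='n, of 1] by (simp add: integral_complex_of_real)
  ultimately show ?thesis unfolding eq[OF \<tau>(1)] by (simp only:)
qed

lemma fourier_inv_fourier:
  assumes \<psi>: "rapid0 \<psi>" and "rapid0 (inv_fourier \<psi>)"
  shows "fourier (inv_fourier \<psi>) x = \<psi> x"
proof -
  define \<tau> where "\<tau> = (\<lambda>j::nat. inverse (real (Suc j)))"
  have \<tau>: "\<And>j. \<tau> j > 0" "\<tau> \<longlonglongrightarrow> 0" unfolding \<tau>_def using LIMSEQ_inverse_real_of_nat by auto
  obtain B where B: "\<And>x. norm (\<psi> x) \<le> B" using rapid0_bounded[OF \<psi>] by blast
  have i: "integrable lborel (inv_fourier \<psi>)" by (rule rapid0_integrable) fact
  have [measurable]: "inv_fourier \<psi> \<in> borel_measurable borel" using borel_measurable_integrable[OF i] by simp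
  have "(\<lambda>j. fourier (\<lambda>\<xi>. complex_of_real (exp (- (4 * pi\<^sup>2 * \<tau> j * (norm \<xi>)\<^sup>2))) * inv_fourier \<psi> \<xi>) x) \<longlonglongrightarrow> fourier (inv_fourier \<psi>) x"
    unfolding fourier_def
  proof (rule integral_dominated_convergence[where w = "\<lambda>\<xi>. norm (inv_fourier \<psi> \<xi>)"])
    have "(\<lambda>j. exp (- (4 * pi\<^sup>2 * \<tau> j * (norm \<xi>)\<^sup>2))) \<longlonglongrightarrow> exp (- (4 * pi\<^sup>2 * 0 * (norm \<xi>)\<^sup>2))" for \<xi> :: "real^'a"
      by (intro tendsto_intros \<tau>(2))
    hence "(\<lambda>j. complex_of_real (exp (- (4 * pi\<^sup>2 * \<tau> j * (norm \<xi>)\<^sup>2)))) \<longlonglongrightarrow> of_real 1" for \<xi> :: "real^'a"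
      by (intro tendsto_of_real) simp
    from tendsto_mult[OF this tendsto_const]
    show "AE \<xi> in lborel. (\<lambda>j. complex_of_real (exp (- (4 * pi\<^sup>2 * \<tau> j * (norm \<xi>)\<^sup>2))) * inv_fourier \<psi> \<xi> * cis (- (2 * pi * (\<xi> \<bullet> x)))) \<longlonglongrightarrow> inv_fourier \<psi> \<xi> * cis (- (2 * pi * (\<xi> \<bullet> x)))"
      by (intro AE_I2) (simp add: mult.assoc)
    show "AE \<xi> in lborel. norm (complex_of_real (exp (- (4 * pi\<^sup>2 * \<tau> j * (norm \<xi>)\<^sup>2))) * inv_fourier \<psi> \<xi> * cis (- (2 * pi * (\<xi> \<bullet> x)))) \<le> norm (inv_fourier \<psi> \<xi>)" for j
      using \<tau>(1)[of j] by (intro AE_I2) (auto simp: norm_mult intro!: mult_left_le_one_le)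
  qed (use i in \<open>auto\<close>)
  moreover have "(\<lambda>j. fourier (\<lambda>\<xi>. complex_of_real (exp (- (4 * pi\<^sup>2 * \<tau> j * (norm \<xi>)\<^sup>2))) * inv_fourier \<psi> \<xi>) x) \<longlonglongrightarrow> \<psi> x"
    unfolding fourier_gauss_inv_fourier[OF rapid0_integrable[OF \<psi>] \<tau>(1)]
    by (rule heat_approximate_identity[OF _ B \<tau>]) (use \<psi> in \<open>simp add: rapid0_def\<close>)
  ultimately show ?thesis by (rule LIMSEQ_unique)
qed

text \<open>By inversion \<open>f\<close> is the Fourier transform of \<open>inv_fourier f\<close>, and Fourier transforms are controlled in
  all mixed directions, in any order.\<close>

lemma schwartz_imp_ctrl:
  assumes "f \<in> schwartz"
  shows "ctrl UNIV rapid0 k f"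
proof -
  have p: "ctrl {i} rapid0 k f" for i k by (rule schwartz_imp_ctrl_pure[OF assms])
  have q: "ctrl {i} rapid0 k (inv_fourier f)" for i k by (rule ctrl_subset[OF ctrl_inv_fourier[OF p]]) auto
  have "fourier (inv_fourier f) = f"
    by (intro ext fourier_inv_fourier ctrl_base[OF p] ctrl_base[OF q])
  thus ?thesis using ctrl_fourier[OF q] by metis
qed

lemma schwartz_iff: "f \<in> schwartz \<longleftrightarrow> (\<forall>k. ctrl UNIV rapid0 k f)"
  using schwartz_imp_ctrl ctrl_imp_schwartz by blast

lemma schwartz_rapid0: "f \<in> schwartz \<Longrightarrow> rapid0 f"
  using schwartz_imp_ctrl[of f 0] by simp

lemma schwartz_pure: "f \<in> schwartz \<Longrightarrow> ctrl {i} rapid0 k f"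
  by (rule ctrl_subset[OF schwartz_imp_ctrl]) auto

lemma fourier_schwartz: "f \<in> schwartz \<Longrightarrow> fourier f \<in> schwartz"
  using ctrl_fourier schwartz_pure schwartz_iff by metis

lemma inv_fourier_schwartz: "f \<in> schwartz \<Longrightarrow> inv_fourier f \<in> schwartz"
  using ctrl_inv_fourier schwartz_pure schwartz_iff by metis

lemma fourier_inv_fourier_schwartz: "f \<in> schwartz \<Longrightarrow> fourier (inv_fourier f) = f"
  using fourier_inv_fourier schwartz_rapid0 inv_fourier_schwartz by blast

lemma inv_fourier_fourier_schwartz:
  assumes "f \<in> schwartz"
  shows "inv_fourier (fourier f) = f"
proof -
  have [measurable]: "fourier f \<in> borel_measurable borel"
    using rapid0_measurable[OF schwartz_rapid0[OF fourier_schwartz[OF assms]]] .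
  have "inv_fourier (fourier f) x = fourier (inv_fourier f) x" for x
  proof -
    have "inv_fourier (fourier f) x = (LINT \<xi>|lborel. fourier f (0 + (-1) *\<^sub>R \<xi>) * cis (2 * pi * (x \<bullet> (0 + (-1) *\<^sub>R \<xi>))))"
      unfolding inv_fourier_def by (subst lborel_affine_integral[of _ "-1" 0]) auto
    thus ?thesis unfolding fourier_def[of "inv_fourier f"] inv_fourier_eq[of f] by (simp add: inner_commute)
  qed
  thus ?thesis using fourier_inv_fourier_schwartz[OF assms] by auto
qed

lemma schwartz_slow_mult:
  assumes "\<And>k. ctrl UNIV slow0 k \<sigma>" "f \<in> schwartz"
  shows "(\<lambda>x. \<sigma> x * f x) \<in> schwartz"
  using assms unfolding schwartz_iff by (auto intro: ctrl_slow_rapid_mult)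

section \<open>The symbol\<close>

definition symA :: "real \<Rightarrow> real^'n::finite \<Rightarrow> real" where
  "symA lam \<xi> = lam + 4 * pi\<^sup>2 * (norm \<xi>)\<^sup>2"

lemma symA_ge: "symA lam \<xi> \<ge> lam"
  unfolding symA_def by simp

lemma continuous_symA: "continuous_on S (symA lam)"
  unfolding symA_def[abs_def] by (intro continuous_intros)

lemma symA_deriv:
  "((\<lambda>t. symA lam (\<xi> + t *\<^sub>R axis i 1)) has_real_derivative 8 * pi\<^sup>2 * \<xi> $ i) (at 0)"
proof -
  have "symA lam (\<xi> + t *\<^sub>R axis i 1) = lam + 4 * pi\<^sup>2 * ((\<xi> + t *\<^sub>R axis i 1) \<bullet> (\<xi> + t *\<^sub>R axis i 1))" for t
    unfolding symA_def by (simp add: power2_norm_eq_inner)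
  also have "\<dots> t = lam + 4 * pi\<^sup>2 * (\<xi> \<bullet> \<xi> + 2 * t * \<xi> $ i + t * t)" for t
    by (simp add: inner_add_left inner_add_right inner_axis inner_axis' inner_axis_axis algebra_simps)
  finally have "(\<lambda>t. symA lam (\<xi> + t *\<^sub>R axis i 1)) = (\<lambda>t. lam + 4 * pi\<^sup>2 * (\<xi> \<bullet> \<xi> + 2 * t * \<xi> $ i + t * t))"
    by blast
  thus ?thesis by (auto intro!: derivative_eq_intros)
qed

text \<open>Up to coordinate factors this two-parameter family is closed under differentiation; it contains the
  symbol (\<open>r = s\<close>, \<open>q = 1\<close>) and its inverse (\<open>r = - s\<close>, \<open>q = - 1\<close>).\<close>

definition log_power :: "real \<Rightarrow> real \<Rightarrow> real \<Rightarrow> 'n::finite scalar_field" where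
  "log_power lam r q \<xi> = complex_of_real (symA lam \<xi> powr r * ln (symA lam \<xi>) powr q)"

lemma has_pd_log_power:
  assumes "lam > 1"
  shows "has_pd (log_power lam r q) i (\<lambda>\<xi>. complex_of_real (8 * pi\<^sup>2) * complex_of_real (\<xi> $ i) *
    (complex_of_real r * log_power lam (r - 1) q \<xi> + complex_of_real q * log_power lam (r - 1) (q - 1) \<xi>))"
  unfolding has_pd_def
proof
  fix \<xi> :: "real^'a"
  let ?A = "\<lambda>t. symA lam (\<xi> + t *\<^sub>R axis i 1)"
  let ?B = "symA lam \<xi>"
  have A: "?B > 1" using symA_ge[of lam \<xi>] assms by simp
  have d: "(?A has_real_derivative 8 * pi\<^sup>2 * \<xi> $ i) (at 0)" by (rule symA_deriv)
  have "((\<lambda>t. ?A t powr r * ln (?A t) powr q) has_real_derivative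
      8 * pi\<^sup>2 * \<xi> $ i * (r * (?B powr (r - 1) * ln ?B powr q) + q * (?B powr (r - 1) * ln ?B powr (q - 1)))) (at 0)"
  proof -
    have P: "((\<lambda>y. y powr r * ln y powr q) has_real_derivative
       (r * (?B powr (r - 1) * ln ?B powr q) + q * (?B powr (r - 1) * ln ?B powr (q - 1)))) (at ?B)"
    proof -
      have l: "ln ?B > 0" using A by simp
      have "((\<lambda>y. ln y powr q) has_real_derivative q * ln ?B powr (q - 1) * (1 / ?B)) (at ?B)"
        by (rule DERIV_chain2[where f="\<lambda>z. z powr q" and g=ln, OF has_real_derivative_powr[OF l]]) (use A in \<open>auto intro!: DERIV_ln_divide\<close>)
      from DERIV_mult[OF has_real_derivative_powr this] show ?thesis
        using A by (simp add: powr_diff algebra_simps)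
    qed
    have "symA lam \<xi> = ?A 0" by simp
    from DERIV_chain2[where g = ?A and x = 0, OF P[unfolded this] d] show ?thesis by (simp only: mult.commute) simp
  qed
  from has_vector_derivative_of_real[OF this]
  show "((\<lambda>t. log_power lam r q (\<xi> + t *\<^sub>R axis i 1)) has_vector_derivative
     complex_of_real (8 * pi\<^sup>2) * complex_of_real (\<xi> $ i) *
    (complex_of_real r * log_power lam (r - 1) q \<xi> + complex_of_real q * log_power lam (r - 1) (q - 1) \<xi>)) (at 0)"
    unfolding log_power_def by simp
qed

lemma slow0_log_power:
  assumes "lam > 1"
  shows "slow0 (log_power lam r q)"
  unfolding slow0_def
proof
  have A: "symA lam \<xi> > 1" for \<xi> :: "real^'a" using symA_ge[of lam \<xi>] assms by simp
  have A0: "symA lam \<xi> \<noteq> 0" "ln (symA lam \<xi>) \<noteq> 0" for \<xi> :: "real^'a"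
    using A[of \<xi>] ln_gt_zero[OF A[of \<xi>]] by auto
  show "continuous_on UNIV (log_power lam r q :: 'a scalar_field)"
    unfolding log_power_def[abs_def]
    by (intro continuous_intros continuous_symA) (use A0 in auto)
  define K where "K = nat \<lceil>\<bar>r\<bar> + \<bar>q\<bar>\<rceil>"
  \<comment> \<open>For negative \<open>q\<close> the power of the logarithm is bounded because \<open>ln A \<ge> ln lam > 0\<close>.\<close>
  define c where "c = max 1 (ln lam powr - \<bar>q\<bar>)"
  have "norm (log_power lam r q \<xi>) \<le> (c * (lam + 4 * pi\<^sup>2) ^ K) * (1 + norm \<xi>) ^ (2 * K)" for \<xi> :: "real^'a"
  proof -
    let ?A = "symA lam \<xi>"
    have l: "ln ?A \<ge> ln lam" "ln lam > 0" "ln ?A \<le> ?A"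
      using symA_ge[of lam \<xi>] assms A[of \<xi>] by (auto intro: ln_bound order.trans)
    have 1: "?A powr r \<le> ?A powr \<bar>r\<bar>" using A[of \<xi>] by (intro powr_mono) auto
    have 2: "ln ?A powr q \<le> c * ?A powr \<bar>q\<bar>"
    proof (cases "q \<ge> 0")
      case True
      hence "ln ?A powr q \<le> 1 * ?A powr \<bar>q\<bar>" using l by (auto intro!: powr_mono2 simp: less_imp_le[OF A])
      also have "\<dots> \<le> c * ?A powr \<bar>q\<bar>" unfolding c_def by (intro mult_right_mono) auto
      finally show ?thesis .
    next
      case False
      hence "ln ?A powr q \<le> ln lam powr - \<bar>q\<bar> * 1" using l by (auto intro!: powr_mono2')
      also have "\<dots> \<le> c * ?A powr \<bar>q\<bar>" unfolding c_def
        using A[of \<xi>] by (intro mult_mono) (auto intro!: ge_one_powr_ge_zero)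
      finally show ?thesis .
    qed
    have c0: "c \<ge> 0" unfolding c_def by simp
    have "norm (log_power lam r q \<xi>) = ?A powr r * ln ?A powr q"
      unfolding log_power_def norm_of_real by (simp add: abs_mult)
    also have "\<dots> \<le> ?A powr \<bar>r\<bar> * (c * ?A powr \<bar>q\<bar>)" by (intro mult_mono 1 2) auto
    also have "\<dots> = c * ?A powr (\<bar>r\<bar> + \<bar>q\<bar>)" by (simp add: powr_add)
    also have "\<dots> \<le> c * ?A powr (real K)" using A[of \<xi>] c0 unfolding K_def
      by (intro mult_left_mono powr_mono) (auto intro: real_nat_ceiling_ge)
    also have "?A powr (real K) = ?A ^ K" using A[of \<xi>] by (simp add: powr_realpow)
    also have "c * ?A ^ K \<le> c * ((lam + 4 * pi\<^sup>2) * (1 + norm \<xi>)\<^sup>2) ^ K"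
    proof (intro mult_left_mono power_mono c0)
      have p: "(1 + norm \<xi>)\<^sup>2 \<ge> 1" "(norm \<xi>)\<^sup>2 \<le> (1 + norm \<xi>)\<^sup>2"
        by (auto intro: power_mono simp: one_le_power)
      have "?A \<le> lam * (1 + norm \<xi>)\<^sup>2 + 4 * pi\<^sup>2 * (1 + norm \<xi>)\<^sup>2"
        unfolding symA_def using p assms by (intro add_mono mult_left_mono) auto
      thus "?A \<le> (lam + 4 * pi\<^sup>2) * (1 + norm \<xi>)\<^sup>2" by (simp add: algebra_simps)
      show "0 \<le> ?A" using A[of \<xi>] by simp
    qed
    finally show ?thesis by (simp add: power_mult_distrib power_mult mult.assoc)
  qed
  thus "\<exists>N C. \<forall>\<xi>. norm (log_power lam r q (\<xi> :: real^'a)) \<le> C * (1 + norm \<xi>) ^ N" by blast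
qed

lemma ctrl_slow_log_power:
  assumes "lam > 1"
  shows "ctrl D slow0 k (log_power lam r q)"
proof (induction k arbitrary: r q)
  case (Suc k)
  have "has_pd (log_power lam r q) i (\<lambda>\<xi>. complex_of_real (8 * pi\<^sup>2) * complex_of_real (\<xi> $ i) *
    (complex_of_real r * log_power lam (r - 1) q \<xi> + complex_of_real q * log_power lam (r - 1) (q - 1) \<xi>))
    \<and> ctrl D slow0 k (\<lambda>\<xi>. complex_of_real (8 * pi\<^sup>2) * complex_of_real (\<xi> $ i) *
    (complex_of_real r * log_power lam (r - 1) q \<xi> + complex_of_real q * log_power lam (r - 1) (q - 1) \<xi>))" for i
    by (intro conjI has_pd_log_power assms ctrl_slow_mult ctrl_slow_add ctrl_slow_const ctrl_slow_coord Suc)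
  thus ?case using slow0_log_power[OF assms] unfolding ctrl.simps by blast
qed (simp add: slow0_log_power[OF assms])

lemma log_symbol_eq: "lam > 1 \<Longrightarrow> log_symbol s lam = log_power lam s 1"
  unfolding log_symbol_def log_power_def symA_def
  using symA_ge[of lam] by (intro ext) (simp add: symA_def add_increasing2)

lemma log_symbol_mult_inverse:
  assumes "lam > 1"
  shows "log_symbol s lam \<xi> * log_power lam (- s) (- 1) \<xi> = 1"
proof -
  have A: "symA lam \<xi> > 1" using symA_ge[of lam \<xi>] assms by simp
  have "symA lam \<xi> powr s * ln (symA lam \<xi>) powr 1 * (symA lam \<xi> powr - s * ln (symA lam \<xi>) powr - 1) = 1"
    using A ln_gt_zero[OF A] by (simp add: powr_minus field_simps)
  thus ?thesis unfolding log_symbol_eq[OF assms] log_power_def of_real_mult[symmetric] by simp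
qed

section \<open>Subordination of the inverse symbol to the heat semigroup\<close>

lemma nn_integral_exp_tail:
  assumes "c > 0"
  shows "(\<integral>\<^sup>+t. ennreal (indicator {a<..} t * exp (- (c * t))) \<partial>lborel) = ennreal (exp (- (c * a)) / c)"
proof -
  have "(\<integral>\<^sup>+t. ennreal (exp (- (c * t))) * indicator {a..} t \<partial>lborel) = ennreal (0 - (- exp (- (c * a)) / c))"
  proof (rule nn_integral_FTC_atLeast)
    show "((\<lambda>t. - exp (- (c * t)) / c) has_real_derivative exp (- (c * x))) (at x)" for x
      using assms by (auto intro!: derivative_eq_intros)
    show "((\<lambda>t. - exp (- (c * t)) / c) \<longlongrightarrow> 0) at_top"
    proof -
      have "filterlim (\<lambda>t. - (c * t)) at_bot at_top"
        unfolding filterlim_uminus_at_top[symmetric] using assms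
        by (intro filterlim_tendsto_pos_mult_at_top[OF tendsto_const]) (auto simp: filterlim_ident)
      from filterlim_compose[OF exp_at_bot this] have "((\<lambda>t. exp (- (c * t))) \<longlongrightarrow> 0) at_top" .
      from tendsto_divide[OF tendsto_minus[OF this] tendsto_const[of c]] show ?thesis using assms by simp
    qed
  qed auto
  also have "(\<integral>\<^sup>+t. ennreal (exp (- (c * t))) * indicator {a..} t \<partial>lborel)
     = (\<integral>\<^sup>+t. ennreal (indicator {a<..} t * exp (- (c * t))) \<partial>lborel)"
  proof (rule nn_integral_cong_AE)
    show "AE t in lborel. ennreal (exp (- (c * t))) * indicator {a..} t = ennreal (indicator {a<..} t * exp (- (c * t)))"
      using AE_lborel_singleton[of a] by eventually_elim (auto split: split_indicator)
  qed
  finally show ?thesis by simp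
qed

lemma nn_integral_powr_tail:
  assumes "0 < q" "q < 1"
  shows "(\<integral>\<^sup>+t. ennreal (indicator {a<..} t * q powr (t - b)) \<partial>lborel) = ennreal (q powr (a - b) / ln (1 / q))"
proof -
  define L where "L = ln (1 / q)"
  have l: "L > 0" unfolding L_def using assms by simp
  have q: "q powr t = exp (- (L * t))" for t unfolding L_def powr_def using assms by (simp add: ln_div)
  have "(\<integral>\<^sup>+t. ennreal (indicator {a<..} t * q powr (t - b)) \<partial>lborel)
     = (\<integral>\<^sup>+t. ennreal (exp (L * b)) * ennreal (indicator {a<..} t * exp (- (L * t))) \<partial>lborel)"
    unfolding q by (intro nn_integral_cong) (auto simp: ennreal_mult[symmetric] exp_add[symmetric] algebra_simps split: split_indicator)
  also have "\<dots> = ennreal (exp (L * b)) * ennreal (exp (- (L * a)) / L)"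
    by (subst nn_integral_cmult) (simp_all add: nn_integral_exp_tail[OF l])
  also have "\<dots> = ennreal (q powr (a - b) / L)"
    unfolding q using l by (simp add: ennreal_mult[symmetric] exp_add[symmetric] algebra_simps)
  finally show ?thesis unfolding L_def .
qed

text \<open>The Gamma integral after a dilation. It is the source of every power that is written below as a
  superposition of exponentials.\<close>

lemma nn_integral_Gamma:
  assumes "z > 0" "A > 0"
  shows "(\<integral>\<^sup>+\<tau>. ennreal (indicator {0<..} \<tau> * (\<tau> powr (z - 1) * exp (- (A * \<tau>)))) \<partial>lborel) = ennreal (Gamma z * A powr (- z))"
proof -
  have "ennreal (Gamma z) = (\<integral>\<^sup>+t. ennreal (indicator {0..} t * t powr (z - 1) / exp t) \<partial>lborel)"
    by (rule Gamma_conv_nn_integral_real) fact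
  also have "\<dots> = (\<integral>\<^sup>+t. ennreal (indicator {0<..} t * (t powr (z - 1) * exp (- t))) \<partial>lborel)"
    by (intro nn_integral_cong) (auto split: split_indicator simp: exp_minus field_simps)
  also have "\<dots> = ennreal \<bar>A\<bar> * (\<integral>\<^sup>+t. ennreal (indicator {0<..} (0 + A * t) * ((0 + A * t) powr (z - 1) * exp (- (0 + A * t)))) \<partial>lborel)"
    by (rule nn_integral_real_affine) (use assms in auto)
  also have "\<dots> = (\<integral>\<^sup>+t. ennreal (A powr z) * ennreal (indicator {0<..} t * (t powr (z - 1) * exp (- (A * t)))) \<partial>lborel)"
    using assms by (subst nn_integral_cmult[symmetric])
      (auto intro!: nn_integral_cong simp: ennreal_mult[symmetric] powr_mult powr_diff zero_less_mult_iff split: split_indicator)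
  also have "\<dots> = ennreal (A powr z) * (\<integral>\<^sup>+t. ennreal (indicator {0<..} t * (t powr (z - 1) * exp (- (A * t)))) \<partial>lborel)"
    by (rule nn_integral_cmult) simp
  finally have "ennreal (A powr - z) * ennreal (Gamma z) = ennreal (A powr - z) * (ennreal (A powr z) * (\<integral>\<^sup>+t. ennreal (indicator {0<..} t * (t powr (z - 1) * exp (- (A * t)))) \<partial>lborel))"
    by simp
  moreover have "ennreal (A powr - z) * (ennreal (A powr z) * I) = I" for I
  proof -
    have "ennreal (A powr - z) * ennreal (A powr z) = 1"
      using assms by (simp add: ennreal_mult[symmetric] powr_add[symmetric])
    thus ?thesis by (metis mult.assoc mult_1)
  qed
  moreover have "ennreal (A powr - z) * ennreal (Gamma z) = ennreal (Gamma z * A powr - z)"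
    using assms by (simp add: ennreal_mult[symmetric] mult.commute Gamma_real_nonneg)
  ultimately show ?thesis by metis
qed

text \<open>The part of the Gamma integral over \<open>t > x\<close>.\<close>

lemma Gamma_ge:
  fixes z x :: real
  assumes "z \<ge> 1" "x \<ge> 0"
  shows "x powr (z - 1) * exp (- x) \<le> Gamma z"
proof -
  have "ennreal (x powr (z - 1) * exp (- x)) = (\<integral>\<^sup>+t. ennreal (x powr (z - 1)) * ennreal (indicator {x<..} t * exp (- (1 * t))) \<partial>lborel)"
    using nn_integral_exp_tail[of 1 x] by (subst nn_integral_cmult) (auto simp: ennreal_mult[symmetric])
  also have "\<dots> \<le> (\<integral>\<^sup>+\<tau>. ennreal (indicator {0<..} \<tau> * (\<tau> powr (z - 1) * exp (- (1 * \<tau>)))) \<partial>lborel)"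
    using assms by (intro nn_integral_mono) (auto split: split_indicator simp: ennreal_mult[symmetric] intro!: ennreal_leI powr_mono2)
  also have "\<dots> = ennreal (Gamma z)" using assms by (subst nn_integral_Gamma) auto
  finally show ?thesis using assms by (simp add: Gamma_real_nonneg)
qed

text \<open>For \<open>z < 1\<close> the integrand of the Gamma integral is at least \<open>exp (- 1)\<close> on the unit interval.\<close>

lemma Gamma_ge_exp_minus_1:
  fixes z :: real
  assumes "z > 0"
  shows "exp (- 1) \<le> Gamma z"
proof (cases "z \<ge> 1")
  case True thus ?thesis using Gamma_ge[of z 1] by simp
next
  case False
  have "ennreal (exp (-1)) = (\<integral>\<^sup>+t. ennreal (exp (- 1)) * indicator {0<..1::real} t \<partial>lborel)"
    by (subst nn_integral_cmult_indicator) auto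
  also have "\<dots> \<le> (\<integral>\<^sup>+\<tau>. ennreal (indicator {0<..} \<tau> * (\<tau> powr (z - 1) * exp (- (1 * \<tau>)))) \<partial>lborel)"
  proof (intro nn_integral_mono)
    fix t :: real
    have "exp (- 1) \<le> t powr (z - 1) * exp (- t)" if "0 < t" "t \<le> 1"
    proof -
      have "1 powr (z - 1) \<le> t powr (z - 1)" using that False by (intro powr_mono2') auto
      hence "1 * exp (-1) \<le> t powr (z - 1) * exp (- t)"
        using that by (intro mult_mono) auto
      thus ?thesis by simp
    qed
    thus "ennreal (exp (- 1)) * indicator {0<..1} t \<le> ennreal (indicator {0<..} t * (t powr (z - 1) * exp (- (1 * t))))"
      by (auto split: split_indicator)
  qed
  also have "\<dots> = ennreal (Gamma z)" using assms by (subst nn_integral_Gamma) auto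
  finally show ?thesis using assms by (simp add: Gamma_real_nonneg)
qed

definition recip_Gamma_tail :: "real \<Rightarrow> real \<Rightarrow> real" where
  "recip_Gamma_tail s t = indicator {s<..} t *\<^sub>R (1 / Gamma t)"

text \<open>The weight of the subordination: by \<open>wt_laplace\<close> its Laplace transform at \<open>A\<close> is the inverse symbol
  \<open>A powr (- s) / ln A\<close>.\<close>

definition wt :: "real \<Rightarrow> real \<Rightarrow> real" where
  "wt s \<tau> = (LINT t|lborel. recip_Gamma_tail s t * \<tau> powr (t - 1))"

lemma measurable_recip_Gamma_tail [measurable]:
  assumes "s > 0"
  shows "recip_Gamma_tail s \<in> borel_measurable borel"
proof -
  have "continuous_on {s<..} (\<lambda>t. 1 / Gamma t :: real)"
    by (intro continuous_intros) (use assms in \<open>auto simp: Gamma_eq_zero_iff elim!: nonpos_Ints_cases\<close>)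
  thus ?thesis unfolding recip_Gamma_tail_def[abs_def]
    by (intro borel_measurable_continuous_on_indicator) auto
qed

lemma recip_Gamma_tail_bounds:
  assumes "s > 0"
  shows "recip_Gamma_tail s t \<ge> 0" "recip_Gamma_tail s t \<le> indicator {s<..} t * exp 1"
proof -
  have "1 / Gamma t \<le> exp 1" "Gamma t > 0" if "t > s"
  proof -
    have "exp (- 1) \<le> Gamma t" by (rule Gamma_ge_exp_minus_1) (use assms that in simp)
    hence "1 / Gamma t \<le> 1 / exp (- 1)" by (intro divide_left_mono) (use assms that in auto)
    thus "1 / Gamma t \<le> exp 1" by (simp add: exp_minus field_simps)
    show "Gamma t > 0" using assms that by simp
  qed
  thus "recip_Gamma_tail s t \<ge> 0" "recip_Gamma_tail s t \<le> indicator {s<..} t * exp 1"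
    unfolding recip_Gamma_tail_def by (auto split: split_indicator intro: less_imp_le)
qed

text \<open>Since \<open>1 / Gamma t\<close> is bounded, only the integral of \<open>\<tau> powr (t - 1)\<close> over \<open>t > s\<close> remains; it is the source
  of the logarithm.\<close>

lemma wt_small:
  assumes "s > 0" "0 < \<tau>" "\<tau> < 1"
  shows "(\<integral>\<^sup>+t. ennreal (recip_Gamma_tail s t * \<tau> powr (t - 1)) \<partial>lborel) \<le> ennreal (exp 1 * (\<tau> powr (s - 1) / ln (1 / \<tau>)))"
proof -
  have "(\<integral>\<^sup>+t. ennreal (recip_Gamma_tail s t * \<tau> powr (t - 1)) \<partial>lborel)
     \<le> (\<integral>\<^sup>+t. ennreal (exp 1) * ennreal (indicator {s<..} t * \<tau> powr (t - 1)) \<partial>lborel)"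
  proof (rule nn_integral_mono)
    fix t
    have "recip_Gamma_tail s t * \<tau> powr (t - 1) \<le> (indicator {s<..} t * exp 1) * \<tau> powr (t - 1)"
      by (intro mult_right_mono recip_Gamma_tail_bounds assms) auto
    thus "ennreal (recip_Gamma_tail s t * \<tau> powr (t - 1)) \<le> ennreal (exp 1) * ennreal (indicator {s<..} t * \<tau> powr (t - 1))"
      by (simp add: ennreal_mult[symmetric] mult_ac)
  qed
  also have "\<dots> = ennreal (exp 1) * ennreal (\<tau> powr (s - 1) / ln (1 / \<tau>))"
    by (subst nn_integral_cmult) (simp_all add: nn_integral_powr_tail[OF assms(2,3)])
  finally show ?thesis using assms by (simp add: ennreal_mult'[symmetric])
qed

text \<open>The lower bound \<open>Gamma_ge\<close> at \<open>\<rho> * \<tau>\<close> leaves the factor \<open>(1 / \<rho>) powr (t - 1)\<close>, which is integrable in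
  \<open>t\<close> because \<open>\<rho> > 1\<close>.\<close>

lemma wt_large:
  assumes "s > 0" "\<tau> \<ge> 1/2" "\<rho> > 1"
  shows "(\<integral>\<^sup>+t. ennreal (recip_Gamma_tail s t * \<tau> powr (t - 1)) \<partial>lborel) \<le> ennreal ((1 / ln \<rho> + 2 * exp 1) * exp (\<rho> * \<tau>))"
proof -
  let ?f = "\<lambda>t. ennreal (exp (\<rho> * \<tau>)) * ennreal (indicator {1<..} t * (1 / \<rho>) powr (t - 1))"
  let ?g = "\<lambda>t::real. ennreal (2 * exp 1) * indicator {s<..max s 1} t"
  have l: "ln (1 / (1 / \<rho>)) > 0" using assms by simp
  have "(\<integral>\<^sup>+t. ennreal (recip_Gamma_tail s t * \<tau> powr (t - 1)) \<partial>lborel) \<le> (\<integral>\<^sup>+t. ?f t + ?g t \<partial>lborel)"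
  proof (rule nn_integral_mono)
    fix t :: real
    consider "t \<le> s" | "t > s" "t > 1" | "t > s" "t \<le> 1" by linarith
    thus "ennreal (recip_Gamma_tail s t * \<tau> powr (t - 1)) \<le> ?f t + ?g t"
    proof cases
      case 1 thus ?thesis by (simp add: recip_Gamma_tail_def)
    next
      case 2
      have "(\<rho> * \<tau>) powr (t - 1) * exp (- (\<rho> * \<tau>)) \<le> Gamma t"
        by (rule Gamma_ge) (use assms 2 in auto)
      moreover have "Gamma t > 0" using 2 assms by simp
      ultimately have "1 / Gamma t * ((\<rho> * \<tau>) powr (t - 1) * exp (- (\<rho> * \<tau>))) \<le> 1"
        by simp
      hence "1 / Gamma t * \<tau> powr (t - 1) \<le> exp (\<rho> * \<tau>) * (1 / \<rho>) powr (t - 1)"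
        using assms \<open>Gamma t > 0\<close> by (simp add: powr_mult powr_divide exp_minus pos_divide_le_eq del: Gamma_real_pos) (simp add: field_simps)
      hence "ennreal (recip_Gamma_tail s t * \<tau> powr (t - 1)) \<le> ?f t"
        using 2 by (simp add: recip_Gamma_tail_def ennreal_mult[symmetric])
      thus ?thesis by (simp add: add_increasing2)
    next
      case 3
      have "recip_Gamma_tail s t * \<tau> powr (t - 1) \<le> exp 1 * 2"
      proof (rule mult_mono)
        show "recip_Gamma_tail s t \<le> exp 1" using recip_Gamma_tail_bounds(2)[OF assms(1), of t] 3 by simp
        have "\<tau> powr (t - 1) \<le> (1/2) powr (t - 1)" using assms 3 by (intro powr_mono2') auto
        also have "\<dots> \<le> (1/2) powr (- 1)" using assms 3 by (intro powr_mono') auto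
        also have "\<dots> = (2::real)" by (simp add: powr_minus)
        finally show "\<tau> powr (t - 1) \<le> 2" .
      qed auto
      hence "ennreal (recip_Gamma_tail s t * \<tau> powr (t - 1)) \<le> ?g t" using 3
        by (auto simp: mult.commute intro!: ennreal_leI)
      thus ?thesis by (simp add: add_increasing)
    qed
  qed
  also have "\<dots> = (\<integral>\<^sup>+t. ?f t \<partial>lborel) + (\<integral>\<^sup>+t. ?g t \<partial>lborel)"
    by (rule nn_integral_add) auto
  also have "(\<integral>\<^sup>+t. ?f t \<partial>lborel) = ennreal (exp (\<rho> * \<tau>)) * ennreal ((1 / \<rho>) powr (1 - 1) / ln (1 / (1 / \<rho>)))"
    by (subst nn_integral_cmult) (use assms in \<open>auto simp: nn_integral_powr_tail\<close>)
  also have "\<dots> = ennreal (exp (\<rho> * \<tau>) / ln \<rho>)" using assms l by (simp add: ennreal_mult[symmetric])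
  also have "(\<integral>\<^sup>+t. ?g t \<partial>lborel) = ennreal (2 * exp 1 * (max s 1 - s))"
    by (subst nn_integral_cmult_indicator) (auto simp: ennreal_mult[symmetric])
  also have "ennreal (exp (\<rho> * \<tau>) / ln \<rho>) + ennreal (2 * exp 1 * (max s 1 - s)) = ennreal (exp (\<rho> * \<tau>) / ln \<rho> + 2 * exp 1 * (max s 1 - s))"
    using assms by (intro ennreal_plus[symmetric]) auto
  also have "\<dots> \<le> ennreal ((1 / ln \<rho> + 2 * exp 1) * exp (\<rho> * \<tau>))"
  proof (rule ennreal_leI)
    have "2 * exp 1 * (max s 1 - s) \<le> 2 * exp 1 * exp (\<rho> * \<tau>)"
    proof (rule mult_left_mono)
      have "max s 1 - s \<le> 1" using assms by simp
      also have "1 \<le> exp (\<rho> * \<tau>)" using assms by simp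
      finally show "max s 1 - s \<le> exp (\<rho> * \<tau>)" .
    qed simp
    thus "exp (\<rho> * \<tau>) / ln \<rho> + 2 * exp 1 * (max s 1 - s) \<le> (1 / ln \<rho> + 2 * exp 1) * exp (\<rho> * \<tau>)"
      by (simp add: algebra_simps)
  qed
  finally show ?thesis .
qed

lemma wt_nonneg: "s > 0 \<Longrightarrow> wt s \<tau> \<ge> 0"
  unfolding wt_def by (intro integral_nonneg_AE AE_I2 mult_nonneg_nonneg recip_Gamma_tail_bounds) auto

lemma wt_ennreal:
  assumes "s > 0" "\<tau> > 0"
  shows "ennreal (wt s \<tau>) = (\<integral>\<^sup>+t. ennreal (recip_Gamma_tail s t * \<tau> powr (t - 1)) \<partial>lborel)"
proof -
  note [measurable] = measurable_recip_Gamma_tail[OF assms(1)]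
  have nn: "recip_Gamma_tail s t * \<tau> powr (t - 1) \<ge> 0" for t
    using recip_Gamma_tail_bounds(1)[OF assms(1), of t] by simp
  have "(\<integral>\<^sup>+t. ennreal (recip_Gamma_tail s t * \<tau> powr (t - 1)) \<partial>lborel) < \<infinity>"
  proof (cases "\<tau> < 1")
    case True
    thus ?thesis using wt_small[OF assms True] by (simp add: order_le_less_trans)
  next
    case False
    thus ?thesis using wt_large[OF assms(1), of \<tau> 2] by (simp add: order_le_less_trans)
  qed
  hence "integrable lborel (\<lambda>t. recip_Gamma_tail s t * \<tau> powr (t - 1))"
    by (intro integrableI_nonneg) (auto simp: nn)
  thus ?thesis unfolding wt_def by (intro nn_integral_eq_integral[symmetric]) (auto simp: nn)
qed

lemma measurable_wt [measurable]:
  assumes "s > 0"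
  shows "wt s \<in> borel_measurable borel"
proof -
  note [measurable] = measurable_recip_Gamma_tail[OF assms]
  show ?thesis unfolding wt_def[abs_def] by measurable
qed

text \<open>By Tonelli's theorem the integral in \<open>\<tau>\<close> can be taken first; it is a Gamma integral that cancels the
  denominator \<open>Gamma t\<close>.\<close>

lemma wt_laplace:
  assumes "s > 0" "A > 1"
  shows "(\<integral>\<^sup>+\<tau>. ennreal (indicator {0<..} \<tau> * (exp (- (A * \<tau>)) * wt s \<tau>)) \<partial>lborel) = ennreal (A powr (- s) / ln A)"
proof -
  note [measurable] = measurable_recip_Gamma_tail[OF assms(1)]
  let ?k = "\<lambda>\<tau> t. ennreal (recip_Gamma_tail s t) * ennreal (indicator {0<..} \<tau> * (\<tau> powr (t - 1) * exp (- (A * \<tau>))))"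
  have "(\<integral>\<^sup>+\<tau>. ennreal (indicator {0<..} \<tau> * (exp (- (A * \<tau>)) * wt s \<tau>)) \<partial>lborel) = (\<integral>\<^sup>+\<tau>. \<integral>\<^sup>+t. ?k \<tau> t \<partial>lborel \<partial>lborel)"
  proof (rule nn_integral_cong)
    fix \<tau> :: real
    show "ennreal (indicator {0<..} \<tau> * (exp (- (A * \<tau>)) * wt s \<tau>)) = (\<integral>\<^sup>+t. ?k \<tau> t \<partial>lborel)"
    proof (cases "\<tau> > 0")
      case True
      have "ennreal (indicator {0<..} \<tau> * (exp (- (A * \<tau>)) * wt s \<tau>)) = ennreal (exp (- (A * \<tau>))) * ennreal (wt s \<tau>)"
        using True wt_nonneg[OF assms(1)] by (simp add: ennreal_mult)
      also have "\<dots> = (\<integral>\<^sup>+t. ennreal (exp (- (A * \<tau>))) * ennreal (recip_Gamma_tail s t * \<tau> powr (t - 1)) \<partial>lborel)"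
        unfolding wt_ennreal[OF assms(1) True] by (rule nn_integral_cmult[symmetric]) measurable
      also have "\<dots> = (\<integral>\<^sup>+t. ?k \<tau> t \<partial>lborel)"
        using True recip_Gamma_tail_bounds(1)[OF assms(1)] by (intro nn_integral_cong) (simp add: ennreal_mult'[symmetric] ennreal_mult''[symmetric] mult_ac)
      finally show ?thesis .
    qed simp
  qed
  also have "\<dots> = (\<integral>\<^sup>+t. \<integral>\<^sup>+\<tau>. ?k \<tau> t \<partial>lborel \<partial>lborel)"
    by (rule lborel_pair.Fubini'[symmetric]) measurable
  also have "\<dots> = (\<integral>\<^sup>+t. ennreal (indicator {s<..} t * (1 / A) powr (t - 0)) \<partial>lborel)"
  proof (rule nn_integral_cong)
    fix t :: real
    have "(\<integral>\<^sup>+\<tau>. ?k \<tau> t \<partial>lborel) = ennreal (recip_Gamma_tail s t) * (\<integral>\<^sup>+\<tau>. ennreal (indicator {0<..} \<tau> * (\<tau> powr (t - 1) * exp (- (A * \<tau>)))) \<partial>lborel)"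
      by (rule nn_integral_cmult) measurable
    also have "\<dots> = ennreal (indicator {s<..} t * (1 / A) powr (t - 0))"
    proof (cases "t > s")
      case True
      hence t: "t > 0" "Gamma t > 0" using assms by auto
      have "ennreal (recip_Gamma_tail s t) * ennreal (Gamma t * A powr - t) = ennreal (A powr - t)"
        using True t(2) by (subst ennreal_mult'[symmetric]) (auto simp: recip_Gamma_tail_def)
      thus ?thesis using True t assms by (simp add: nn_integral_Gamma powr_divide powr_minus_divide)
    qed (simp add: recip_Gamma_tail_def)
    finally show "(\<integral>\<^sup>+\<tau>. ?k \<tau> t \<partial>lborel) = ennreal (indicator {s<..} t * (1 / A) powr (t - 0))" .
  qed
  also have "\<dots> = ennreal ((1 / A) powr (s - 0) / ln (1 / (1 / A)))"
    using assms by (intro nn_integral_powr_tail) auto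
  finally show ?thesis using assms by (simp add: powr_divide powr_minus_divide)
qed

text \<open>The profile of the weight beyond the pure power: a logarithmic gain at small times and exponential
  decay at large ones.\<close>

definition ell :: "real \<Rightarrow> real \<Rightarrow> real" where
  "ell \<delta> \<tau> = (if \<tau> < 1/2 then 1 / ln (1 / \<tau>) else exp (- (\<delta> * \<tau>)))"

lemma measurable_ell [measurable]: "ell \<delta> \<in> borel_measurable borel"
  unfolding ell_def[abs_def] by measurable

lemma ell_pos: "\<tau> > 0 \<Longrightarrow> ell \<delta> \<tau> > 0"
  unfolding ell_def by auto

lemma ell_le:
  assumes "\<tau> > 0" "\<delta> \<ge> 0"
  shows "ell \<delta> \<tau> \<le> 2"
proof (cases "\<tau> < 1/2")
  case True
  have "1/2 \<le> ln (2::real)" using ln2_ge_two_thirds by simp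
  also have "ln 2 \<le> ln (1 / \<tau>)" using True assms by (subst ln_le_cancel_iff) (auto simp: field_simps)
  finally have "1 / ln (1 / \<tau>) \<le> 1 / (1/2)" by (intro divide_left_mono) auto
  thus ?thesis using True by (simp add: ell_def)
next
  case False
  have "exp (- (\<delta> * \<tau>)) \<le> exp 0" using assms by (subst exp_le_cancel_iff) auto
  hence "exp (- (\<delta> * \<tau>)) \<le> 2" unfolding exp_zero by linarith
  thus ?thesis using False by (simp add: ell_def)
qed

lemma powr_le_exp:
  fixes r \<delta> :: real
  assumes "\<delta> > 0"
  shows "\<exists>C>0. \<forall>\<tau>\<ge>1/2. \<tau> powr r \<le> C * exp (\<delta> * \<tau>)"
proof (cases "r > 0")
  case True
  have "\<tau> powr r \<le> (r / \<delta>) powr r * exp (\<delta> * \<tau>)" if "\<tau> \<ge> 1/2" for \<tau>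
  proof -
    have "\<delta> * \<tau> / r \<le> exp (\<delta> * \<tau> / r)"
      using exp_ge_add_one_self[of "\<delta> * \<tau> / r"] by linarith
    hence "(\<delta> * \<tau> / r) powr r \<le> exp (\<delta> * \<tau> / r) powr r"
      using that True assms by (intro powr_mono2) auto
    also have "\<dots> = exp (\<delta> * \<tau>)" using True by (simp add: powr_def)
    finally have "(r / \<delta>) powr r * (\<delta> * \<tau> / r) powr r \<le> (r / \<delta>) powr r * exp (\<delta> * \<tau>)"
      by (intro mult_left_mono) auto
    moreover have "(r / \<delta>) powr r * (\<delta> * \<tau> / r) powr r = \<tau> powr r"
      using True assms that by (subst powr_mult[symmetric]) auto
    ultimately show ?thesis by simp
  qed
  moreover have "(r / \<delta>) powr r > 0" using True assms by simp
  ultimately show ?thesis by blast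
next
  case False
  have "\<tau> powr r \<le> (1/2) powr r * exp (\<delta> * \<tau>)" if "\<tau> \<ge> 1/2" for \<tau>
  proof -
    have "\<tau> powr r \<le> (1/2) powr r * 1" using False that by (auto intro!: powr_mono2')
    also have "\<dots> \<le> (1/2) powr r * exp (\<delta> * \<tau>)" using assms that by (intro mult_left_mono) auto
    finally show ?thesis .
  qed
  moreover have "(1/2::real) powr r > 0" by simp
  ultimately show ?thesis by blast
qed

text \<open>For small times this is \<open>wt_small\<close>; for large times \<open>wt_large\<close> with \<open>\<rho>\<close> half way between \<open>1\<close> and
  \<open>lam\<close>, where half of the remaining exponential decay absorbs the powers of \<open>\<tau>\<close>.\<close>

lemma weight_bound:
  assumes "s > 0" "lam > 1" "b \<le> s + a"
  shows "\<exists>C>0. \<forall>\<tau>>0. exp (- (lam * \<tau>)) * wt s \<tau> * \<tau> powr (- b) \<le> C * \<tau> powr (- a - 1) * ell ((lam - 1) / 4) \<tau>"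
proof -
  define \<rho> where "\<rho> = (1 + lam) / 2"
  define \<delta> where "\<delta> = (lam - 1) / 4"
  have \<rho>: "\<rho> > 1" "\<delta> > 0" "\<rho> - lam = - (2 * \<delta>)" unfolding \<rho>_def \<delta>_def using assms by (auto simp: field_simps)
  obtain D where D: "D > 0" "\<And>\<tau>. \<tau> \<ge> 1/2 \<Longrightarrow> \<tau> powr (a + 1 - b) \<le> D * exp (\<delta> * \<tau>)"
    using powr_le_exp[OF \<rho>(2)] by blast
  define E where "E = 1 / ln \<rho> + 2 * exp 1"
  have E: "E > 0" unfolding E_def using \<rho> by (intro add_pos_pos) auto
  have "exp (- (lam * \<tau>)) * wt s \<tau> * \<tau> powr (- b) \<le> (exp 1 + E * D) * \<tau> powr (- a - 1) * ell \<delta> \<tau>" if \<tau>: "\<tau> > 0" for \<tau>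
  proof (cases "\<tau> < 1/2")
    case True
    hence l: "ln (1 / \<tau>) > 0" using \<tau> by simp
    have "ennreal (wt s \<tau>) \<le> ennreal (exp 1 * (\<tau> powr (s - 1) / ln (1 / \<tau>)))"
      unfolding wt_ennreal[OF assms(1) \<tau>] using True \<tau> by (intro wt_small assms) auto
    hence w: "wt s \<tau> \<le> exp 1 * (\<tau> powr (s - 1) / ln (1 / \<tau>))" using l by (subst (asm) ennreal_le_iff) auto
    have "exp (- (lam * \<tau>)) * wt s \<tau> * \<tau> powr (- b) \<le> 1 * (exp 1 * (\<tau> powr (s - 1) / ln (1 / \<tau>))) * \<tau> powr (- b)"
      using \<tau> assms by (intro mult_right_mono mult_mono w) (auto simp: wt_nonneg)
    also have "\<dots> = exp 1 * \<tau> powr (s - 1 - b) * ell \<delta> \<tau>"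
    proof -
      have "\<tau> powr (s - 1) * \<tau> powr (- b) = \<tau> powr (s - 1 - b)" by (simp add: powr_add[symmetric])
      thus ?thesis using True by (simp add: ell_def mult_ac)
    qed
    also have "\<dots> \<le> (exp 1 + E * D) * \<tau> powr (- a - 1) * ell \<delta> \<tau>"
      using \<tau> True assms E D(1) ell_pos[OF \<tau>, of \<delta>] by (intro mult_right_mono mult_mono powr_mono') auto
    finally show ?thesis .
  next
    case False
    have "ennreal (wt s \<tau>) \<le> ennreal (E * exp (\<rho> * \<tau>))"
      unfolding wt_ennreal[OF assms(1) \<tau>] E_def using False by (intro wt_large assms \<rho>) auto
    hence w: "wt s \<tau> \<le> E * exp (\<rho> * \<tau>)" using E by (subst (asm) ennreal_le_iff) auto
    have "exp (- (lam * \<tau>)) * wt s \<tau> * \<tau> powr (- b) \<le> exp (- (lam * \<tau>)) * (E * exp (\<rho> * \<tau>)) * \<tau> powr (- b)"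
      using \<tau> assms by (intro mult_right_mono mult_left_mono w) auto
    also have "\<dots> = E * (exp (- (2 * \<delta> * \<tau>)) * \<tau> powr (a + 1 - b)) * \<tau> powr (- a - 1)"
    proof -
      have "\<tau> powr (a + 1 - b) * \<tau> powr (- a - 1) = \<tau> powr (- b)" by (simp add: powr_add[symmetric])
      moreover have "exp (- (lam * \<tau>)) * exp (\<rho> * \<tau>) = exp (- (2 * \<delta> * \<tau>))"
        using \<rho>(3) by (simp add: exp_add[symmetric]) (metis add_uminus_conv_diff add.commute left_diff_distrib mult_minus_left)
      ultimately show ?thesis by (metis (no_types, opaque_lifting) mult.assoc mult.left_commute)
    qed
    also have "\<dots> \<le> E * (exp (- (2 * \<delta> * \<tau>)) * (D * exp (\<delta> * \<tau>))) * \<tau> powr (- a - 1)"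
      using False E D(2)[of \<tau>] by (intro mult_right_mono mult_left_mono) auto
    also have "\<dots> = E * D * \<tau> powr (- a - 1) * ell \<delta> \<tau>"
    proof -
      have "exp (- (2 * \<delta> * \<tau>)) * exp (\<delta> * \<tau>) = exp (- (\<delta> * \<tau>))" by (simp add: exp_add[symmetric])
      thus ?thesis using False by (simp add: ell_def mult_ac)
    qed
    also have "\<dots> \<le> (exp 1 + E * D) * \<tau> powr (- a - 1) * ell \<delta> \<tau>"
      using ell_pos[OF \<tau>, of \<delta>] by (intro mult_right_mono) auto
    finally show ?thesis .
  qed
  moreover have "exp 1 + E * D > 0" using E D(1) by (simp add: add_pos_pos)
  ultimately show ?thesis unfolding \<delta>_def by blast
qed

section \<open>Integrals of the logarithmic weight\<close>

text \<open>The primitive \<open>ln (1 / \<tau>) powr (1 - q) / (q - 1)\<close> vanishes at \<open>0\<close> because \<open>q > 1\<close>.\<close>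

lemma nn_integral_log_weight:
  fixes q h :: real
  assumes "q > 1" "0 < h" "h \<le> 1/2"
  shows "(\<integral>\<^sup>+\<tau>. ennreal (indicator {0<..<h} \<tau> * ((1 / ln (1 / \<tau>)) powr q / \<tau>)) \<partial>lborel) = ennreal (ln (1 / h) powr (1 - q) / (q - 1))"
proof -
  let ?f = "\<lambda>\<tau>::real. (1 / ln (1 / \<tau>)) powr q / \<tau>"
  let ?F = "\<lambda>\<tau>::real. ln (1 / \<tau>) powr (1 - q) / (q - 1)"
  have l: "ln (1 / x) > 0" if "0 < x" "x < 1" for x :: real using that by simp
  have D: "(?F has_real_derivative ?f x) (at x)" if "0 < x" "x < 1" for x
  proof -
    have "((\<lambda>\<tau>. ln (1 / \<tau>)) has_real_derivative - (1 / x)) (at x)"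
      using that by (auto intro!: derivative_eq_intros simp: field_simps power2_eq_square)
    from DERIV_chain2[where f = "\<lambda>z. z powr (1 - q)", OF has_real_derivative_powr[OF l[OF that]] this]
    have "((\<lambda>\<tau>. ln (1 / \<tau>) powr (1 - q)) has_real_derivative (1 - q) * ln (1 / x) powr (1 - q - 1) * - (1 / x)) (at x)" .
    from DERIV_cdivide[OF this, of "q - 1"]
    have "(?F has_real_derivative (1 - q) * ln (1 / x) powr (1 - q - 1) * - (1 / x) / (q - 1)) (at x)" .
    moreover have "(1 - q) * ln (1 / x) powr (1 - q - 1) * - (1 / x) / (q - 1) = ?f x"
      using assms l[OF that] that by (simp add: powr_minus_divide powr_divide field_simps)
    ultimately show ?thesis by simp
  qed
  have lim0: "(?F \<longlongrightarrow> 0) (at_right 0)"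
  proof -
    have "filterlim (\<lambda>x::real. ln (1 / x)) at_top (at_right 0)"
      by (rule filterlim_compose[OF ln_at_top])
        (simp add: divide_inverse filterlim_inverse_at_top_right)
    hence "((\<lambda>x::real. ln (1 / x) powr (1 - q)) \<longlongrightarrow> 0) (at_right 0)"
      using assms by (intro tendsto_neg_powr) auto
    from tendsto_divide[OF this tendsto_const[of "q - 1"]] assms show ?thesis by simp
  qed
  have limh: "(?F \<longlongrightarrow> ?F h) (at_left h)"
    using DERIV_isCont[OF D[of h]] assms unfolding isCont_def by (auto intro: tendsto_within_subset)
  note F = interval_integral_FTC_nonneg[of "ereal 0" "ereal h" ?F ?f 0 "?F h"]
  have c: "isCont ?f x" if "0 < x" "x < h" for x
    using that assms l[of x] by (intro continuous_intros) auto
  have e: "((?F \<circ> real_of_ereal) \<longlongrightarrow> 0) (at_right (ereal 0))" "((?F \<circ> real_of_ereal) \<longlongrightarrow> ?F h) (at_left (ereal h))"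
    using lim0 limh by (simp_all only: ereal_tendsto_simps)
  have "set_integrable lborel (einterval (ereal 0) (ereal h)) ?f"
    by (rule F(1)) (use assms D c e in auto)
  moreover have "(LBINT x=ereal 0..ereal h. ?f x) = ?F h - 0"
    by (rule F(2)) (use assms D c e in auto)
  ultimately
  have "integrable lborel (\<lambda>\<tau>. indicator {0<..<h} \<tau> * ?f \<tau>)" "(LINT \<tau>|lborel. indicator {0<..<h} \<tau> * ?f \<tau>) = ?F h"
    using assms by (auto simp: set_integrable_def interval_lebesgue_integral_def set_lebesgue_integral_def)
  thus ?thesis
    by (subst nn_integral_eq_integral) (auto split: split_indicator)
qed

lemma nn_integral_powr_tail_at_infinity:
  fixes r h :: real
  assumes "r > 0" "h > 0"
  shows "(\<integral>\<^sup>+\<tau>. ennreal (indicator {h..} \<tau> * \<tau> powr (- r - 1)) \<partial>lborel) = ennreal (h powr (- r) / r)"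
proof -
  have "(\<integral>\<^sup>+\<tau>. ennreal (\<tau> powr (- r - 1)) * indicator {h..} \<tau> \<partial>lborel) = ennreal (0 - (- (h powr (- r) / r)))"
  proof (rule nn_integral_FTC_atLeast)
    show "((\<lambda>\<tau>. - (\<tau> powr (- r) / r)) has_real_derivative x powr (- r - 1)) (at x)" if "h \<le> x" for x
      using that assms by (auto intro!: derivative_eq_intros has_real_derivative_powr)
    have "((\<lambda>\<tau>::real. \<tau> powr (- r)) \<longlongrightarrow> 0) at_top" using assms by (intro tendsto_neg_powr filterlim_ident) auto
    from tendsto_minus[OF tendsto_divide[OF this tendsto_const[of r]]] assms
    show "((\<lambda>\<tau>. - (\<tau> powr (- r) / r)) \<longlongrightarrow> 0) at_top" by simp
  qed auto
  moreover have "(\<integral>\<^sup>+\<tau>. ennreal (\<tau> powr (- r - 1)) * indicator {h..} \<tau> \<partial>lborel) = (\<integral>\<^sup>+\<tau>. ennreal (indicator {h..} \<tau> * \<tau> powr (- r - 1)) \<partial>lborel)"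
    by (intro nn_integral_cong) (auto split: split_indicator)
  ultimately show ?thesis by simp
qed

lemma nn_integral_ell:
  fixes q \<delta> :: real
  assumes "q > 1" "\<delta> > 0"
  shows "\<exists>J\<ge>0. (\<integral>\<^sup>+\<tau>. ennreal (indicator {0<..} \<tau> * (ell \<delta> \<tau> powr q / \<tau>)) \<partial>lborel) \<le> ennreal J"
proof -
  let ?f = "\<lambda>\<tau>. ennreal (indicator {0<..<1/2} \<tau> * ((1 / ln (1 / \<tau>)) powr q / \<tau>))"
  let ?g = "\<lambda>\<tau>. ennreal 2 * ennreal (indicator {0<..} \<tau> * exp (- (\<delta> * q * \<tau>)))"
  have "(\<integral>\<^sup>+\<tau>. ennreal (indicator {0<..} \<tau> * (ell \<delta> \<tau> powr q / \<tau>)) \<partial>lborel) \<le> (\<integral>\<^sup>+\<tau>. ?f \<tau> + ?g \<tau> \<partial>lborel)"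
  proof (rule nn_integral_mono)
    fix \<tau> :: real
    consider "\<tau> \<le> 0" | "0 < \<tau>" "\<tau> < 1/2" | "\<tau> \<ge> 1/2" by linarith
    thus "ennreal (indicator {0<..} \<tau> * (ell \<delta> \<tau> powr q / \<tau>)) \<le> ?f \<tau> + ?g \<tau>"
    proof cases
      case 2 thus ?thesis by (simp add: ell_def add_increasing2)
    next
      case 3
      have "exp (- (\<delta> * q * \<tau>)) / \<tau> \<le> exp (- (\<delta> * q * \<tau>)) / (1/2)" using 3 by (intro divide_left_mono) auto
      hence "ell \<delta> \<tau> powr q / \<tau> \<le> 2 * exp (- (\<delta> * q * \<tau>))" using 3 by (simp add: ell_def powr_def mult_ac)
      hence "ennreal (ell \<delta> \<tau> powr q / \<tau>) \<le> ennreal (2 * exp (- (\<delta> * q * \<tau>)))" by (rule ennreal_leI)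
      also have "\<dots> = ?g \<tau>" using 3 by (subst ennreal_mult) auto
      finally have "ennreal (ell \<delta> \<tau> powr q / \<tau>) \<le> ?g \<tau>" .
      thus ?thesis using 3 by (simp add: add_increasing)
    qed simp
  qed
  also have "\<dots> = (\<integral>\<^sup>+\<tau>. ?f \<tau> \<partial>lborel) + (\<integral>\<^sup>+\<tau>. ?g \<tau> \<partial>lborel)"
    by (rule nn_integral_add) auto
  also have "(\<integral>\<^sup>+\<tau>. ?g \<tau> \<partial>lborel) = ennreal 2 * ennreal (exp (- (\<delta> * q * 0)) / (\<delta> * q))"
    by (subst nn_integral_cmult) (use assms in \<open>auto simp: nn_integral_exp_tail\<close>)
  also have "(\<integral>\<^sup>+\<tau>. ?f \<tau> \<partial>lborel) = ennreal (ln (1 / (1/2)) powr (1 - q) / (q - 1))"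
    using assms by (intro nn_integral_log_weight) auto
  also have "ennreal (ln (1 / (1/2)) powr (1 - q) / (q - 1)) + ennreal 2 * ennreal (exp (- (\<delta> * q * 0)) / (\<delta> * q))
    = ennreal (ln (1 / (1/2)) powr (1 - q) / (q - 1) + 2 * (exp (- (\<delta> * q * 0)) / (\<delta> * q)))"
  proof -
    have *: "ennreal u + ennreal 2 * ennreal v = ennreal (u + 2 * v)" if "u \<ge> 0" "v \<ge> 0" for u v
      using that by (simp add: ennreal_mult)
    show ?thesis by (rule *) (use assms in auto)
  qed
  finally have "(\<integral>\<^sup>+\<tau>. ennreal (indicator {0<..} \<tau> * (ell \<delta> \<tau> powr q / \<tau>)) \<partial>lborel)
    \<le> ennreal (ln (1 / (1/2)) powr (1 - q) / (q - 1) + 2 * (exp (- (\<delta> * q * 0)) / (\<delta> * q)))" .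
  moreover have "ln (1 / (1/2)) powr (1 - q) / (q - 1) + 2 * (exp (- (\<delta> * q * 0)) / (\<delta> * q)) \<ge> 0"
    using assms by (intro add_nonneg_nonneg) auto
  ultimately show ?thesis by blast
qed

section \<open>Hoelder's inequality\<close>

text \<open>Young's inequality after normalisation. If one of the bounds is \<open>0\<close>, the product vanishes almost
  everywhere.\<close>

lemma nn_integral_Holder:
  fixes A B :: "'a \<Rightarrow> real"
  assumes [measurable]: "A \<in> borel_measurable M" "B \<in> borel_measurable M"
    and nn: "\<And>x. A x \<ge> 0" "\<And>x. B x \<ge> 0" and pq: "p > 1" "q > 1" "1 / p + 1 / q = 1"
    and X: "X \<ge> 0" "(\<integral>\<^sup>+x. ennreal (A x powr p) \<partial>M) \<le> ennreal X"
    and Y: "Y \<ge> 0" "(\<integral>\<^sup>+x. ennreal (B x powr q) \<partial>M) \<le> ennreal Y"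
  shows "(\<integral>\<^sup>+x. ennreal (A x * B x) \<partial>M) \<le> ennreal (X powr (1/p) * Y powr (1/q))"
proof (cases "X = 0 \<or> Y = 0")
  case True
  have "AE x in M. A x * B x = 0"
  proof (cases "X = 0")
    case True
    hence "(\<integral>\<^sup>+x. ennreal (A x powr p) \<partial>M) = 0" using X by simp
    hence "AE x in M. ennreal (A x powr p) = 0" by (subst (asm) nn_integral_0_iff_AE) auto
    thus ?thesis by eventually_elim (use pq in \<open>auto simp: ennreal_eq_0_iff\<close>)
  next
    case False
    hence "(\<integral>\<^sup>+x. ennreal (B x powr q) \<partial>M) = 0" using Y True by simp
    hence "AE x in M. ennreal (B x powr q) = 0" by (subst (asm) nn_integral_0_iff_AE) auto
    thus ?thesis by eventually_elim (use pq in \<open>auto simp: ennreal_eq_0_iff\<close>)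
  qed
  hence "(\<integral>\<^sup>+x. ennreal (A x * B x) \<partial>M) = 0" by (subst nn_integral_0_iff_AE) auto
  thus ?thesis by simp
next
  case False
  hence XY: "X > 0" "Y > 0" using X Y by auto
  define K where "K = X powr (1/p) * Y powr (1/q)"
  have K: "K > 0" unfolding K_def using XY by simp
  have "(\<integral>\<^sup>+x. ennreal (A x * B x) \<partial>M) \<le> (\<integral>\<^sup>+x. ennreal (K / (p * X)) * ennreal (A x powr p) + ennreal (K / (q * Y)) * ennreal (B x powr q) \<partial>M)"
  proof (rule nn_integral_mono)
    fix x
    let ?a = "A x / X powr (1/p)" and ?b = "B x / Y powr (1/q)"
    have "?a * ?b \<le> ?a powr p / p + ?b powr q / q"
      by (rule Youngs_inequality) (use pq nn in auto)
    also have "?a powr p = A x powr p / X" using pq XY nn by (simp add: powr_divide powr_powr)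
    also have "?b powr q = B x powr q / Y" using pq XY nn by (simp add: powr_divide powr_powr)
    finally have "K * (?a * ?b) \<le> K * (A x powr p / X / p + B x powr q / Y / q)" using K by (intro mult_left_mono) auto
    moreover have "K * (?a * ?b) = A x * B x" using XY by (simp add: K_def)
    moreover have "K * (A x powr p / X / p + B x powr q / Y / q) = K / (p * X) * A x powr p + K / (q * Y) * B x powr q"
      using XY pq by (simp add: field_simps)
    ultimately have "A x * B x \<le> K / (p * X) * A x powr p + K / (q * Y) * B x powr q" by simp
    hence "ennreal (A x * B x) \<le> ennreal (K / (p * X) * A x powr p + K / (q * Y) * B x powr q)" by (rule ennreal_leI)
    moreover have "ennreal (c * A x powr p + d * B x powr q) = ennreal c * ennreal (A x powr p) + ennreal d * ennreal (B x powr q)"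
      if "c \<ge> 0" "d \<ge> 0" for c d
      using that by (simp add: ennreal_mult)
    moreover have "K / (p * X) \<ge> 0" "K / (q * Y) \<ge> 0" using K XY pq by auto
    ultimately show "ennreal (A x * B x) \<le> ennreal (K / (p * X)) * ennreal (A x powr p) + ennreal (K / (q * Y)) * ennreal (B x powr q)"
      by metis
  qed
  also have "\<dots> = ennreal (K / (p * X)) * (\<integral>\<^sup>+x. ennreal (A x powr p) \<partial>M) + ennreal (K / (q * Y)) * (\<integral>\<^sup>+x. ennreal (B x powr q) \<partial>M)"
    by (subst nn_integral_add) (auto simp: nn_integral_cmult)
  also have "\<dots> \<le> ennreal (K / (p * X)) * ennreal X + ennreal (K / (q * Y)) * ennreal Y"
    by (intro add_mono mult_left_mono X Y) auto
  also have "\<dots> = ennreal (K * (1 / p + 1 / q))"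
    using K XY pq by (simp add: ennreal_mult'[symmetric] ennreal_plus[symmetric] field_simps del: ennreal_plus)
  finally show ?thesis unfolding pq(3) K_def by simp
qed

section \<open>Two scale-invariant Gaussian integrals\<close>

lemma gaussian_nn_integral:
  assumes "\<alpha> > 0"
  shows "(\<integral>\<^sup>+z. ennreal (exp (- (\<alpha> * (norm (z::real^'n::finite))\<^sup>2))) \<partial>lborel) = ennreal (sqrt (pi / \<alpha>) ^ CARD('n))"
proof -
  define \<tau> where "\<tau> = 1 / (4 * \<alpha>)"
  have \<tau>: "\<tau> > 0" unfolding \<tau>_def using assms by simp
  have "heat [] \<tau> z = (1 / sqrt (4 * pi * \<tau>)) ^ CARD('n) * exp (- (\<alpha> * (norm z)\<^sup>2))" for z :: "real^'n"
  proof -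
    have "heat1 0 \<tau> t = (1 / sqrt (4 * pi * \<tau>)) * exp (- (\<alpha> * t\<^sup>2))" for t
      using assms by (simp add: heat1_def \<tau>_def)
    thus ?thesis unfolding heat_def norm_sq_cart
      by (simp only: count_list.simps prod.distrib prod_constant exp_sum[symmetric, OF finite] sum_distrib_left sum_negf)
  qed
  hence e: "exp (- (\<alpha> * (norm z)\<^sup>2)) = sqrt (4 * pi * \<tau>) ^ CARD('n) * heat [] \<tau> z" for z :: "real^'n"
    using \<tau> by (simp add: power_divide)
  have "4 * pi * \<tau> = pi / \<alpha>" unfolding \<tau>_def by simp
  thus ?thesis unfolding e
    using heat_integral[OF \<tau>, where ?'n = 'n] heat_nonneg[OF \<tau>, where ?'a = 'n] \<tau> assms
    by (subst nn_integral_eq_integral) auto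
qed

lemma square_powr: "r > 0 \<Longrightarrow> (r\<^sup>2) powr x = r powr (2 * x)" for r :: real
  using powr_powr[of r 2 x] by simp

text \<open>The power of \<open>t + c\<close> is itself a Gamma integral of \<open>exp (- ((t + c) * u))\<close>; by Tonelli's theorem only Gamma
  integrals remain.\<close>

lemma nn_integral_Beta:
  fixes x y c :: real
  assumes "0 < x" "x < y" "c > 0"
  shows "(\<integral>\<^sup>+t. ennreal (indicator {0<..} t * t powr (x - 1) * (t + c) powr (- y)) \<partial>lborel)
    = ennreal (Gamma x * Gamma (y - x) / Gamma y * c powr (x - y))"
proof -
  have G: "Gamma x > 0" "Gamma y > 0" "Gamma (y - x) > 0" using assms by auto
  let ?k = "\<lambda>t u. ennreal (1 / Gamma y) * (ennreal (indicator {0<..} u * (u powr (y - 1) * exp (- (c * u)))) *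
    ennreal (indicator {0<..} t * (t powr (x - 1) * exp (- (u * t)))))"
  have "(\<integral>\<^sup>+t. ennreal (indicator {0<..} t * t powr (x - 1) * (t + c) powr (- y)) \<partial>lborel)
    = (\<integral>\<^sup>+t. \<integral>\<^sup>+u. ?k t u \<partial>lborel \<partial>lborel)"
  proof (rule nn_integral_cong)
    fix t :: real
    show "ennreal (indicator {0<..} t * t powr (x - 1) * (t + c) powr (- y)) = (\<integral>\<^sup>+u. ?k t u \<partial>lborel)"
    proof (cases "t > 0")
      case True
      let ?w = "1 / Gamma y * t powr (x - 1)"
      have "(\<integral>\<^sup>+u. ?k t u \<partial>lborel) = (\<integral>\<^sup>+u. ennreal ?w * ennreal (indicator {0<..} u * (u powr (y - 1) * exp (- ((t + c) * u)))) \<partial>lborel)"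
        using True G by (intro nn_integral_cong)
          (auto simp: ennreal_mult'[symmetric] exp_add[symmetric] algebra_simps split: split_indicator)
      also have "\<dots> = ennreal ?w * ennreal (Gamma y * (t + c) powr (- y))"
        using True assms by (subst nn_integral_cmult) (auto simp: nn_integral_Gamma)
      also have "\<dots> = ennreal (t powr (x - 1) * (t + c) powr (- y))"
        using G less_imp_neq[OF G(2)] by (subst ennreal_mult'[symmetric]) (simp_all add: field_simps)
      finally show ?thesis using True by simp
    qed simp
  qed
  also have "\<dots> = (\<integral>\<^sup>+u. \<integral>\<^sup>+t. ?k t u \<partial>lborel \<partial>lborel)"
    by (rule lborel_pair.Fubini'[symmetric]) measurable
  also have "\<dots> = (\<integral>\<^sup>+u. ennreal (Gamma x / Gamma y) * ennreal (indicator {0<..} u * (u powr (y - x - 1) * exp (- (c * u)))) \<partial>lborel)"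
  proof (rule nn_integral_cong)
    fix u :: real
    show "(\<integral>\<^sup>+t. ?k t u \<partial>lborel) = ennreal (Gamma x / Gamma y) * ennreal (indicator {0<..} u * (u powr (y - x - 1) * exp (- (c * u))))"
    proof (cases "u > 0")
      case True
      have "y - 1 + - x = y - x - 1" by simp
      hence e: "u powr (y - 1) * u powr (- x) = u powr (y - x - 1)" unfolding powr_add[symmetric] by (simp only:)
      have "(\<integral>\<^sup>+t. ?k t u \<partial>lborel) = ennreal (1 / Gamma y) * (ennreal (u powr (y - 1) * exp (- (c * u))) * ennreal (Gamma x * u powr (- x)))"
        using True assms nn_integral_Gamma[of x u] by (simp add: nn_integral_cmult)
      also have "\<dots> = ennreal (1 / Gamma y * (u powr (y - 1) * exp (- (c * u)) * (Gamma x * u powr (- x))))"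
      proof -
        have *: "ennreal u * (ennreal v * ennreal w) = ennreal (u * (v * w))" if "u \<ge> 0" "v \<ge> 0" "w \<ge> 0" for u v w
          using that by (simp add: ennreal_mult)
        show ?thesis by (rule *) (use G in auto)
      qed
      also have "1 / Gamma y * (u powr (y - 1) * exp (- (c * u)) * (Gamma x * u powr (- x))) = Gamma x / Gamma y * (u powr (y - x - 1) * exp (- (c * u)))"
        unfolding e[symmetric] by simp
      also have "\<dots> = ennreal (Gamma x / Gamma y) * ennreal (indicator {0<..} u * (u powr (y - x - 1) * exp (- (c * u))))"
        using G True by (subst ennreal_mult) auto
      finally show ?thesis .
    qed simp
  qed
  also have "\<dots> = ennreal (Gamma x / Gamma y) * ennreal (Gamma (y - x) * c powr (- (y - x)))"
    using assms nn_integral_Gamma[of "y - x" c] by (subst nn_integral_cmult) auto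
  also have "\<dots> = ennreal (Gamma x * Gamma (y - x) / Gamma y * c powr (x - y))"
    using G by (subst ennreal_mult'[symmetric]) auto
  finally show ?thesis .
qed

text \<open>A negative power of \<open>|z|\<close> is a superposition of Gaussians, by the Gamma integral at \<open>(norm z)\<^sup>2\<close>; after
  integration in \<open>z\<close> a Beta integral remains, finite since \<open>1/4 < n / 2\<close>. The dependence on \<open>\<tau>\<close> is
  dictated by scaling.\<close>

lemma singular_gaussian_integral:
  "\<exists>C>0. \<forall>\<tau>>0. (\<integral>\<^sup>+z. ennreal (norm (z::real^'n::finite) powr (- 1 / 2) * exp (- (norm z)\<^sup>2 / (16 * \<tau>))) \<partial>lborel)
     \<le> ennreal (C * \<tau> powr (real CARD('n) / 2 - 1 / 4))"
proof -
  let ?d = "real CARD('n) / 2"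
  define K where "K = sqrt pi ^ CARD('n) / Gamma (1/4) * (Gamma (1/4) * Gamma (?d - 1/4) / Gamma ?d)"
  have d: "?d \<ge> 1/2" using zero_less_card_finite[where ?'a = 'n] by linarith
  have G: "Gamma (1/4 :: real) > 0" "Gamma ?d > 0" "Gamma (?d - 1/4) > 0" by (rule Gamma_real_pos, use d in linarith)+
  have K: "K > 0" unfolding K_def using G by (intro mult_pos_pos divide_pos_pos zero_less_power) auto
  have "(\<integral>\<^sup>+z. ennreal (norm (z::real^'n) powr (- 1 / 2) * exp (- (norm z)\<^sup>2 / (16 * \<tau>))) \<partial>lborel)
     \<le> ennreal (K * 16 powr (?d - 1 / 4) * \<tau> powr (?d - 1 / 4))" if \<tau>: "\<tau> > 0" for \<tau>
  proof -
    define c where "c = 1 / (16 * \<tau>)"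
    have c: "c > 0" unfolding c_def using \<tau> by simp
    let ?t = "\<lambda>t::real. indicator {0<..} t * t powr (1/4 - 1)"
    let ?k = "\<lambda>(z::real^'n) t. ennreal (1 / Gamma (1/4) * ?t t) * ennreal (exp (- ((t + c) * (norm z)\<^sup>2)))"
    have "(\<integral>\<^sup>+z. ennreal (norm (z::real^'n) powr (- 1 / 2) * exp (- (norm z)\<^sup>2 / (16 * \<tau>))) \<partial>lborel)
       \<le> (\<integral>\<^sup>+z. \<integral>\<^sup>+t. ?k z t \<partial>lborel \<partial>lborel)"
    proof (rule nn_integral_mono)
      fix z :: "real^'n"
      show "ennreal (norm z powr (- 1 / 2) * exp (- (norm z)\<^sup>2 / (16 * \<tau>))) \<le> (\<integral>\<^sup>+t. ?k z t \<partial>lborel)"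
      proof (cases "z = 0")
        case False
        let ?A = "(norm z)\<^sup>2" and ?w = "1 / Gamma (1/4) * exp (- (c * (norm z)\<^sup>2))"
        have A: "?A > 0" using False by simp
        have "?A powr (- (1/4)) = norm z powr (- 1 / 2)"
          using False by (simp add: square_powr)
        hence "ennreal (norm z powr (- 1 / 2) * exp (- (norm z)\<^sup>2 / (16 * \<tau>))) = ennreal ?w * ennreal (Gamma (1/4) * ?A powr (- (1/4)))"
          using G less_imp_neq[OF G(1)] by (subst ennreal_mult'[symmetric]) (simp_all add: c_def)
        also have "\<dots> = (\<integral>\<^sup>+t. ennreal ?w * ennreal (indicator {0<..} t * (t powr (1/4 - 1) * exp (- (?A * t)))) \<partial>lborel)"
          by (subst nn_integral_cmult) (use nn_integral_Gamma[of "1/4" ?A] A in auto)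
        also have "\<dots> = (\<integral>\<^sup>+t. ?k z t \<partial>lborel)"
          using G by (intro nn_integral_cong) (auto simp: ennreal_mult'[symmetric] exp_add[symmetric] algebra_simps split: split_indicator)
        finally show ?thesis by simp
      qed simp
    qed
    also have "\<dots> = (\<integral>\<^sup>+t. \<integral>\<^sup>+z. ?k z t \<partial>lborel \<partial>lborel)"
      by (rule lborel_pair.Fubini'[symmetric]) measurable
    also have "\<dots> = (\<integral>\<^sup>+t. ennreal (sqrt pi ^ CARD('n) / Gamma (1/4)) * ennreal (?t t * (t + c) powr (- ?d)) \<partial>lborel)"
    proof (rule nn_integral_cong)
      fix t :: real
      show "(\<integral>\<^sup>+z. ?k z t \<partial>lborel) = ennreal (sqrt pi ^ CARD('n) / Gamma (1/4)) * ennreal (?t t * (t + c) powr (- ?d))"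
      proof (cases "t > 0")
        case t: True
        have e: "sqrt (t + c) ^ CARD('n) = (t + c) powr ?d"
          using t c by (simp add: powr_half_sqrt[symmetric] powr_realpow[symmetric] powr_powr)
        have "sqrt (pi / (t + c)) ^ CARD('n) = sqrt pi ^ CARD('n) / sqrt (t + c) ^ CARD('n)"
          by (simp add: real_sqrt_divide power_divide)
        also have "\<dots> = sqrt pi ^ CARD('n) * (t + c) powr (- ?d)"
          unfolding e using powr_minus_divide[of "t + c" ?d] by simp
        finally show ?thesis
          using t c G by (subst nn_integral_cmult) (simp_all add: gaussian_nn_integral ennreal_mult'[symmetric] mult_ac)
      qed simp
    qed
    also have "\<dots> = ennreal (sqrt pi ^ CARD('n) / Gamma (1/4)) * ennreal (Gamma (1/4) * Gamma (?d - 1/4) / Gamma ?d * c powr (1/4 - ?d))"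
    proof -
      have "1/4 < ?d" using d by linarith
      thus ?thesis using nn_integral_Beta[of "1/4" ?d c] c by (subst nn_integral_cmult) auto
    qed
    also have "\<dots> = ennreal (K * c powr (1/4 - ?d))"
      unfolding K_def using G by (subst ennreal_mult'[symmetric]) (auto simp: mult.assoc)
    also have "c powr (1/4 - ?d) = 16 powr (?d - 1 / 4) * \<tau> powr (?d - 1 / 4)"
    proof -
      have "c powr e = (16 * \<tau>) powr (- e)" for e
        unfolding c_def powr_minus_divide using \<tau> by (subst powr_divide) auto
      moreover have "- (1/4 - ?d) = ?d - 1 / 4" by simp
      ultimately show ?thesis using \<tau> by (metis powr_mult)
    qed
    finally show ?thesis by (simp add: mult.assoc)
  qed
  moreover have "K * 16 powr (?d - 1 / 4) > 0" using K by simp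
  ultimately show ?thesis by blast
qed

text \<open>By scaling the integral is the same for all \<open>r > 0\<close>. The exponential is at most a constant times
  \<open>(1 + r\<^sup>2 / \<tau>) powr (- \<beta> - 1)\<close>, which turns the power of \<open>\<tau>\<close> into the same power of \<open>\<tau> + r\<^sup>2\<close>.\<close>

lemma time_gaussian_integral:
  fixes \<beta> :: real
  assumes "\<beta> > 0"
  shows "\<exists>C>0. \<forall>r\<ge>0. (\<integral>\<^sup>+\<tau>. ennreal (indicator {0<..} \<tau> * (r powr (2 * \<beta>) * \<tau> powr (- \<beta> - 1) * exp (- r\<^sup>2 / (16 * \<tau>)))) \<partial>lborel) \<le> ennreal C"
proof -
  let ?f = "\<lambda>r \<tau>. indicator {0<..} \<tau> * (r powr (2 * \<beta>) * \<tau> powr (- \<beta> - 1) * exp (- r\<^sup>2 / (16 * \<tau>)))"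
  obtain K where K: "K > 0" "\<And>u. u \<ge> 1/2 \<Longrightarrow> u powr (\<beta> + 1) \<le> K * exp (1/16 * u)"
    using powr_le_exp[of "1/16" "\<beta> + 1"] by auto
  define D where "D = K * exp (1/16)"
  have D: "D > 0" unfolding D_def using K(1) by simp
  have "(\<integral>\<^sup>+\<tau>. ennreal (?f r \<tau>) \<partial>lborel) \<le> ennreal (D / \<beta>)" if r: "r > 0" for r
  proof -
    let ?g = "\<lambda>v. ennreal (indicator {r\<^sup>2..} v * v powr (- \<beta> - 1))"
    have "(\<integral>\<^sup>+\<tau>. ennreal (?f r \<tau>) \<partial>lborel) \<le> (\<integral>\<^sup>+\<tau>. ennreal (D * r powr (2 * \<beta>)) * ?g (r\<^sup>2 + 1 * \<tau>) \<partial>lborel)"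
    proof (rule nn_integral_mono)
      fix \<tau> :: real
      show "ennreal (?f r \<tau>) \<le> ennreal (D * r powr (2 * \<beta>)) * ?g (r\<^sup>2 + 1 * \<tau>)"
      proof (cases "\<tau> > 0")
        case True
        let ?v = "r\<^sup>2 + \<tau>"
        have v: "?v / \<tau> = 1 + r\<^sup>2 / \<tau>" using True by (simp add: field_simps)
        have "(?v / \<tau>) powr (\<beta> + 1) \<le> K * exp (1/16 * (?v / \<tau>))"
          using True by (intro K(2)) (simp add: field_simps)
        also have "\<dots> = D * exp (r\<^sup>2 / (16 * \<tau>))"
          unfolding v D_def by (simp add: exp_add[symmetric] distrib_left)
        finally have "(?v / \<tau>) powr (\<beta> + 1) * exp (- r\<^sup>2 / (16 * \<tau>)) \<le> D * exp (r\<^sup>2 / (16 * \<tau>)) * exp (- r\<^sup>2 / (16 * \<tau>))"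
          by (intro mult_right_mono) auto
        also have "\<dots> = D" by (simp add: exp_minus)
        finally have "?v powr (- \<beta> - 1) * ((?v / \<tau>) powr (\<beta> + 1) * exp (- r\<^sup>2 / (16 * \<tau>))) \<le> ?v powr (- \<beta> - 1) * D"
          by (rule mult_left_mono) simp
        moreover have "?v powr (- \<beta> - 1) * (?v / \<tau>) powr (\<beta> + 1) = \<tau> powr (- \<beta> - 1)"
        proof -
          have "w powr (- \<beta> - 1) = 1 / w powr (\<beta> + 1)" for w :: real
            using powr_minus_divide[of w "\<beta> + 1"] by simp
          moreover have "?v \<noteq> 0" using True zero_le_power2[of r] by linarith
          ultimately show ?thesis using True by (simp add: powr_divide)
        qed
        ultimately have "\<tau> powr (- \<beta> - 1) * exp (- r\<^sup>2 / (16 * \<tau>)) \<le> D * ?v powr (- \<beta> - 1)"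
          by (simp add: mult.assoc[symmetric] mult.commute)
        hence "r powr (2 * \<beta>) * (\<tau> powr (- \<beta> - 1) * exp (- r\<^sup>2 / (16 * \<tau>))) \<le> r powr (2 * \<beta>) * (D * ?v powr (- \<beta> - 1))"
          by (intro mult_left_mono) auto
        thus ?thesis using True D by (subst ennreal_mult'[symmetric]) (auto intro!: ennreal_leI simp: mult_ac)
      qed simp
    qed
    also have "\<dots> = ennreal (D * r powr (2 * \<beta>)) * ennreal ((r\<^sup>2) powr (- \<beta>) / \<beta>)"
      using r assms nn_integral_real_affine[of ?g 1 "r\<^sup>2"] nn_integral_powr_tail_at_infinity[of \<beta> "r\<^sup>2"]
      by (subst nn_integral_cmult) auto
    also have "\<dots> = ennreal (D / \<beta>)"
      using r D assms by (subst ennreal_mult'[symmetric]) (auto simp: square_powr powr_minus)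
    finally show ?thesis .
  qed
  hence "(\<integral>\<^sup>+\<tau>. ennreal (?f r \<tau>) \<partial>lborel) \<le> ennreal (D / \<beta>)" if "r \<ge> 0" for r
    using that by (cases "r = 0") auto
  moreover have "D / \<beta> > 0" using D assms by simp
  ultimately show ?thesis by blast
qed

section \<open>The critical kernel estimate\<close>

lemma nn_integral_lborel_diff:
  fixes F :: "'a::euclidean_space \<Rightarrow> ennreal"
  assumes "F \<in> borel_measurable borel"
  shows "(\<integral>\<^sup>+y. F (x - y) \<partial>lborel) = (\<integral>\<^sup>+z. F z \<partial>lborel)"
  using lborel_affine_nn_integral[OF assms, of "-1" x] by simp

text \<open>The \<open>q\<close>-th power of the norm of \<open>\<omega>\<close> in \<open>L\<^sup>q\<close> for the dilation-invariant measure \<open>d\<tau> / \<tau>\<close>.\<close>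

definition time_mass :: "real \<Rightarrow> (real \<Rightarrow> real) \<Rightarrow> ennreal" where
  "time_mass q \<omega> = (\<integral>\<^sup>+\<tau>. ennreal (indicator {0<..} \<tau> * (\<omega> \<tau> powr q / \<tau>)) \<partial>lborel)"

text \<open>The common form of all pointwise bounds for kernels: for \<open>\<omega> = 1\<close> and
  \<open>a = n / (2 * q)\<close> the \<open>L\<^sup>q\<close> norm of the kernel in space is a multiple of \<open>1 / \<tau>\<close>, which is exactly
  critical, and \<open>\<omega>\<close> is the gain over it.\<close>

definition majorant ::
  "real \<Rightarrow> real \<Rightarrow> (real \<Rightarrow> real) \<Rightarrow> 'n::finite scalar_field \<Rightarrow> real^'n \<Rightarrow> real \<Rightarrow> real^'n \<Rightarrow> real" where
  "majorant b a \<omega> g x \<tau> y =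
     indicator {0<..} \<tau> * (\<omega> \<tau> * \<tau> powr (- a - 1) * exp (- (norm (x - y))\<^sup>2 / (b * \<tau>)) * norm (g y))"

text \<open>Hoelder's inequality on the product of time and space. The kernel is split as \<open>A * B\<close>, where \<open>A\<close>
  carries \<open>g\<close> and is such that \<open>A powr p\<close>, integrated in time, is \<open>norm (g y) powr p\<close> up to a constant
  (\<open>time_gaussian_integral\<close>), while \<open>B powr q\<close>, integrated in space, is \<open>\<omega> \<tau> powr q / \<tau>\<close> up to a constant
  (\<open>singular_gaussian_integral\<close>). Without the powers of \<open>|x - y|\<close> the first of these integrals would
  diverge logarithmically at both ends.\<close>

lemma kernel_Holder:
  fixes p q a :: real
  assumes pq: "p > 1" "q > 1" "1 / p + 1 / q = 1" and a: "a = real CARD('n::finite) / (2 * q)"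
  shows "\<exists>C>0. \<forall>\<omega> J. \<forall>g :: 'n scalar_field. \<forall>x.
     \<omega> \<in> borel_measurable borel \<longrightarrow> (\<forall>\<tau>. \<omega> \<tau> \<ge> 0) \<longrightarrow> J \<ge> 0 \<longrightarrow>
     time_mass q \<omega> \<le> ennreal J \<longrightarrow> g \<in> Lp p \<longrightarrow>
     (\<integral>\<^sup>+\<tau>. \<integral>\<^sup>+y. ennreal (majorant 16 a \<omega> g x \<tau> y) \<partial>lborel \<partial>lborel)
       \<le> ennreal (C * J powr (1 / q) * Lp_norm p g)"
proof -
  \<comment> \<open>With this choice the second factor contains \<open>|x - y|\<close> to the power \<open>- 1 / 2\<close>, which is locally
    integrable in every dimension.\<close>
  define \<beta> where "\<beta> = (p - 1) / 4"
  have \<beta>: "\<beta> > 0" unfolding \<beta>_def using pq by simp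
  have qp: "q / p = q - 1" using pq by (simp add: field_simps)
  have \<beta>q: "\<beta> * (q / p) = 1 / 4"
  proof -
    have "(p - 1) * (q / p) = 1" using pq by (simp add: field_simps)
    thus ?thesis unfolding \<beta>_def by simp
  qed
  obtain C1 where C1: "C1 > 0" "\<And>r. r \<ge> 0 \<Longrightarrow> (\<integral>\<^sup>+\<tau>. ennreal (indicator {0<..} \<tau> * (r powr (2 * \<beta>) * \<tau> powr (- \<beta> - 1) * exp (- r\<^sup>2 / (16 * \<tau>)))) \<partial>lborel) \<le> ennreal C1"
    using time_gaussian_integral[OF \<beta>] by blast
  obtain C2 where C2: "C2 > 0" "\<And>\<tau>. \<tau> > 0 \<Longrightarrow> (\<integral>\<^sup>+z. ennreal (norm (z::real^'n) powr (- 1 / 2) * exp (- (norm z)\<^sup>2 / (16 * \<tau>))) \<partial>lborel)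
     \<le> ennreal (C2 * \<tau> powr (real CARD('n) / 2 - 1 / 4))"
    using singular_gaussian_integral[where ?'n = 'n] by blast
  define C where "C = C1 powr (1 / p) * C2 powr (1 / q)"
  have "(\<integral>\<^sup>+\<tau>. \<integral>\<^sup>+y. ennreal (majorant 16 a \<omega> g x \<tau> y) \<partial>lborel \<partial>lborel)
       \<le> ennreal (C * J powr (1 / q) * Lp_norm p g)"
    if \<omega>m [measurable]: "\<omega> \<in> borel_measurable borel" and \<omega>: "\<And>\<tau>. \<omega> \<tau> \<ge> 0" and J: "J \<ge> 0"
      "time_mass q \<omega> \<le> ennreal J" and g: "g \<in> Lp p"
    for \<omega> J and g :: "'n scalar_field" and x
  proof -
    have gm [measurable]: "g \<in> borel_measurable borel" and gi: "integrable lborel (\<lambda>y. norm (g y) powr p)"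
      using g unfolding Lp_def by auto
    let ?r = "\<lambda>y. norm (x - y)"
    let ?e = "\<lambda>\<tau> y. exp (- (?r y)\<^sup>2 / (16 * \<tau>))"
    let ?\<alpha> = "\<lambda>\<tau> y. indicator {0<..} \<tau> * (?r y powr (2 * \<beta>) * \<tau> powr (- \<beta> - 1) * ?e \<tau> y)"
    let ?d = "real CARD('n) / 2"
    define G where "G = (LINT y|lborel. norm (g y) powr p)"
    have G: "G \<ge> 0" unfolding G_def by simp
    have Gn: "(\<integral>\<^sup>+y. ennreal (norm (g y) powr p) \<partial>lborel) = ennreal G"
      unfolding G_def by (rule nn_integral_eq_integral[OF gi]) auto
    define A where "A = (\<lambda>(\<tau>, y). indicator {0<..} \<tau> * (norm (g y) * (?r y powr (2 * \<beta> / p) * \<tau> powr (- (\<beta> + 1) / p) * exp (- (?r y)\<^sup>2 / (16 * \<tau>) / p))))"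
    define B where "B = (\<lambda>(\<tau>, y). indicator {0<..} \<tau> * (\<omega> \<tau> * (\<tau> powr (- a - 1 + (\<beta> + 1) / p) * ?r y powr (- (2 * \<beta> / p)) * exp (- (?r y)\<^sup>2 / (16 * \<tau>) / q))))"
    have Am [measurable]: "A \<in> borel_measurable (lborel \<Otimes>\<^sub>M lborel)" unfolding A_def by measurable
    have Bm [measurable]: "B \<in> borel_measurable (lborel \<Otimes>\<^sub>M lborel)" unfolding B_def by measurable
    have nn: "A z \<ge> 0" "B z \<ge> 0" for z unfolding A_def B_def using \<omega> by (auto simp: split_def)
    have Ap: "A (\<tau>, y) powr p = norm (g y) powr p * ?\<alpha> \<tau> y" for \<tau> y
    proof (cases "\<tau> > 0")
      case True
      have "exp (- (u / (v * p))) powr p = exp (- (u / v))" for u v :: real using pq by (simp add: powr_def)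
      moreover have "- (\<beta> + 1) = - \<beta> - 1" by simp
      ultimately show ?thesis using True pq by (simp add: A_def powr_mult powr_powr)
    qed (simp add: A_def)
    have Bq: "B (\<tau>, y) powr q = indicator {0<..} \<tau> * (\<omega> \<tau> powr q * \<tau> powr (- ?d - 3 / 4)) * (?r y powr (- 1 / 2) * ?e \<tau> y)" for \<tau> y
    proof (cases "\<tau> > 0")
      case True
      have 1: "exp (- (u / (v * q))) powr q = exp (- (u / v))" for u v :: real using pq by (simp add: powr_def)
      have 2: "(- a - 1 + (\<beta> + 1) / p) * q = - ?d - 3 / 4"
      proof -
        have "(- a - 1 + (\<beta> + 1) / p) * q = - (a * q) - q + \<beta> * (q / p) + q / p" using pq by (simp add: field_simps)
        also have "a * q = ?d" unfolding a using pq by simp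
        finally show ?thesis unfolding \<beta>q unfolding qp by simp
      qed
      have 3: "- (2 * \<beta> / p) * q = - 1 / 2"
      proof -
        have "- (2 * \<beta> / p) * q = - 2 * (\<beta> * (q / p))" by simp
        also have "\<dots> = - 1 / 2" unfolding \<beta>q by simp
        finally show ?thesis .
      qed
      have "B (\<tau>, y) powr q = \<omega> \<tau> powr q * (\<tau> powr ((- a - 1 + (\<beta> + 1) / p) * q) * ?r y powr (- (2 * \<beta> / p) * q) * ?e \<tau> y)"
        using True \<omega>[of \<tau>] by (simp add: B_def powr_mult powr_powr 1)
      thus ?thesis unfolding 2 3 using True by simp
    qed (simp add: B_def)
    have X: "(\<integral>\<^sup>+z. ennreal (A z powr p) \<partial>(lborel \<Otimes>\<^sub>M lborel)) \<le> ennreal (C1 * G)"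
    proof -
      have "(\<integral>\<^sup>+z. ennreal (A z powr p) \<partial>(lborel \<Otimes>\<^sub>M lborel)) = (\<integral>\<^sup>+y. \<integral>\<^sup>+\<tau>. ennreal (A (\<tau>, y) powr p) \<partial>lborel \<partial>lborel)"
        by (rule lborel_pair.nn_integral_snd[symmetric]) measurable
      also have "\<dots> \<le> (\<integral>\<^sup>+y. ennreal C1 * ennreal (norm (g y) powr p) \<partial>lborel)"
      proof (rule nn_integral_mono)
        fix y
        have "(\<integral>\<^sup>+\<tau>. ennreal (A (\<tau>, y) powr p) \<partial>lborel) = (\<integral>\<^sup>+\<tau>. ennreal (norm (g y) powr p) * ennreal (?\<alpha> \<tau> y) \<partial>lborel)"
          unfolding Ap by (intro nn_integral_cong ennreal_mult) auto
        also have "\<dots> = ennreal (norm (g y) powr p) * (\<integral>\<^sup>+\<tau>. ennreal (?\<alpha> \<tau> y) \<partial>lborel)"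
          by (rule nn_integral_cmult) measurable
        also have "\<dots> \<le> ennreal (norm (g y) powr p) * ennreal C1"
          by (intro mult_left_mono C1) auto
        finally show "(\<integral>\<^sup>+\<tau>. ennreal (A (\<tau>, y) powr p) \<partial>lborel) \<le> ennreal C1 * ennreal (norm (g y) powr p)"
          by (simp only: mult.commute)
      qed
      also have "\<dots> = ennreal (C1 * G)"
        using C1(1) G by (subst nn_integral_cmult) (simp_all add: Gn ennreal_mult)
      finally show ?thesis .
    qed
    have Y: "(\<integral>\<^sup>+z. ennreal (B z powr q) \<partial>(lborel \<Otimes>\<^sub>M lborel)) \<le> ennreal (C2 * J)"
    proof -
      have "(\<integral>\<^sup>+z. ennreal (B z powr q) \<partial>(lborel \<Otimes>\<^sub>M lborel)) = (\<integral>\<^sup>+\<tau>. \<integral>\<^sup>+y. ennreal (B (\<tau>, y) powr q) \<partial>lborel \<partial>lborel)"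
        by (rule lborel.nn_integral_fst[symmetric]) measurable
      also have "\<dots> \<le> (\<integral>\<^sup>+\<tau>. ennreal C2 * ennreal (indicator {0<..} \<tau> * (\<omega> \<tau> powr q / \<tau>)) \<partial>lborel)"
      proof (rule nn_integral_mono)
        fix \<tau> :: real
        show "(\<integral>\<^sup>+y. ennreal (B (\<tau>, y) powr q) \<partial>lborel) \<le> ennreal C2 * ennreal (indicator {0<..} \<tau> * (\<omega> \<tau> powr q / \<tau>))"
        proof (cases "\<tau> > 0")
          case True
          let ?c = "\<omega> \<tau> powr q * \<tau> powr (- ?d - 3 / 4)"
          let ?h = "\<lambda>z::real^'n. ennreal (norm z powr (- 1 / 2) * exp (- (norm z)\<^sup>2 / (16 * \<tau>)))"
          have "(\<integral>\<^sup>+y. ennreal (B (\<tau>, y) powr q) \<partial>lborel) = (\<integral>\<^sup>+y. ennreal ?c * ?h (x - y) \<partial>lborel)"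
            unfolding Bq using True by (intro nn_integral_cong) (simp add: ennreal_mult[symmetric])
          also have "\<dots> = ennreal ?c * (\<integral>\<^sup>+y. ?h (x - y) \<partial>lborel)"
            by (rule nn_integral_cmult) measurable
          also have "(\<integral>\<^sup>+y. ?h (x - y) \<partial>lborel) = (\<integral>\<^sup>+z. ?h z \<partial>lborel)"
            by (rule nn_integral_lborel_diff) measurable
          also have "ennreal ?c * (\<integral>\<^sup>+z. ?h z \<partial>lborel) \<le> ennreal ?c * ennreal (C2 * \<tau> powr (?d - 1 / 4))"
            by (intro mult_left_mono C2 True) auto
          also have "\<dots> = ennreal (?c * (C2 * \<tau> powr (?d - 1 / 4)))"
            using C2(1) by (intro ennreal_mult[symmetric]) auto
          also have "?c * (C2 * \<tau> powr (?d - 1 / 4)) = C2 * (\<omega> \<tau> powr q / \<tau>)"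
          proof -
            have "\<tau> powr (- ?d - 3 / 4) * \<tau> powr (?d - 1 / 4) = \<tau> powr (- 1)"
              by (simp add: powr_add[symmetric])
            also have "\<dots> = 1 / \<tau>" using True by (simp add: powr_minus_divide)
            finally have e: "\<tau> powr (- ?d - 3 / 4) * \<tau> powr (?d - 1 / 4) = 1 / \<tau>" .
            have "?c * (C2 * \<tau> powr (?d - 1 / 4)) = C2 * \<omega> \<tau> powr q * (\<tau> powr (- ?d - 3 / 4) * \<tau> powr (?d - 1 / 4))"
              by (simp only: mult_ac)
            thus ?thesis unfolding e by simp
          qed
          finally show ?thesis using True C2(1) by (simp add: ennreal_mult'[symmetric])
        qed (simp add: B_def)
      qed
      also have "\<dots> = ennreal C2 * time_mass q \<omega>"
        unfolding time_mass_def by (rule nn_integral_cmult) measurable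
      also have "\<dots> \<le> ennreal C2 * ennreal J" by (intro mult_left_mono J) auto
      finally show ?thesis using C2(1) J(1) by (simp add: ennreal_mult)
    qed
    have "(\<integral>\<^sup>+\<tau>. \<integral>\<^sup>+y. ennreal (majorant 16 a \<omega> g x \<tau> y) \<partial>lborel \<partial>lborel)
      = (\<integral>\<^sup>+\<tau>. \<integral>\<^sup>+y. ennreal (A (\<tau>, y) * B (\<tau>, y)) \<partial>lborel \<partial>lborel)"
    proof (rule nn_integral_cong, rule nn_integral_cong_AE)
      fix \<tau> :: real
      have "majorant 16 a \<omega> g x \<tau> y = A (\<tau>, y) * B (\<tau>, y)"
        if "y \<noteq> x" for y
      proof (cases "\<tau> > 0")
        case True
        have r: "?r y powr (2 * \<beta> / p) * ?r y powr (- (2 * \<beta> / p)) = 1"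
          using that by (simp add: powr_add[symmetric])
        have t: "\<tau> powr (- (\<beta> + 1) / p) * \<tau> powr (- a - 1 + (\<beta> + 1) / p) = \<tau> powr (- a - 1)"
        proof -
          have "- (\<beta> + 1) / p + (- a - 1 + (\<beta> + 1) / p) = - a - 1" using pq by (simp add: field_simps)
          thus ?thesis unfolding powr_add[symmetric] by (simp only:)
        qed
        have e: "exp (c / p) * exp (c / q) = exp c" for c
        proof -
          have "c / p + c / q = c * (1 / p + 1 / q)" by (simp add: distrib_left)
          thus ?thesis unfolding exp_add[symmetric] pq(3) by simp
        qed
        have "A (\<tau>, y) * B (\<tau>, y) = norm (g y) * \<omega> \<tau> * (?r y powr (2 * \<beta> / p) * ?r y powr (- (2 * \<beta> / p)))
           * (\<tau> powr (- (\<beta> + 1) / p) * \<tau> powr (- a - 1 + (\<beta> + 1) / p)) * (exp (- (?r y)\<^sup>2 / (16 * \<tau>) / p) * exp (- (?r y)\<^sup>2 / (16 * \<tau>) / q))"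
          using True unfolding A_def B_def prod.case by (simp only: indicator_simps greaterThan_iff mult_1 mult_ac)
        thus ?thesis unfolding r t e majorant_def using True by simp
      qed (simp add: A_def majorant_def)
      thus "AE y in lborel. ennreal (majorant 16 a \<omega> g x \<tau> y) = ennreal (A (\<tau>, y) * B (\<tau>, y))"
        using AE_lborel_singleton[of x] by (auto elim: eventually_mono)
    qed
    also have "\<dots> = (\<integral>\<^sup>+z. ennreal (A z * B z) \<partial>(lborel \<Otimes>\<^sub>M lborel))"
      by (rule lborel.nn_integral_fst) measurable
    also have "\<dots> \<le> ennreal ((C1 * G) powr (1/p) * (C2 * J) powr (1/q))"
      by (rule nn_integral_Holder[OF Am Bm nn pq _ X _ Y]) (use C1(1) C2(1) G J(1) in auto)
    also have "(C1 * G) powr (1/p) * (C2 * J) powr (1/q) = C * J powr (1 / q) * Lp_norm p g"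
      unfolding C_def Lp_norm_def G_def[symmetric] using C1(1) C2(1) G J(1) by (simp add: powr_mult)
    finally show ?thesis .
  qed
  moreover have "C > 0" unfolding C_def using C1(1) C2(1) by simp
  ultimately show ?thesis by blast
qed

lemma Lp_norm_nonneg [simp]: "Lp_norm p g \<ge> 0"
  unfolding Lp_norm_def by simp

lemma heat_deriv_along:
  fixes x h :: "real^'n::finite"
  assumes "\<tau> > 0"
  shows "((\<lambda>t. heat ds \<tau> (x + t *\<^sub>R h)) has_real_derivative (\<Sum>i\<in>UNIV. h $ i * heat (i # ds) \<tau> (x + t *\<^sub>R h))) (at t)"
proof -
  have c: "count_list (i # ds) j = count_list ds j" if "j \<noteq> i" for i j using that by simp
  have "((\<lambda>t. heat ds \<tau> (x + t *\<^sub>R h)) has_real_derivative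
     (\<Sum>i\<in>UNIV. (heat1 (Suc (count_list ds i)) \<tau> ((x + t *\<^sub>R h) $ i) * h $ i) * (\<Prod>j\<in>UNIV - {i}. heat1 (count_list ds j) \<tau> ((x + t *\<^sub>R h) $ j)))) (at t)"
    unfolding heat_def
  proof (rule has_field_derivative_prod)
    fix i
    have "((\<lambda>t. (x + t *\<^sub>R h) $ i) has_real_derivative h $ i) (at t)"
      by (auto intro!: derivative_eq_intros)
    from DERIV_chain2[where g = "\<lambda>t. (x + t *\<^sub>R h) $ i", OF heat1_deriv[OF assms] this]
    show "((\<lambda>t. heat1 (count_list ds i) \<tau> ((x + t *\<^sub>R h) $ i)) has_real_derivative heat1 (Suc (count_list ds i)) \<tau> ((x + t *\<^sub>R h) $ i) * h $ i) (at t)" .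
  qed
  moreover have "(heat1 (Suc (count_list ds i)) \<tau> (y $ i) * h $ i) * (\<Prod>j\<in>UNIV - {i}. heat1 (count_list ds j) \<tau> (y $ j)) = h $ i * heat (i # ds) \<tau> y" for i y
    unfolding heat_def prod.remove[OF finite UNIV_I[of i]] by simp
  ultimately show ?thesis by (simp only:)
qed

text \<open>The mean value theorem costs a factor \<open>norm h * \<tau> powr (- 1 / 2)\<close>. For \<open>(norm h)\<^sup>2 \<le> \<tau>\<close> a shift by at most
  \<open>h\<close> changes the Gaussian only by a constant, at the price of half of the exponent.\<close>

lemma heat_increment_bound:
  "\<exists>C>0. \<forall>\<tau>>0. \<forall>x h. (norm h)\<^sup>2 \<le> \<tau> \<longrightarrow> \<bar>heat ds \<tau> (x + h) - heat ds \<tau> x\<bar>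
     \<le> C * norm h * \<tau> powr (- (real CARD('n) + real (length ds) + 1) / 2) * exp (- (norm x)\<^sup>2 / (16 * \<tau>))"
  for ds :: "'n::finite list"
proof -
  have "\<exists>C>0. \<forall>\<tau>>0. \<forall>x. \<bar>heat (i # ds) \<tau> x\<bar>
     \<le> C * \<tau> powr (- (real CARD('n) + real (length ds) + 1) / 2) * exp (- (norm x)\<^sup>2 / (8 * \<tau>))" for i
    using heat_bound[of "i # ds"] by (simp add: add_ac)
  then obtain C where C: "\<And>i. C i > 0" "\<And>i \<tau> x. \<tau> > 0 \<Longrightarrow> \<bar>heat (i # ds) \<tau> x\<bar>
     \<le> C i * \<tau> powr (- (real CARD('n) + real (length ds) + 1) / 2) * exp (- (norm x)\<^sup>2 / (8 * \<tau>))"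
    by metis
  define D where "D = (\<Sum>i\<in>UNIV. C i)"
  have D: "D > 0" unfolding D_def using C(1) by (intro sum_pos) auto
  have "\<bar>heat ds \<tau> (x + h) - heat ds \<tau> x\<bar> \<le> (D * exp (1/8)) * norm h * \<tau> powr (- (real CARD('n) + real (length ds) + 1) / 2) * exp (- (norm x)\<^sup>2 / (16 * \<tau>))"
    if \<tau>: "\<tau> > 0" and h: "(norm h)\<^sup>2 \<le> \<tau>" for \<tau> and x h :: "real^'n"
  proof -
    let ?T = "\<tau> powr (- (real CARD('n) + real (length ds) + 1) / 2)"
    obtain t where t: "0 < t" "t < 1" "heat ds \<tau> (x + 1 *\<^sub>R h) - heat ds \<tau> (x + 0 *\<^sub>R h) = (1 - 0) * (\<Sum>i\<in>UNIV. h $ i * heat (i # ds) \<tau> (x + t *\<^sub>R h))"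
      using MVT2[of 0 1 "\<lambda>t. heat ds \<tau> (x + t *\<^sub>R h)", OF _ heat_deriv_along[OF \<tau>]] by auto
    let ?y = "x + t *\<^sub>R h"
    have "\<bar>heat ds \<tau> (x + h) - heat ds \<tau> x\<bar> \<le> (\<Sum>i\<in>UNIV. \<bar>h $ i * heat (i # ds) \<tau> ?y\<bar>)"
      using t(3) by (simp add: sum_abs)
    also have "\<dots> \<le> (\<Sum>i\<in>UNIV. norm h * (C i * ?T * exp (- (norm ?y)\<^sup>2 / (8 * \<tau>))))"
      unfolding abs_mult by (intro sum_mono mult_mono C(2)[OF \<tau>] component_le_norm_cart) auto
    also have "\<dots> = D * norm h * ?T * exp (- (norm ?y)\<^sup>2 / (8 * \<tau>))"
      unfolding D_def by (simp add: sum_distrib_left sum_distrib_right mult_ac)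
    also have "\<dots> \<le> D * norm h * ?T * (exp (1/8) * exp (- (norm x)\<^sup>2 / (16 * \<tau>)))"
    proof (intro mult_left_mono)
      have "norm x \<le> norm ?y + norm h"
      proof -
        have "norm (?y - t *\<^sub>R h) \<le> norm ?y + norm (t *\<^sub>R h)" by (rule norm_triangle_ineq4)
        also have "norm (t *\<^sub>R h) \<le> norm h" using t by (simp add: mult_left_le_one_le)
        finally show ?thesis by simp
      qed
      hence "(norm x)\<^sup>2 \<le> (norm ?y + norm h)\<^sup>2" by (intro power_mono) auto
      also have "\<dots> \<le> 2 * (norm ?y)\<^sup>2 + 2 * (norm h)\<^sup>2"
        using sum_squares_bound[of "norm ?y" "norm h"] by (simp add: power2_sum)
      finally have "(norm x)\<^sup>2 \<le> 2 * (norm ?y)\<^sup>2 + 2 * \<tau>" using h by simp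
      hence "- (norm ?y)\<^sup>2 / (8 * \<tau>) \<le> 1/8 + - (norm x)\<^sup>2 / (16 * \<tau>)"
        using \<tau> by (simp add: field_simps)
      thus "exp (- (norm ?y)\<^sup>2 / (8 * \<tau>)) \<le> exp (1/8) * exp (- (norm x)\<^sup>2 / (16 * \<tau>))"
        unfolding exp_add[symmetric] by (subst exp_le_cancel_iff)
    qed (use D in auto)
    finally show ?thesis by (simp add: mult_ac)
  qed
  moreover have "D * exp (1/8) > 0" using D by simp
  ultimately show ?thesis by blast
qed

lemma majorant_le:
  assumes "\<tau> > 0 \<Longrightarrow> 0 \<le> \<omega> \<tau> \<and> \<omega> \<tau> \<le> \<omega>' \<tau>"
  shows "majorant 8 a \<omega> g x \<tau> y \<le> majorant 16 a \<omega>' g x \<tau> y"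
proof (cases "\<tau> > 0")
  case True
  have "(norm (x - y))\<^sup>2 / (16 * \<tau>) \<le> (norm (x - y))\<^sup>2 / (8 * \<tau>)" using True by (intro divide_left_mono) auto
  thus ?thesis using True assms unfolding majorant_def by (auto intro!: mult_right_mono mult_mono)
qed (simp add: majorant_def)

section \<open>The potential of an integrable function\<close>

text \<open>The parameter \<open>dim\<close> carries the dimension \<open>n\<close> in its type.\<close>

locale critical_log_bessel =
  fixes s p lam :: real and m :: nat and dim :: "'n::finite itself"
  assumes s: "s > 0" and p: "1 < p" and lam: "lam > 1"
    and crit: "s = 1 / 2 * (real CARD('n) / p + real m)"
begin

definition "q = p / (p - 1)"
definition "a = real CARD('n) / (2 * q)"
definition "\<delta> = (lam - 1) / 4"

text \<open>The density in time of the superposition of heat semigroups that inverts the operator.\<close>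

definition dens :: "real \<Rightarrow> real" where
  "dens \<tau> = indicator {0<..} \<tau> * (exp (- (lam * \<tau>)) * wt s \<tau>)"

definition kern :: "'n scalar_field \<Rightarrow> 'n list \<Rightarrow> real^'n \<Rightarrow> real \<times> (real^'n) \<Rightarrow> complex" where
  "kern g ds x = (\<lambda>(\<tau>, y). complex_of_real (dens \<tau> * heat ds \<tau> (x - y)) * g y)"

text \<open>The potential of \<open>g\<close>, differentiated in the directions \<open>ds\<close>. Integration over time and space together
  makes every exchange of integrals a matter of integrability on one product space.\<close>

definition rep :: "'n scalar_field \<Rightarrow> 'n list \<Rightarrow> 'n scalar_field" where
  "rep g ds x = (LINT z|(lborel \<Otimes>\<^sub>M lborel). kern g ds x z)"

lemma q: "q > 1" "1 / p + 1 / q = 1" "(1 - q) / q = - (1 / p)"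
  unfolding q_def using p by (auto simp: field_simps)

lemma \<delta>: "\<delta> > 0" unfolding \<delta>_def using lam by simp

lemma dens_nonneg: "dens \<tau> \<ge> 0"
  unfolding dens_def using wt_nonneg[OF s] by simp

lemma measurable_dens [measurable]: "dens \<in> borel_measurable borel"
proof -
  note [measurable] = measurable_wt[OF s]
  show ?thesis unfolding dens_def[abs_def] by measurable
qed

lemma Lp_measurable: "g \<in> Lp r \<Longrightarrow> g \<in> borel_measurable borel"
  unfolding Lp_def by simp

lemma measurable_kern [measurable]:
  assumes "g \<in> borel_measurable borel"
  shows "kern g ds x \<in> borel_measurable (lborel \<Otimes>\<^sub>M lborel)"
  using assms unfolding kern_def by measurable

lemma dens_bound:
  assumes "k \<le> m"
  shows "\<exists>C>0. \<forall>\<tau>>0. dens \<tau> * \<tau> powr (- (real CARD('n) + real k) / 2) \<le> C * \<tau> powr (- a - 1) * ell \<delta> \<tau>"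
proof -
  have "real CARD('n) / (2 * q) = real CARD('n) / 2 - real CARD('n) / (2 * p)"
    unfolding q_def using p by (simp add: field_simps)
  hence "(real CARD('n) + real k) / 2 \<le> s + a"
    unfolding a_def crit using assms by (simp add: field_simps)
  from weight_bound[OF s lam this] obtain C where C: "C > 0"
    "\<And>\<tau>. \<tau> > 0 \<Longrightarrow> exp (- (lam * \<tau>)) * wt s \<tau> * \<tau> powr (- ((real CARD('n) + real k) / 2)) \<le> C * \<tau> powr (- a - 1) * ell \<delta> \<tau>"
    unfolding \<delta>_def by blast
  have "dens \<tau> * \<tau> powr (- (real CARD('n) + real k) / 2) \<le> C * \<tau> powr (- a - 1) * ell \<delta> \<tau>" if "\<tau> > 0" for \<tau>
  proof -
    have "- (real CARD('n) + real k) / 2 = - ((real CARD('n) + real k) / 2)" by (rule minus_divide_left[symmetric])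
    thus ?thesis using C(2)[OF that] that by (simp only:) (simp add: dens_def)
  qed
  thus ?thesis using C(1) by blast
qed

text \<open>A constant \<open>C\<close> for which the critical estimate holds; a predicate, because \<open>C\<close> is used for several
  kernels \<open>K\<close> and weights \<open>\<omega>\<close>.\<close>

definition Holder_const :: "real \<Rightarrow> bool" where
  "Holder_const C \<longleftrightarrow> (\<forall>\<omega> J c. \<forall>g :: 'n scalar_field. \<forall>x. \<forall>K :: real \<times> (real^'n) \<Rightarrow> complex.
     \<omega> \<in> borel_measurable borel \<longrightarrow> (\<forall>\<tau>. \<omega> \<tau> \<ge> 0) \<longrightarrow> J \<ge> 0 \<longrightarrow> c \<ge> 0 \<longrightarrow>
     time_mass q \<omega> \<le> ennreal J \<longrightarrow> g \<in> Lp p \<longrightarrow>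
     K \<in> borel_measurable (lborel \<Otimes>\<^sub>M lborel) \<longrightarrow>
     (\<forall>\<tau> y. norm (K (\<tau>, y)) \<le> c * majorant 16 a \<omega> g x \<tau> y) \<longrightarrow>
     integrable (lborel \<Otimes>\<^sub>M lborel) K \<and> (LINT z|(lborel \<Otimes>\<^sub>M lborel). norm (K z)) \<le> c * (C * J powr (1 / q) * Lp_norm p g))"

lemma Holder_constD:
  fixes g :: "'n scalar_field" and K :: "real \<times> (real^'n) \<Rightarrow> complex"
  assumes "Holder_const C" "\<omega> \<in> borel_measurable borel" "\<And>\<tau>. \<omega> \<tau> \<ge> 0" "J \<ge> 0" "c \<ge> 0"
    "time_mass q \<omega> \<le> ennreal J" "g \<in> Lp p"
    "K \<in> borel_measurable (lborel \<Otimes>\<^sub>M lborel)"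
    "\<And>\<tau> y. norm (K (\<tau>, y)) \<le> c * majorant 16 a \<omega> g x \<tau> y"
  shows "integrable (lborel \<Otimes>\<^sub>M lborel) K" "(LINT z|(lborel \<Otimes>\<^sub>M lborel). norm (K z)) \<le> c * (C * J powr (1 / q) * Lp_norm p g)"
proof -
  from assms(1)[unfolded Holder_const_def, THEN spec, of \<omega>, THEN spec, of J, THEN spec, of c, THEN spec, of g, THEN spec, of x, THEN spec, of K] assms(2-)
  have "integrable (lborel \<Otimes>\<^sub>M lborel) K \<and> (LINT z|(lborel \<Otimes>\<^sub>M lborel). norm (K z)) \<le> c * (C * J powr (1 / q) * Lp_norm p g)"
    by blast
  thus "integrable (lborel \<Otimes>\<^sub>M lborel) K" "(LINT z|(lborel \<Otimes>\<^sub>M lborel). norm (K z)) \<le> c * (C * J powr (1 / q) * Lp_norm p g)"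
    by auto
qed

lemma kernel_estimate: "\<exists>C>0. Holder_const C"
proof -
  have "a = real CARD('n) / (2 * q)" by (rule a_def)
  from kernel_Holder[OF p q(1,2) this] obtain C where C: "C > 0" and C2: "\<forall>\<omega> J. \<forall>g :: 'n scalar_field. \<forall>x.
     \<omega> \<in> borel_measurable borel \<longrightarrow> (\<forall>\<tau>. \<omega> \<tau> \<ge> 0) \<longrightarrow> J \<ge> 0 \<longrightarrow>
     time_mass q \<omega> \<le> ennreal J \<longrightarrow> g \<in> Lp p \<longrightarrow>
     (\<integral>\<^sup>+\<tau>. \<integral>\<^sup>+y. ennreal (majorant 16 a \<omega> g x \<tau> y) \<partial>lborel \<partial>lborel)
       \<le> ennreal (C * J powr (1 / q) * Lp_norm p g)"
    by (elim exE conjE)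
  have main: "integrable (lborel \<Otimes>\<^sub>M lborel) K \<and> (LINT z|(lborel \<Otimes>\<^sub>M lborel). norm (K z)) \<le> c * (C * J powr (1 / q) * Lp_norm p g)"
    if \<omega>[measurable]: "\<omega> \<in> borel_measurable borel" "\<And>\<tau>. \<omega> \<tau> \<ge> 0" and J: "J \<ge> 0" "c \<ge> 0"
     "time_mass q \<omega> \<le> ennreal J" and g: "g \<in> Lp p"
     and K [measurable]: "K \<in> borel_measurable (lborel \<Otimes>\<^sub>M lborel)"
     and b: "\<And>\<tau> y. norm (K (\<tau>, y)) \<le> c * majorant 16 a \<omega> g x \<tau> y"
    for \<omega> J c x and g :: "'n scalar_field" and K :: "real \<times> (real^'n) \<Rightarrow> complex"
  proof -
    have [measurable]: "g \<in> borel_measurable borel" by (rule Lp_measurable[OF g])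
    let ?k = "majorant 16 a \<omega> g x"
    have nn: "?k \<tau> y \<ge> 0" for \<tau> y using \<omega>(2) by (simp add: majorant_def)
    have B: "c * (C * J powr (1 / q) * Lp_norm p g) \<ge> 0" using J C Lp_norm_nonneg by simp
    have "(\<integral>\<^sup>+z. ennreal (norm (K z)) \<partial>(lborel \<Otimes>\<^sub>M lborel)) = (\<integral>\<^sup>+\<tau>. \<integral>\<^sup>+y. ennreal (norm (K (\<tau>, y))) \<partial>lborel \<partial>lborel)"
      by (rule lborel.nn_integral_fst[symmetric]) measurable
    also have "\<dots> \<le> (\<integral>\<^sup>+\<tau>. \<integral>\<^sup>+y. ennreal c * ennreal (?k \<tau> y) \<partial>lborel \<partial>lborel)"
      by (intro nn_integral_mono) (subst ennreal_mult[symmetric], use J nn b in \<open>auto intro: ennreal_leI\<close>)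
    also have "\<dots> = ennreal c * (\<integral>\<^sup>+\<tau>. \<integral>\<^sup>+y. ennreal (?k \<tau> y) \<partial>lborel \<partial>lborel)"
      unfolding majorant_def by (simp add: nn_integral_cmult)
    also have "\<dots> \<le> ennreal c * ennreal (C * J powr (1 / q) * Lp_norm p g)"
      by (intro mult_left_mono C2[rule_format] \<omega> J g) auto
    also have "\<dots> = ennreal (c * (C * J powr (1 / q) * Lp_norm p g))"
      using J C Lp_norm_nonneg by (intro ennreal_mult[symmetric]) auto
    finally have N: "(\<integral>\<^sup>+z. ennreal (norm (K z)) \<partial>(lborel \<Otimes>\<^sub>M lborel)) \<le> ennreal (c * (C * J powr (1 / q) * Lp_norm p g))" .
    have int: "integrable (lborel \<Otimes>\<^sub>M lborel) K"
      by (rule integrableI_bounded) (use N in \<open>auto intro: order_le_less_trans\<close>)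
    moreover have "ennreal (LINT z|(lborel \<Otimes>\<^sub>M lborel). norm (K z)) = (\<integral>\<^sup>+z. ennreal (norm (K z)) \<partial>(lborel \<Otimes>\<^sub>M lborel))"
      by (rule nn_integral_eq_integral[symmetric]) (use int in auto)
    hence "ennreal (LINT z|(lborel \<Otimes>\<^sub>M lborel). norm (K z)) \<le> ennreal (c * (C * J powr (1 / q) * Lp_norm p g))"
      using N by simp
    hence "(LINT z|(lborel \<Otimes>\<^sub>M lborel). norm (K z)) \<le> c * (C * J powr (1 / q) * Lp_norm p g)"
      using B by (simp add: ennreal_le_iff)
    ultimately show ?thesis by blast
  qed
  show ?thesis
    unfolding Holder_const_def by (rule exI[of _ C], rule conjI[OF C], intro allI impI, rule main) (assumption | blast)+
qed

text \<open>The Gaussian is kept at twice the rate that \<open>kernel_Holder\<close> asks for; the surplus pays for the decay at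
  infinity in \<open>rep_compact_decay\<close>.\<close>

lemma kern_bound:
  assumes "length ds \<le> m"
  shows "\<exists>C>0. \<forall>g x \<tau> y. norm (kern g ds x (\<tau>, y)) \<le> C * majorant 8 a (ell \<delta>) g x \<tau> y"
proof -
  obtain C where C: "C > 0" "\<And>\<tau> x. \<tau> > 0 \<Longrightarrow> \<bar>heat ds \<tau> x\<bar>
     \<le> C * \<tau> powr (- (real CARD('n) + real (length ds)) / 2) * exp (- (norm x)\<^sup>2 / (8 * \<tau>))"
    using heat_bound[of ds] by blast
  obtain D where D: "D > 0" "\<And>\<tau>. \<tau> > 0 \<Longrightarrow> dens \<tau> * \<tau> powr (- (real CARD('n) + real (length ds)) / 2) \<le> D * \<tau> powr (- a - 1) * ell \<delta> \<tau>"
    using dens_bound[OF assms] by blast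
  have "norm (kern g ds x (\<tau>, y)) \<le> (C * D) * majorant 8 a (ell \<delta>) g x \<tau> y" for g x \<tau> y
  proof (cases "\<tau> > 0")
    case True
    let ?E = "exp (- (norm (x - y))\<^sup>2 / (8 * \<tau>))"
    have "norm (kern g ds x (\<tau>, y)) = dens \<tau> * \<bar>heat ds \<tau> (x - y)\<bar> * norm (g y)"
      unfolding kern_def using dens_nonneg by (simp add: norm_mult abs_mult)
    also have "\<dots> \<le> dens \<tau> * (C * \<tau> powr (- (real CARD('n) + real (length ds)) / 2) * ?E) * norm (g y)"
      by (intro mult_right_mono mult_left_mono C True dens_nonneg) auto
    also have "\<dots> = (dens \<tau> * \<tau> powr (- (real CARD('n) + real (length ds)) / 2)) * (C * ?E * norm (g y))"
      by (simp only: mult_ac)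
    also have "\<dots> \<le> (D * \<tau> powr (- a - 1) * ell \<delta> \<tau>) * (C * ?E * norm (g y))"
      using C(1) by (intro mult_right_mono D True) auto
    finally show ?thesis using True by (simp add: majorant_def mult_ac)
  qed (simp add: kern_def dens_def majorant_def)
  thus ?thesis using C(1) D(1) by (meson mult_pos_pos)
qed

lemma kern_increment_bound:
  assumes "length ds \<le> m"
  shows "\<exists>C>0. \<forall>g x h \<tau> y. (norm h)\<^sup>2 \<le> \<tau> \<longrightarrow> norm (kern g ds (x + h) (\<tau>, y) - kern g ds x (\<tau>, y))
    \<le> C * majorant 16 a (\<lambda>\<tau>. norm h * \<tau> powr (- (1/2)) * ell \<delta> \<tau>) g x \<tau> y"
proof -
  obtain C where C: "C > 0" "\<And>\<tau> x h. \<tau> > 0 \<Longrightarrow> (norm h)\<^sup>2 \<le> \<tau> \<Longrightarrow> \<bar>heat ds \<tau> (x + h) - heat ds \<tau> x\<bar>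
     \<le> C * norm h * \<tau> powr (- (real CARD('n) + real (length ds) + 1) / 2) * exp (- (norm x)\<^sup>2 / (16 * \<tau>))"
    using heat_increment_bound[of ds] by blast
  obtain D where D: "D > 0" "\<And>\<tau>. \<tau> > 0 \<Longrightarrow> dens \<tau> * \<tau> powr (- (real CARD('n) + real (length ds)) / 2) \<le> D * \<tau> powr (- a - 1) * ell \<delta> \<tau>"
    using dens_bound[OF assms] by blast
  have "norm (kern g ds (x + h) (\<tau>, y) - kern g ds x (\<tau>, y)) \<le> (C * D) * majorant 16 a (\<lambda>\<tau>. norm h * \<tau> powr (- (1/2)) * ell \<delta> \<tau>) g x \<tau> y"
    if h: "(norm h)\<^sup>2 \<le> \<tau>" for g x h \<tau> y
  proof (cases "\<tau> > 0")
    case True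
    let ?E = "exp (- (norm (x - y))\<^sup>2 / (16 * \<tau>))"
    let ?P = "\<tau> powr (- (real CARD('n) + real (length ds)) / 2)"
    have e: "\<tau> powr (- (real CARD('n) + real (length ds) + 1) / 2) = ?P * \<tau> powr (- (1/2))"
      by (simp add: powr_add[symmetric] add_divide_distrib diff_divide_distrib)
    have "kern g ds (x + h) (\<tau>, y) - kern g ds x (\<tau>, y) = complex_of_real (dens \<tau> * (heat ds \<tau> ((x - y) + h) - heat ds \<tau> (x - y))) * g y"
      unfolding kern_def by (simp add: algebra_simps)
    hence "norm (kern g ds (x + h) (\<tau>, y) - kern g ds x (\<tau>, y)) = dens \<tau> * \<bar>heat ds \<tau> ((x - y) + h) - heat ds \<tau> (x - y)\<bar> * norm (g y)"
      using dens_nonneg[of \<tau>] by (simp only: norm_mult norm_of_real abs_mult abs_of_nonneg)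
    also have "\<dots> \<le> dens \<tau> * (C * norm h * (?P * \<tau> powr (- (1/2))) * ?E) * norm (g y)"
      unfolding e[symmetric] by (intro mult_right_mono mult_left_mono C True dens_nonneg h) auto
    also have "\<dots> = (dens \<tau> * ?P) * (C * norm h * \<tau> powr (- (1/2)) * ?E * norm (g y))"
      by (simp only: mult_ac)
    also have "\<dots> \<le> (D * \<tau> powr (- a - 1) * ell \<delta> \<tau>) * (C * norm h * \<tau> powr (- (1/2)) * ?E * norm (g y))"
      using C(1) by (intro mult_right_mono D True) auto
    finally show ?thesis using True by (simp add: majorant_def mult_ac)
  qed (simp add: kern_def dens_def majorant_def)
  thus ?thesis using C(1) D(1) by (meson mult_pos_pos)
qed

section \<open>Boundedness and modulus of continuity\<close>

definition ellp :: "real \<Rightarrow> real" where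
  "ellp \<tau> = indicator {0<..} \<tau> * ell \<delta> \<tau>"

lemma measurable_ellp [measurable]: "ellp \<in> borel_measurable borel"
  unfolding ellp_def[abs_def] by measurable

lemma ellp_nonneg: "ellp \<tau> \<ge> 0"
  unfolding ellp_def using ell_pos[of \<tau> \<delta>] by (auto split: split_indicator)

lemma kern_integrable:
  assumes "length ds \<le> m"
  shows "\<exists>C>0. \<forall>g\<in>Lp p. \<forall>x. integrable (lborel \<Otimes>\<^sub>M lborel) (kern g ds x) \<and> (LINT z|(lborel \<Otimes>\<^sub>M lborel). norm (kern g ds x z)) \<le> C * Lp_norm p g"
proof -
  obtain E where E: "E > 0" "Holder_const E" using kernel_estimate by blast
  obtain C where C: "C > 0" "\<And>g x \<tau> y. norm (kern g ds x (\<tau>, y)) \<le> C * majorant 8 a (ell \<delta>) g x \<tau> y"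
    using kern_bound[OF assms] by blast
  obtain J where J: "J \<ge> 0" "time_mass q (ell \<delta>) \<le> ennreal J"
    using nn_integral_ell[OF q(1) \<delta>] unfolding time_mass_def by blast
  have eq: "time_mass q ellp = time_mass q (ell \<delta>)"
    unfolding time_mass_def by (intro nn_integral_cong) (simp add: ellp_def split: split_indicator)
  have *: "integrable (lborel \<Otimes>\<^sub>M lborel) (kern g ds x) \<and> (LINT z|(lborel \<Otimes>\<^sub>M lborel). norm (kern g ds x z)) \<le> (C * E * J powr (1 / q)) * Lp_norm p g"
    if g: "g \<in> Lp p" for g x
  proof -
    note [measurable] = Lp_measurable[OF g]
    have b: "norm (kern g ds x (\<tau>, y)) \<le> C * majorant 16 a ellp g x \<tau> y" for \<tau> y
      by (rule order.trans[OF C(2)], rule mult_left_mono[OF majorant_le])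
        (use C(1) ell_pos in \<open>auto simp: ellp_def less_imp_le\<close>)
    have m: "kern g ds x \<in> borel_measurable (lborel \<Otimes>\<^sub>M lborel)" by measurable
    have JJ: "time_mass q ellp \<le> ennreal J" unfolding eq by (rule J)
    show ?thesis
      using Holder_constD[OF E(2) measurable_ellp ellp_nonneg J(1) less_imp_le[OF C(1)] JJ g m b] by (simp add: mult_ac)
  qed
  \<comment> \<open>The summand \<open>1\<close> makes the constant positive also for \<open>J = 0\<close>.\<close>
  have "C * E * (J + 1) powr (1 / q) > 0" using C(1) E(1) J(1) by simp
  moreover have "integrable (lborel \<Otimes>\<^sub>M lborel) (kern g ds x) \<and> (LINT z|(lborel \<Otimes>\<^sub>M lborel). norm (kern g ds x z)) \<le> (C * E * (J + 1) powr (1 / q)) * Lp_norm p g"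
    if g: "g \<in> Lp p" for g x
  proof -
    have "(C * E * J powr (1 / q)) * Lp_norm p g \<le> (C * E * (J + 1) powr (1 / q)) * Lp_norm p g"
      using C(1) E(1) J(1) q(1) by (intro mult_right_mono mult_left_mono powr_mono2) auto
    thus ?thesis using *[OF g, of x] by auto
  qed
  ultimately show ?thesis by blast
qed

lemma rep_bound:
  assumes "length ds \<le> m"
  shows "\<exists>C>0. \<forall>g\<in>Lp p. \<forall>x. norm (rep g ds x) \<le> C * Lp_norm p g"
proof -
  obtain C where C: "C > 0" "\<And>g x. g \<in> Lp p \<Longrightarrow> (LINT z|(lborel \<Otimes>\<^sub>M lborel). norm (kern g ds x z)) \<le> C * Lp_norm p g"
    using kern_integrable[OF assms] by blast
  have "norm (rep g ds x) \<le> C * Lp_norm p g" if "g \<in> Lp p" for g x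
    unfolding rep_def by (rule order.trans[OF integral_norm_bound C(2)[OF that]])
  thus ?thesis using C(1) by blast
qed

text \<open>The increment is split at the time \<open>norm h\<close>. Earlier times are estimated without using cancellation, by
  the mass of \<open>ell\<close> on \<open>\<tau> < norm h\<close>, and they determine the result. Later times gain
  \<open>norm h * \<tau> powr (- 1 / 2)\<close> from cancellation, which makes them negligible; a cut at any power of \<open>norm h\<close> with
  exponent strictly between \<open>0\<close> and \<open>2\<close> would have the same effect.\<close>

lemma rep_modulus:
  assumes "length ds \<le> m"
  shows "\<exists>C>0. \<forall>g\<in>Lp p. \<forall>x h. 0 < norm h \<longrightarrow> norm h < 1/2 \<longrightarrow>
    norm (rep g ds (x + h) - rep g ds x) \<le> C * Lp_norm p g * ln (1 / norm h) powr (- (1 / p))"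
proof -
  obtain E where E: "E > 0" "Holder_const E" using kernel_estimate by blast
  obtain C where C: "C > 0" "\<And>g x \<tau> y. norm (kern g ds x (\<tau>, y)) \<le> C * majorant 8 a (ell \<delta>) g x \<tau> y"
    using kern_bound[OF assms] by blast
  obtain C' where C': "C' > 0" "\<And>g x h \<tau> y. (norm h)\<^sup>2 \<le> \<tau> \<Longrightarrow> norm (kern g ds (x + h) (\<tau>, y) - kern g ds x (\<tau>, y))
    \<le> C' * majorant 16 a (\<lambda>\<tau>. norm h * \<tau> powr (- (1/2)) * ell \<delta> \<tau>) g x \<tau> y"
    using kern_increment_bound[OF assms] by blast
  obtain B where B: "\<And>g x. g \<in> Lp p \<Longrightarrow> integrable (lborel \<Otimes>\<^sub>M lborel) (kern g ds x)"
    using kern_integrable[OF assms] by blast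
  obtain D where D: "D > 0" "\<And>t. t \<ge> 1/2 \<Longrightarrow> t powr (1 / p) \<le> D * exp (1/2 * t)"
    using powr_le_exp[of "1/2" "1/p"] by auto
  define F where "F = 2 * C * E * (1 / (q - 1)) powr (1 / q) + C' * E * (2 * (2 / q) powr (1 / q)) * D"
  have "norm (rep g ds (x + h) - rep g ds x) \<le> F * Lp_norm p g * ln (1 / norm h) powr (- (1 / p))"
    if g: "g \<in> Lp p" and h: "0 < norm h" "norm h < 1/2" for g x h
  proof -
    note [measurable] = Lp_measurable[OF g]
    let ?N = "lborel \<Otimes>\<^sub>M lborel :: (real \<times> (real^'n)) measure"
    define \<eta> where "\<eta> = norm h"
    have \<eta>: "0 < \<eta>" "\<eta> < 1/2" using h unfolding \<eta>_def by auto
    define L where "L = ln (1 / \<eta>)"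
    have L: "L \<ge> 1/2"
    proof -
      have "1/2 \<le> ln (2::real)" using ln2_ge_two_thirds by simp
      also have "ln 2 \<le> L" unfolding L_def using \<eta> by (subst ln_le_cancel_iff) (auto simp: field_simps)
      finally show ?thesis .
    qed
    have \<eta>L: "\<eta> powr (1/2) \<le> D * L powr (- (1 / p))"
    proof -
      have e: "exp (1/2 * L) = \<eta> powr (- (1/2))" using \<eta> by (simp add: powr_def L_def ln_div)
      have "\<eta> powr (1/2) * L powr (1 / p) \<le> \<eta> powr (1/2) * (D * exp (1/2 * L))"
        by (intro mult_left_mono D(2) L) auto
      also have "\<dots> = D" unfolding e using \<eta> by (simp add: powr_add[symmetric])
      finally have "\<eta> powr (1/2) * L powr (1 / p) * L powr (- (1 / p)) \<le> D * L powr (- (1 / p))"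
        by (intro mult_right_mono) auto
      thus ?thesis using L by (simp add: mult.assoc powr_add[symmetric])
    qed
    let ?small = "\<lambda>\<tau>::real. indicator {0<..<\<eta>} \<tau> :: real" and ?large = "\<lambda>\<tau>::real. indicator {\<eta>..} \<tau> :: real"
    define K1 where "K1 = (\<lambda>x' (z :: real \<times> (real^'n)). complex_of_real (?small (fst z)) * kern g ds x' z)"
    define K3 where "K3 = (\<lambda>z. complex_of_real (?large (fst z)) * (kern g ds (x + h) z - kern g ds x z))"
    have split: "kern g ds (x + h) z - kern g ds x z = K1 (x + h) z - K1 x z + K3 z" for z
    proof (cases z)
      case (Pair \<tau> y)
      show ?thesis
      proof (cases "\<tau> > 0")
        case True thus ?thesis unfolding K1_def K3_def Pair by (auto split: split_indicator)
      next
        case False thus ?thesis using \<eta> unfolding K1_def K3_def Pair kern_def dens_def by simp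
      qed
    qed
    have small: "integrable ?N (K1 x')" "(LINT z|?N. norm (K1 x' z)) \<le> C * (E * (L powr (1 - q) / (q - 1)) powr (1 / q) * Lp_norm p g)" for x'
    proof -
      let ?\<omega> = "\<lambda>\<tau>. ?small \<tau> * (1 / ln (1 / \<tau>))"
      have \<omega>: "?\<omega> \<tau> \<ge> 0" for \<tau>
        using \<eta> by (auto split: split_indicator)
      have J: "time_mass q ?\<omega> \<le> ennreal (L powr (1 - q) / (q - 1))"
      proof -
        have "time_mass q ?\<omega> = (\<integral>\<^sup>+\<tau>. ennreal (indicator {0<..<\<eta>} \<tau> * ((1 / ln (1 / \<tau>)) powr q / \<tau>)) \<partial>lborel)"
          unfolding time_mass_def by (intro nn_integral_cong) (auto split: split_indicator)
        also have "\<dots> = ennreal (L powr (1 - q) / (q - 1))"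
          unfolding L_def by (rule nn_integral_log_weight) (use q \<eta> in auto)
        finally show ?thesis by simp
      qed
      have b: "norm (K1 x' (\<tau>, y)) \<le> C * majorant 16 a ?\<omega> g x' \<tau> y" for \<tau> y
      proof (cases "0 < \<tau> \<and> \<tau> < \<eta>")
        case True
        have "norm (K1 x' (\<tau>, y)) = norm (kern g ds x' (\<tau>, y))" using True by (simp add: K1_def)
        also note C(2)
        also have "C * majorant 8 a (ell \<delta>) g x' \<tau> y \<le> C * majorant 16 a ?\<omega> g x' \<tau> y"
          using True \<eta> C(1) by (intro mult_left_mono majorant_le) (auto simp: ell_def)
        finally show ?thesis .
      next
        case False thus ?thesis by (auto simp: K1_def majorant_def)
      qed
      have m: "K1 x' \<in> borel_measurable ?N" unfolding K1_def by measurable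
      have J0: "L powr (1 - q) / (q - 1) \<ge> 0" using q by simp
      have \<omega>m: "?\<omega> \<in> borel_measurable borel" by measurable
      note hb = Holder_constD[OF E(2) \<omega>m \<omega> J0 less_imp_le[OF C(1)] J g m b]
      show "integrable ?N (K1 x')" "(LINT z|?N. norm (K1 x' z)) \<le> C * (E * (L powr (1 - q) / (q - 1)) powr (1 / q) * Lp_norm p g)"
        by (rule hb)+
    qed
    have large: "integrable ?N K3" "(LINT z|?N. norm (K3 z)) \<le> C' * (E * ((2 * \<eta>) powr q * (\<eta> powr (- (q / 2)) / (q / 2))) powr (1 / q) * Lp_norm p g)"
    proof -
      let ?\<omega> = "\<lambda>\<tau>. ?large \<tau> * (\<eta> * \<tau> powr (- (1/2)) * ell \<delta> \<tau>)"
      have \<omega>: "?\<omega> \<tau> \<ge> 0" for \<tau>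
        using \<eta> ell_pos[of \<tau> \<delta>] by (auto split: split_indicator)
      have J: "time_mass q ?\<omega> \<le> ennreal ((2 * \<eta>) powr q * (\<eta> powr (- (q / 2)) / (q / 2)))"
      proof -
        have "time_mass q ?\<omega> \<le> (\<integral>\<^sup>+\<tau>. ennreal ((2 * \<eta>) powr q) * ennreal (indicator {\<eta>..} \<tau> * \<tau> powr (- (q / 2) - 1)) \<partial>lborel)"
          unfolding time_mass_def
        proof (rule nn_integral_mono)
          fix \<tau> :: real
          show "ennreal (indicator {0<..} \<tau> * (?\<omega> \<tau> powr q / \<tau>)) \<le> ennreal ((2 * \<eta>) powr q) * ennreal (indicator {\<eta>..} \<tau> * \<tau> powr (- (q / 2) - 1))"
          proof (cases "\<tau> \<ge> \<eta>")
            case True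
            hence \<tau>: "\<tau> > 0" using \<eta> by simp
            have "\<eta> * \<tau> powr (- (1/2)) * ell \<delta> \<tau> \<le> \<eta> * \<tau> powr (- (1/2)) * 2"
              using \<eta> \<tau> \<delta> by (intro mult_left_mono ell_le) auto
            hence "(\<eta> * \<tau> powr (- (1/2)) * ell \<delta> \<tau>) powr q \<le> (2 * \<eta> * \<tau> powr (- (1/2))) powr q"
              using \<eta> \<tau> ell_pos[OF \<tau>, of \<delta>] q by (intro powr_mono2) auto
            also have "\<dots> = (2 * \<eta>) powr q * \<tau> powr (- (q / 2))"
              using \<eta> \<tau> by (simp add: powr_mult powr_powr)
            finally have "(\<eta> * \<tau> powr (- (1/2)) * ell \<delta> \<tau>) powr q / \<tau> \<le> (2 * \<eta>) powr q * \<tau> powr (- (q / 2)) / \<tau>"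
              using \<tau> by (intro divide_right_mono) auto
            also have "\<dots> = (2 * \<eta>) powr q * \<tau> powr (- (q / 2) - 1)" using \<tau> by (simp add: powr_diff)
            finally show ?thesis using True \<tau> by (subst ennreal_mult[symmetric]) (auto intro: ennreal_leI)
          qed simp
        qed
        also have "\<dots> = ennreal ((2 * \<eta>) powr q) * ennreal (\<eta> powr (- (q / 2)) / (q / 2))"
          using \<eta> q by (subst nn_integral_cmult) (auto simp: nn_integral_powr_tail_at_infinity)
        also have "\<dots> = ennreal ((2 * \<eta>) powr q * (\<eta> powr (- (q / 2)) / (q / 2)))"
          using q by (intro ennreal_mult[symmetric]) auto
        finally show ?thesis .
      qed
      have b: "norm (K3 (\<tau>, y)) \<le> C' * majorant 16 a ?\<omega> g x \<tau> y" for \<tau> y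
      proof (cases "\<tau> \<ge> \<eta>")
        case True
        have "\<eta>\<^sup>2 \<le> \<tau>"
        proof -
          have "\<eta>\<^sup>2 \<le> \<eta> * 1" unfolding power2_eq_square using \<eta> by (intro mult_left_mono) auto
          thus ?thesis using True by simp
        qed
        from C'(2)[OF this[unfolded \<eta>_def], of g x y] show ?thesis using True by (simp add: K3_def \<eta>_def majorant_def)
      next
        case False thus ?thesis by (simp add: K3_def majorant_def)
      qed
      have m: "K3 \<in> borel_measurable ?N" unfolding K3_def by measurable
      have J0: "(2 * \<eta>) powr q * (\<eta> powr (- (q / 2)) / (q / 2)) \<ge> 0" using q by simp
      have \<omega>m: "?\<omega> \<in> borel_measurable borel" by measurable
      note hb = Holder_constD[OF E(2) \<omega>m \<omega> J0 less_imp_le[OF C'(1)] J g m b]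
      show "integrable ?N K3" "(LINT z|?N. norm (K3 z)) \<le> C' * (E * ((2 * \<eta>) powr q * (\<eta> powr (- (q / 2)) / (q / 2))) powr (1 / q) * Lp_norm p g)"
        by (rule hb)+
    qed
    have J1: "(L powr (1 - q) / (q - 1)) powr (1 / q) = (1 / (q - 1)) powr (1 / q) * L powr (- (1 / p))"
    proof -
      have "(L powr (1 - q)) powr (1 / q) = L powr (- (1 / p))" unfolding powr_powr using q(3) by simp
      thus ?thesis using q(1) L by (simp add: powr_divide)
    qed
    have J3: "((2 * \<eta>) powr q * (\<eta> powr (- (q / 2)) / (q / 2))) powr (1 / q) = (2 * (2 / q) powr (1 / q)) * \<eta> powr (1/2)"
    proof -
      have "((2 * \<eta>) powr q * (\<eta> powr (- (q / 2)) / (q / 2))) = (2 * \<eta>) powr q * \<eta> powr (- (q / 2)) * (2 / q)" by simp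
      also have "\<dots> powr (1 / q) = ((2 * \<eta>) powr q) powr (1 / q) * (\<eta> powr (- (q / 2))) powr (1 / q) * (2 / q) powr (1 / q)"
      proof -
        have *: "(u * v * w) powr e = u powr e * v powr e * w powr e" if "u \<ge> 0" "v \<ge> 0" "w \<ge> 0" for u v w e :: real
          using that by (simp add: powr_mult)
        show ?thesis by (rule *) (use q(1) in auto)
      qed
      also have "\<dots> = 2 * (\<eta> * \<eta> powr (- (1 / 2))) * (2 / q) powr (1 / q)" using q(1) \<eta> by (simp add: powr_powr)
      also have "\<eta> * \<eta> powr (- (1 / 2)) = \<eta> powr (1 / 2)" using \<eta> powr_add[of \<eta> 1 "- (1 / 2)"] by simp
      finally show ?thesis by simp
    qed
    have "rep g ds (x + h) - rep g ds x = (LINT z|?N. kern g ds (x + h) z - kern g ds x z)"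
      unfolding rep_def using B[OF g] by simp
    also have "\<dots> = (LINT z|?N. K1 (x + h) z) - (LINT z|?N. K1 x z) + (LINT z|?N. K3 z)"
      unfolding split using small(1) large(1) by simp
    finally have "norm (rep g ds (x + h) - rep g ds x) \<le> norm (LINT z|?N. K1 (x + h) z) + norm (LINT z|?N. K1 x z) + norm (LINT z|?N. K3 z)"
      by (smt (verit) norm_triangle_ineq norm_triangle_ineq4)
    also have "\<dots> \<le> C * (E * (L powr (1 - q) / (q - 1)) powr (1 / q) * Lp_norm p g) + C * (E * (L powr (1 - q) / (q - 1)) powr (1 / q) * Lp_norm p g)
       + C' * (E * ((2 * \<eta>) powr q * (\<eta> powr (- (q / 2)) / (q / 2))) powr (1 / q) * Lp_norm p g)"
      by (intro add_mono order.trans[OF integral_norm_bound] small large)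
    also have "\<dots> = 2 * C * E * (1 / (q - 1)) powr (1 / q) * L powr (- (1 / p)) * Lp_norm p g + C' * E * (2 * (2 / q) powr (1 / q)) * \<eta> powr (1/2) * Lp_norm p g"
      unfolding J1 J3 by (simp add: algebra_simps)
    also have "\<dots> \<le> 2 * C * E * (1 / (q - 1)) powr (1 / q) * L powr (- (1 / p)) * Lp_norm p g + C' * E * (2 * (2 / q) powr (1 / q)) * (D * L powr (- (1 / p))) * Lp_norm p g"
      using C'(1) E(1) by (intro add_left_mono mult_right_mono mult_left_mono \<eta>L) auto
    also have "\<dots> = F * Lp_norm p g * ln (1 / norm h) powr (- (1 / p))"
      unfolding F_def L_def \<eta>_def by (simp add: algebra_simps)
    finally show ?thesis .
  qed
  moreover have "F > 0" unfolding F_def using C(1) C'(1) D(1) E(1) q(1) by (intro add_pos_nonneg mult_pos_pos) auto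
  ultimately show ?thesis by blast
qed

text \<open>The modulus of continuity tends to \<open>0\<close> with \<open>h\<close>.\<close>

lemma continuous_rep:
  assumes "length ds \<le> m" "g \<in> Lp p"
  shows "continuous_on UNIV (rep g ds)"
  unfolding continuous_on_eq_continuous_at[OF open_UNIV] continuous_at
proof
  fix x :: "real^'n"
  obtain C where C: "C > 0" "\<And>x h. 0 < norm h \<Longrightarrow> norm h < 1/2 \<Longrightarrow>
    norm (rep g ds (x + h) - rep g ds x) \<le> C * Lp_norm p g * ln (1 / norm h) powr (- (1 / p))"
    using rep_modulus[OF assms(1)] assms(2) by meson
  have n: "filterlim (\<lambda>h::real^'n. norm h) (at_right 0) (at 0)"
    unfolding filterlim_at using tendsto_norm_zero[OF tendsto_ident_at]
    by (auto simp: eventually_at_filter)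
  have "filterlim (\<lambda>x::real. ln (1 / x)) at_top (at_right 0)"
    by (rule filterlim_compose[OF ln_at_top]) (simp add: divide_inverse filterlim_inverse_at_top_right)
  from filterlim_compose[OF this n] have "filterlim (\<lambda>h::real^'n. ln (1 / norm h)) at_top (at 0)" .
  hence "((\<lambda>h::real^'n. ln (1 / norm h) powr (- (1 / p))) \<longlongrightarrow> 0) (at 0)"
    using p by (intro tendsto_neg_powr) auto
  from tendsto_mult[OF tendsto_const[of "C * Lp_norm p g"] this]
  have z: "((\<lambda>h::real^'n. C * Lp_norm p g * ln (1 / norm h) powr (- (1 / p))) \<longlongrightarrow> 0) (at 0)" by simp
  have "((\<lambda>h. rep g ds (x + h) - rep g ds x) \<longlongrightarrow> 0) (at 0)"
  proof (rule Lim_null_comparison[OF _ z])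
    have "\<forall>\<^sub>F h in at (0::real^'n). 0 < norm h \<and> norm h < 1/2"
      unfolding eventually_at by (intro exI[of _ "1/2"]) auto
    thus "\<forall>\<^sub>F h in at 0. norm (rep g ds (x + h) - rep g ds x) \<le> C * Lp_norm p g * ln (1 / norm h) powr (- (1 / p))"
      by eventually_elim (use C(2) in auto)
  qed
  hence "((\<lambda>h. rep g ds (x + h)) \<longlongrightarrow> rep g ds x) (at 0)" by (simp add: LIM_zero_iff)
  thus "rep g ds \<midarrow>x\<rightarrow> rep g ds x" by (subst LIM_offset_zero_iff) auto
qed

section \<open>Decay at infinity and differentiation\<close>

lemma Lp_restrict:
  assumes "g \<in> Lp p" "A \<in> sets borel"
  shows "(\<lambda>y. indicator A y * g y) \<in> Lp p"
proof -
  have [measurable]: "g \<in> borel_measurable borel" "A \<in> sets borel" using assms Lp_measurable by auto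
  have "integrable lborel (\<lambda>y. norm (indicator A y * g y) powr p)"
    by (rule Bochner_Integration.integrable_bound[of _ "\<lambda>y. norm (g y) powr p"])
      (use assms p in \<open>auto simp: Lp_def split: split_indicator\<close>)
  thus ?thesis unfolding Lp_def by simp
qed

lemma Lp_norm_tail:
  fixes g :: "'n scalar_field"
  assumes "g \<in> Lp p"
  shows "(\<lambda>k::nat. Lp_norm p (\<lambda>y. indicator (- cball 0 (real k)) y * g y)) \<longlonglongrightarrow> 0"
proof -
  have [measurable]: "g \<in> borel_measurable borel" using assms Lp_measurable by auto
  have gi: "integrable lborel (\<lambda>y. norm (g y) powr p)" using assms unfolding Lp_def by simp
  have "(\<lambda>k::nat. LINT y|lborel. norm (indicator (- cball 0 (real k)) y * g y) powr p) \<longlonglongrightarrow> (LINT y|(lborel :: (real^'n) measure). 0)"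
  proof (rule integral_dominated_convergence[OF _ _ gi])
    have "(\<lambda>k::nat. norm (indicator (- cball 0 (real k)) y * g y) powr p) \<longlonglongrightarrow> 0" for y
    proof (rule tendsto_eventually)
      show "\<forall>\<^sub>F k in sequentially. norm (indicator (- cball 0 (real k)) y * g y) powr p = 0"
        using eventually_ge_at_top[of "nat \<lceil>norm y\<rceil>"]
        by eventually_elim (auto simp: nat_le_iff ceiling_le_iff split: split_indicator)
    qed
    thus "AE y in lborel. (\<lambda>k::nat. norm (indicator (- cball 0 (real k)) y * g y) powr p) \<longlonglongrightarrow> 0" by simp
    show "AE y in lborel. norm (norm (indicator (- cball 0 (real k)) y * g y) powr p) \<le> norm (g y) powr p" for k :: nat
      by (intro AE_I2) (auto split: split_indicator)
  qed measurable
  hence "(\<lambda>k::nat. (LINT y|lborel. norm (indicator (- cball 0 (real k)) y * g y) powr p) powr (1 / p)) \<longlonglongrightarrow> 0 powr (1 / p)"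
    using p by (intro tendsto_powr2) auto
  thus ?thesis unfolding Lp_norm_def using p by simp
qed

text \<open>The extra factor \<open>\<tau>\<close>, harmless at small times, is paid for by half of the exponential decay.\<close>

lemma ell_half:
  "\<exists>D>0. \<forall>\<tau>>0. \<tau> * ell \<delta> \<tau> powr q \<le> D * ell (\<delta> / 2) \<tau> powr q"
proof -
  obtain D where D: "D > 0" "\<And>t. t \<ge> 1/2 \<Longrightarrow> t powr 1 \<le> D * exp (\<delta> * q / 2 * t)"
    using powr_le_exp[of "\<delta> * q / 2" 1] \<delta> q by auto
  have "\<tau> * ell \<delta> \<tau> powr q \<le> (D + 1) * ell (\<delta> / 2) \<tau> powr q" if \<tau>: "\<tau> > 0" for \<tau>
  proof (cases "\<tau> < 1/2")
    case True
    have "\<tau> * ell \<delta> \<tau> powr q \<le> (D + 1) * ell \<delta> \<tau> powr q" using True D(1) by (intro mult_right_mono) auto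
    thus ?thesis using True by (simp add: ell_def)
  next
    case False
    have "\<tau> * ell \<delta> \<tau> powr q \<le> (D * exp (\<delta> * q / 2 * \<tau>)) * ell \<delta> \<tau> powr q"
      using D(2)[of \<tau>] False \<tau> by (intro mult_right_mono) auto
    also have "\<dots> = D * ell (\<delta> / 2) \<tau> powr q"
      using False by (simp add: ell_def powr_def exp_add[symmetric] algebra_simps)
    also have "\<dots> \<le> (D + 1) * ell (\<delta> / 2) \<tau> powr q" by (intro mult_right_mono) auto
    finally show ?thesis .
  qed
  moreover have "D + 1 > 0" using D(1) by simp
  ultimately show ?thesis by blast
qed

text \<open>For \<open>norm x \<ge> 2 * R\<close> every point \<open>y\<close> of the support has distance at least \<open>norm x / 2\<close> from \<open>x\<close>, so half
  of the Gaussian is at most \<open>exp (- (X / \<tau>))\<close> with \<open>X = (norm x)\<^sup>2 / 64\<close>. Included in the weight, this factor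
  makes its mass \<open>O(1 / X)\<close>.\<close>

lemma rep_compact_decay:
  assumes "length ds \<le> m" "g \<in> Lp p" "R \<ge> 0"
  shows "((rep (\<lambda>y. indicator (cball 0 R) y * g y) ds) \<longlongrightarrow> 0) at_infinity"
proof -
  let ?g = "\<lambda>y. indicator (cball 0 R) y * g y"
  have g: "?g \<in> Lp p" by (rule Lp_restrict[OF assms(2)]) simp
  obtain E where E: "E > 0" "Holder_const E" using kernel_estimate by blast
  obtain C where C: "C > 0" "\<And>g x \<tau> y. norm (kern g ds x (\<tau>, y)) \<le> C * majorant 8 a (ell \<delta>) g x \<tau> y"
    using kern_bound[OF assms(1)] by blast
  obtain J where J: "J \<ge> 0" "time_mass q (ell (\<delta> / 2)) \<le> ennreal J"
    using nn_integral_ell[OF q(1), of "\<delta> / 2"] \<delta> unfolding time_mass_def by auto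
  obtain D where D: "D > 0" "\<And>\<tau>. \<tau> > 0 \<Longrightarrow> \<tau> * ell \<delta> \<tau> powr q \<le> D * ell (\<delta> / 2) \<tau> powr q"
    using ell_half by blast
  note [measurable] = Lp_measurable[OF g]
  have main: "norm (rep ?g ds x) \<le> C * (E * (D / q * J / ((norm x)\<^sup>2 / 64)) powr (1 / q) * Lp_norm p ?g)" if x: "norm x \<ge> 2 * R" "norm x > 0" for x
  proof -
    define X where "X = (norm x)\<^sup>2 / 64"
    have X: "X > 0" unfolding X_def using x by simp
    let ?\<omega> = "\<lambda>\<tau>. ellp \<tau> * exp (- (X / \<tau>))"
    have \<omega>: "?\<omega> \<tau> \<ge> 0" for \<tau> using ellp_nonneg by simp
    have JJ: "time_mass q ?\<omega> \<le> ennreal (D / q * J / X)"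
    proof -
      have "time_mass q ?\<omega> \<le> (\<integral>\<^sup>+\<tau>. ennreal (D / q / X) * ennreal (indicator {0<..} \<tau> * (ell (\<delta> / 2) \<tau> powr q / \<tau>)) \<partial>lborel)"
        unfolding time_mass_def
      proof (rule nn_integral_mono)
        fix \<tau> :: real
        show "ennreal (indicator {0<..} \<tau> * (?\<omega> \<tau> powr q / \<tau>)) \<le> ennreal (D / q / X) * ennreal (indicator {0<..} \<tau> * (ell (\<delta> / 2) \<tau> powr q / \<tau>))"
        proof (cases "\<tau> > 0")
          case True
          have ex: "exp (- (X / \<tau>)) powr q \<le> \<tau> / (q * X)"
          proof -
            have u: "q * X / \<tau> > 0" using True X q by simp
            have "q * X / \<tau> \<le> exp (q * X / \<tau>)" using exp_ge_add_one_self[of "q * X / \<tau>"] by linarith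
            hence "1 / exp (q * X / \<tau>) \<le> 1 / (q * X / \<tau>)" using u by (intro divide_left_mono mult_pos_pos) auto
            moreover have "exp (- (X / \<tau>)) powr q = exp (- (q * X / \<tau>))" by (simp add: powr_def)
            moreover have "exp (- (q * X / \<tau>)) = 1 / exp (q * X / \<tau>)" by (simp add: exp_minus inverse_eq_divide)
            moreover have "1 / (q * X / \<tau>) = \<tau> / (q * X)" by simp
            ultimately show ?thesis by (simp only:)
          qed
          have "?\<omega> \<tau> powr q / \<tau> = ell \<delta> \<tau> powr q * exp (- (X / \<tau>)) powr q / \<tau>"
            using True ell_pos[OF True, of \<delta>] by (simp add: ellp_def powr_mult)
          also have "\<dots> \<le> ell \<delta> \<tau> powr q * (\<tau> / (q * X)) / \<tau>"
            using True by (intro divide_right_mono mult_left_mono ex) auto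
          also have "\<dots> = (\<tau> * ell \<delta> \<tau> powr q) / (q * X) / \<tau>" by simp
          also have "\<dots> \<le> (D * ell (\<delta> / 2) \<tau> powr q) / (q * X) / \<tau>"
            using True X q by (intro divide_right_mono D(2)) auto
          also have "\<dots> = D / q / X * (ell (\<delta> / 2) \<tau> powr q / \<tau>)" by simp
          finally show ?thesis using True X q D(1) by (subst ennreal_mult[symmetric]) (auto intro!: ennreal_leI)
        qed simp
      qed
      also have "\<dots> = ennreal (D / q / X) * time_mass q (ell (\<delta> / 2))"
        unfolding time_mass_def by (rule nn_integral_cmult) measurable
      also have "\<dots> \<le> ennreal (D / q / X) * ennreal J" by (intro mult_left_mono J) auto
      also have "\<dots> = ennreal (D / q / X * J)" using J(1) D(1) q X by (intro ennreal_mult[symmetric]) auto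
      finally show ?thesis by simp
    qed
    have b: "norm (kern ?g ds x (\<tau>, y)) \<le> C * majorant 16 a ?\<omega> ?g x \<tau> y" for \<tau> y
    proof (cases "\<tau> > 0 \<and> y \<in> cball 0 R")
      case True
      let ?e = "\<lambda>b. exp (- (norm (x - y))\<^sup>2 / (b * \<tau>))"
      have "norm x \<le> norm (x - y) + norm y" using norm_triangle_ineq[of "x - y" y] by simp
      hence "norm x / 2 \<le> norm (x - y)" using True x(1) by auto
      hence "(norm x / 2)\<^sup>2 \<le> (norm (x - y))\<^sup>2" by (intro power_mono) auto
      hence "X / \<tau> \<le> (norm (x - y))\<^sup>2 / 16 / \<tau>" unfolding X_def using True by (intro divide_right_mono) (auto simp: power_divide)
      hence "- (norm (x - y))\<^sup>2 / (8 * \<tau>) \<le> - (X / \<tau>) + - (norm (x - y))\<^sup>2 / (16 * \<tau>)" by simp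
      hence e: "?e 8 \<le> exp (- (X / \<tau>)) * ?e 16"
        unfolding exp_add[symmetric] by (subst exp_le_cancel_iff)
      have "norm (kern ?g ds x (\<tau>, y)) \<le> C * (ell \<delta> \<tau> * \<tau> powr (- a - 1) * ?e 8 * norm (?g y))"
        using C(2)[of ?g x \<tau> y] True by (simp add: majorant_def)
      also have "\<dots> \<le> C * (ell \<delta> \<tau> * \<tau> powr (- a - 1) * (exp (- (X / \<tau>)) * ?e 16) * norm (?g y))"
        using C(1) True ell_pos[of \<tau> \<delta>] by (intro mult_left_mono mult_right_mono e) auto
      finally show ?thesis using True by (simp add: majorant_def ellp_def mult_ac)
    next
      case False thus ?thesis by (auto simp: kern_def dens_def majorant_def)
    qed
    have J0: "D / q * J / X \<ge> 0" using D(1) q J(1) X by simp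
    have m: "kern ?g ds x \<in> borel_measurable (lborel \<Otimes>\<^sub>M lborel)" by measurable
    have \<omega>m: "?\<omega> \<in> borel_measurable borel" by measurable
    note hb = Holder_constD(2)[OF E(2) \<omega>m \<omega> J0 less_imp_le[OF C(1)] JJ g m b]
    show ?thesis unfolding rep_def X_def[symmetric] by (rule order.trans[OF integral_norm_bound hb])
  qed
  have "filterlim (\<lambda>x::real^'n. (norm x)\<^sup>2) at_top at_infinity"
    by (rule filterlim_pow_at_top[OF _ filterlim_norm_at_top]) simp
  from filterlim_tendsto_pos_mult_at_top[OF tendsto_const[of "1/64"] _ this]
  have "filterlim (\<lambda>x::real^'n. (norm x)\<^sup>2 / 64) at_top at_infinity" by simp
  from tendsto_divide_0[OF tendsto_const filterlim_at_top_imp_at_infinity[OF this]]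
  have Z: "((\<lambda>x::real^'n. D / q * J / ((norm x)\<^sup>2 / 64)) \<longlongrightarrow> 0) at_infinity" .
  have "((\<lambda>x::real^'n. (D / q * J / ((norm x)\<^sup>2 / 64)) powr (1 / q)) \<longlongrightarrow> 0 powr (1 / q)) at_infinity"
    by (rule tendsto_powr2[OF Z tendsto_const]) (use q D(1) J(1) in auto)
  from tendsto_mult[OF tendsto_const[of C] tendsto_mult[OF tendsto_mult[OF tendsto_const[of E] this] tendsto_const[of "Lp_norm p ?g"]]]
  have lim: "((\<lambda>x::real^'n. C * (E * (D / q * J / ((norm x)\<^sup>2 / 64)) powr (1 / q) * Lp_norm p ?g)) \<longlongrightarrow> 0) at_infinity"
    using q by simp
  show ?thesis
  proof (rule Lim_null_comparison[OF _ lim])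
    show "\<forall>\<^sub>F x in at_infinity. norm (rep ?g ds x) \<le> C * (E * (D / q * J / ((norm x)\<^sup>2 / 64)) powr (1 / q) * Lp_norm p ?g)"
      unfolding eventually_at_infinity
      by (rule exI[of _ "max 1 (2 * R)"], intro allI impI, rule main) auto
  qed
qed

text \<open>The part of \<open>g\<close> outside a large ball has small norm and hence a uniformly small potential; the other
  part is compactly supported.\<close>

lemma rep_vanishes:
  assumes "length ds \<le> m" "g \<in> Lp p"
  shows "(rep g ds \<longlongrightarrow> 0) at_infinity"
  unfolding tendsto_iff
proof (intro allI impI)
  fix e :: real assume e: "e > 0"
  obtain C where C: "C > 0" "\<And>g x. g \<in> Lp p \<Longrightarrow> norm (rep g ds x) \<le> C * Lp_norm p g"
    using rep_bound[OF assms(1)] by blast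
  obtain B where B: "\<And>g x. g \<in> Lp p \<Longrightarrow> integrable (lborel \<Otimes>\<^sub>M lborel) (kern g ds x)"
    using kern_integrable[OF assms(1)] by blast
  have "(\<lambda>k::nat. C * Lp_norm p (\<lambda>y. indicator (- cball 0 (real k)) y * g y)) \<longlonglongrightarrow> C * 0"
    by (intro tendsto_intros Lp_norm_tail assms)
  hence "\<forall>\<^sub>F k in sequentially. C * Lp_norm p (\<lambda>y. indicator (- cball 0 (real k)) y * g y) < e / 2"
    using e by (intro order_tendstoD(2)[where a = "e / 2"]) auto
  then obtain k where k: "C * Lp_norm p (\<lambda>y. indicator (- cball 0 (real k)) y * g y) < e / 2"
    using eventually_happens'[OF sequentially_bot] by blast
  let ?g1 = "\<lambda>y. indicator (cball 0 (real k)) y * g y" and ?g2 = "\<lambda>y. indicator (- cball 0 (real k)) y * g y"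
  have L: "?g1 \<in> Lp p" "?g2 \<in> Lp p" by (intro Lp_restrict assms; simp)+
  have split: "rep g ds x = rep ?g1 ds x + rep ?g2 ds x" for x
  proof -
    have "kern g ds x = (\<lambda>z. kern ?g1 ds x z + kern ?g2 ds x z)"
      unfolding kern_def by (auto simp: fun_eq_iff split: split_indicator)
    thus ?thesis unfolding rep_def
      by (simp only: Bochner_Integration.integral_add[OF B[OF L(1)] B[OF L(2)]])
  qed
  have "\<forall>\<^sub>F x in at_infinity. dist (rep ?g1 ds x) 0 < e / 2"
    by (rule tendstoD[OF rep_compact_decay[OF assms]]) (use e in auto)
  thus "\<forall>\<^sub>F x in at_infinity. dist (rep g ds x) 0 < e"
  proof eventually_elim
    fix x assume "dist (rep ?g1 ds x) 0 < e / 2"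
    moreover have "norm (rep ?g2 ds x) < e / 2" using C(2)[OF L(2), of x] k by simp
    ultimately show "dist (rep g ds x) 0 < e"
      unfolding split[of x] using norm_triangle_ineq[of "rep ?g1 ds x" "rep ?g2 ds x"] by simp
  qed
qed

lemma rep_has_pd:
  assumes "length ds < m" "g \<in> Lp p"
  shows "has_pd (rep g ds) i (rep g (i # ds))"
  unfolding has_pd_def
proof
  fix x :: "real^'n"
  let ?N = "lborel \<Otimes>\<^sub>M lborel :: (real \<times> (real^'n)) measure"
  let ?e = "axis i (1::real) :: real^'n"
  note [measurable] = Lp_measurable[OF assms(2)]
  have l: "length ds \<le> m" "length (i # ds) \<le> m" using assms(1) by auto
  obtain B where B: "\<And>x. integrable ?N (kern g ds x)" using kern_integrable[OF l(1)] assms(2) by blast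
  obtain B' where B': "\<And>x. integrable ?N (kern g (i # ds) x)" "\<And>x. (LINT z|?N. norm (kern g (i # ds) x z)) \<le> B' * Lp_norm p g"
    using kern_integrable[OF l(2)] assms(2) by blast
  have "((\<lambda>r. LINT z|?N. kern g ds (x + r *\<^sub>R ?e) z) has_vector_derivative (LINT z|?N. kern g (i # ds) (x + 0 *\<^sub>R ?e) z)) (at 0)"
  proof (rule has_vector_derivative_lebesgue_integral[where B = "B' * Lp_norm p g"])
    show "sigma_finite_measure ?N" by (rule sigma_finite_pair_measure) (rule lborel.sigma_finite_measure_axioms)+
    show "(\<lambda>(r, z). kern g (i # ds) (x + r *\<^sub>R ?e) z) \<in> borel_measurable (borel \<Otimes>\<^sub>M ?N)"
      unfolding kern_def by measurable
    show "((\<lambda>r. kern g ds (x + r *\<^sub>R ?e) z) has_vector_derivative kern g (i # ds) (x + r *\<^sub>R ?e) z) (at r)" for z r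
    proof (cases z)
      case (Pair \<tau> y)
      show ?thesis
      proof (cases "\<tau> > 0")
        case True
        have "((\<lambda>t. heat ds \<tau> ((x - y) + t *\<^sub>R ?e)) has_real_derivative heat (i # ds) \<tau> ((x - y) + r *\<^sub>R ?e)) (at r)"
        proof -
          have "(\<Sum>j\<in>UNIV. ?e $ j * heat (j # ds) \<tau> ((x - y) + r *\<^sub>R ?e)) = (\<Sum>j\<in>UNIV. if j = i then heat (i # ds) \<tau> ((x - y) + r *\<^sub>R ?e) else 0)"
            by (intro sum.cong) (auto simp: axis_def)
          thus ?thesis using heat_deriv_along[OF True, of ds "x - y" ?e r] by simp
        qed
        from DERIV_cmult[OF this, of "dens \<tau>"]
        have "((\<lambda>t. dens \<tau> * heat ds \<tau> (x + t *\<^sub>R ?e - y)) has_real_derivative dens \<tau> * heat (i # ds) \<tau> (x + r *\<^sub>R ?e - y)) (at r)"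
          by (simp add: algebra_simps)
        from has_vector_derivative_mult_left[OF has_vector_derivative_of_real[OF this], of "g y"]
        show ?thesis unfolding kern_def Pair by simp
      next
        case False thus ?thesis unfolding kern_def Pair by (simp add: dens_def)
      qed
    qed
    show "continuous_on UNIV (\<lambda>r. kern g (i # ds) (x + r *\<^sub>R ?e) z)" for z
    proof (cases z)
      case (Pair \<tau> y)
      show ?thesis
      proof (cases "\<tau> > 0")
        case True
        have "continuous_on UNIV (\<lambda>r. heat (i # ds) \<tau> (x + r *\<^sub>R ?e - y))"
          by (rule continuous_on_compose2[OF continuous_heat[OF True, of UNIV]]) (auto intro!: continuous_intros)
        thus ?thesis unfolding kern_def Pair by (auto intro!: continuous_intros)
      next
        case False thus ?thesis unfolding kern_def Pair by (simp add: dens_def)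
      qed
    qed
    have "continuous_on UNIV (\<lambda>r. rep g (i # ds) (x + r *\<^sub>R ?e))"
      by (rule continuous_on_compose2[OF continuous_rep[OF l(2) assms(2)]]) (auto intro!: continuous_intros)
    thus "continuous_on UNIV (\<lambda>r. LINT z|?N. kern g (i # ds) (x + r *\<^sub>R ?e) z)"
      unfolding rep_def .
  qed (use B B' in auto)
  thus "((\<lambda>t. rep g ds (x + t *\<^sub>R ?e)) has_vector_derivative rep g (i # ds) x) (at 0)"
    unfolding rep_def by simp
qed

lemma rep_C0: "length ds \<le> m \<Longrightarrow> g \<in> Lp p \<Longrightarrow> rep g ds \<in> C0"
  unfolding C0_def using continuous_rep rep_vanishes by blast

lemma mi_deriv_rep:
  assumes "g \<in> Lp p" "mi_order \<gamma> \<le> m"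
  shows "mi_deriv \<gamma> (rep g []) = rep g (mi_list \<gamma>)"
  unfolding mi_deriv_foldr
  by (rule foldr_partial_family[where k = m]) (use assms in \<open>auto intro: rep_has_pd simp: length_mi_list\<close>)

lemma rep_C0m:
  assumes "g \<in> Lp p"
  shows "rep g [] \<in> C0m m"
proof -
  have "C_diff m (rep g [])"
    by (rule C_diff_family[where k = m and F = "rep g"]) (use assms in \<open>auto intro: continuous_rep rep_has_pd\<close>)
  thus ?thesis unfolding C0m_def using assms by (auto simp: mi_deriv_rep intro!: rep_C0 simp: length_mi_list)
qed

section \<open>Identification of the distribution\<close>

text \<open>The Laplace transform of the weight at \<open>symA lam \<xi>\<close>, rewritten with the heat multiplier.\<close>

lemma dens_laplace:
  fixes \<xi> :: "real^'n"
  shows "integrable lborel (\<lambda>\<tau>. dens \<tau> * exp (- (4 * pi\<^sup>2 * \<tau> * (norm \<xi>)\<^sup>2)))"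
    and "complex_of_real (LINT \<tau>|lborel. dens \<tau> * exp (- (4 * pi\<^sup>2 * \<tau> * (norm \<xi>)\<^sup>2))) = log_power lam (- s) (- 1) \<xi>"
proof -
  let ?A = "symA lam \<xi>"
  let ?f = "\<lambda>\<tau>. dens \<tau> * exp (- (4 * pi\<^sup>2 * \<tau> * (norm \<xi>)\<^sup>2))"
  have A: "?A > 1" using symA_ge[of lam \<xi>] lam by simp
  have f: "?f \<tau> = indicator {0<..} \<tau> * (exp (- (?A * \<tau>)) * wt s \<tau>)" for \<tau>
  proof -
    have e: "exp (- (lam * \<tau>)) * exp (- (4 * pi\<^sup>2 * \<tau> * (norm \<xi>)\<^sup>2)) = exp (- (?A * \<tau>))"
      unfolding exp_add[symmetric] symA_def by (simp add: algebra_simps)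
    have "?f \<tau> = indicator {0<..} \<tau> * ((exp (- (lam * \<tau>)) * exp (- (4 * pi\<^sup>2 * \<tau> * (norm \<xi>)\<^sup>2))) * wt s \<tau>)"
      unfolding dens_def by (simp only: mult_ac)
    thus ?thesis unfolding e .
  qed
  have nn: "?f \<tau> \<ge> 0" for \<tau> using dens_nonneg by simp
  have N: "(\<integral>\<^sup>+\<tau>. ennreal (?f \<tau>) \<partial>lborel) = ennreal (?A powr (- s) / ln ?A)"
    unfolding f by (rule wt_laplace[OF s A])
  show int: "integrable lborel ?f"
    by (rule integrableI_nonneg) (use nn N in auto)
  have "ennreal (LINT \<tau>|lborel. ?f \<tau>) = ennreal (?A powr (- s) / ln ?A)"
    using nn_integral_eq_integral[OF int] nn N by simp
  hence "(LINT \<tau>|lborel. ?f \<tau>) = ?A powr (- s) / ln ?A"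
    using A nn by (subst (asm) ennreal_inj) (auto intro: integral_nonneg_AE)
  thus "complex_of_real (LINT \<tau>|lborel. ?f \<tau>) = log_power lam (- s) (- 1) \<xi>"
    unfolding log_power_def using ln_gt_zero[OF A] by (simp add: powr_minus divide_inverse)
qed

text \<open>Superposition of \<open>fourier_gauss_inv_fourier\<close> over time.\<close>

lemma fourier_inverse_symbol:
  assumes \<psi>: "(\<psi> :: 'n scalar_field) \<in> schwartz"
  shows "fourier (\<lambda>\<xi>. log_power lam (- s) (- 1) \<xi> * inv_fourier \<psi> \<xi>) x
    = (LINT \<tau>|lborel. complex_of_real (dens \<tau>) * (LINT y|lborel. complex_of_real (heat [] \<tau> (x - y)) * \<psi> y))"
proof -
  let ?\<chi> = "inv_fourier \<psi>"
  let ?g = "\<lambda>\<xi> \<tau>. dens \<tau> * exp (- (4 * pi\<^sup>2 * \<tau> * (norm (\<xi>::real^'n))\<^sup>2))"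
  let ?c = "\<lambda>\<xi>. ?\<chi> \<xi> * cis (- (2 * pi * (\<xi> \<bullet> x)))"
  let ?k = "\<lambda>\<xi> \<tau>. complex_of_real (?g \<xi> \<tau>) * ?c \<xi>"
  have \<chi>: "?\<chi> \<in> schwartz" by (rule inv_fourier_schwartz[OF \<psi>])
  have [measurable]: "?\<chi> \<in> borel_measurable borel" by (rule rapid0_measurable[OF schwartz_rapid0[OF \<chi>]])
  have \<eta>: "(\<lambda>\<xi>. log_power lam (- s) (- 1) \<xi> * ?\<chi> \<xi>) \<in> schwartz"
    by (rule schwartz_slow_mult[OF ctrl_slow_log_power[OF lam] \<chi>])
  have ki: "integrable (lborel \<Otimes>\<^sub>M lborel) (case_prod ?k)"
  proof (rule lborel_pair.Fubini_integrable)
    show "case_prod ?k \<in> borel_measurable (lborel \<Otimes>\<^sub>M lborel)" by measurable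
    have "norm (log_power lam (- s) (- 1) \<xi> * ?\<chi> \<xi>) = (LINT \<tau>|lborel. norm (case_prod ?k (\<xi>, \<tau>)))" for \<xi>
    proof -
      have "(LINT \<tau>|lborel. norm (case_prod ?k (\<xi>, \<tau>))) = (LINT \<tau>|lborel. ?g \<xi> \<tau> * norm (?\<chi> \<xi>))"
        using dens_nonneg by (intro Bochner_Integration.integral_cong) (auto simp: norm_mult abs_mult)
      also have "\<dots> = (LINT \<tau>|lborel. ?g \<xi> \<tau>) * norm (?\<chi> \<xi>)" by (rule integral_mult_left_zero)
      also have "(LINT \<tau>|lborel. ?g \<xi> \<tau>) = norm (log_power lam (- s) (- 1) \<xi>)"
        unfolding dens_laplace(2)[symmetric] norm_of_real
        using dens_nonneg by (intro abs_of_nonneg[symmetric] integral_nonneg_AE) auto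
      finally show ?thesis unfolding norm_mult[of "log_power lam (- s) (- 1) \<xi>"] by (rule sym)
    qed
    thus "integrable lborel (\<lambda>\<xi>. LINT \<tau>|lborel. norm (case_prod ?k (\<xi>, \<tau>)))"
      using integrable_norm[OF rapid0_integrable[OF schwartz_rapid0[OF \<eta>]]] by simp
    have "integrable lborel (\<lambda>\<tau>. case_prod ?k (\<xi>, \<tau>))" for \<xi>
      unfolding prod.case by (intro integrable_mult_left integrable_of_real dens_laplace)
    thus "AE \<xi> in lborel. integrable lborel (\<lambda>\<tau>. case_prod ?k (\<xi>, \<tau>))" by simp
  qed
  have "fourier (\<lambda>\<xi>. log_power lam (- s) (- 1) \<xi> * ?\<chi> \<xi>) x = (LINT \<xi>|lborel. LINT \<tau>|lborel. ?k \<xi> \<tau>)"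
    unfolding fourier_def
  proof (rule Bochner_Integration.integral_cong[OF refl])
    fix \<xi>
    have "(LINT \<tau>|lborel. ?k \<xi> \<tau>) = (LINT \<tau>|lborel. complex_of_real (?g \<xi> \<tau>)) * ?c \<xi>"
      by (rule integral_mult_left_zero)
    also have "(LINT \<tau>|lborel. complex_of_real (?g \<xi> \<tau>)) = log_power lam (- s) (- 1) \<xi>"
      unfolding dens_laplace(2)[symmetric] by (rule integral_complex_of_real)
    finally show "log_power lam (- s) (- 1) \<xi> * ?\<chi> \<xi> * cis (- (2 * pi * (\<xi> \<bullet> x))) = (LINT \<tau>|lborel. ?k \<xi> \<tau>)"
      by (simp only: mult.assoc)
  qed
  also have "\<dots> = (LINT \<tau>|lborel. LINT \<xi>|lborel. ?k \<xi> \<tau>)"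
    by (rule lborel_pair.Fubini_integral[OF ki, symmetric])
  also have "\<dots> = (LINT \<tau>|lborel. complex_of_real (dens \<tau>) * (LINT y|lborel. complex_of_real (heat [] \<tau> (x - y)) * \<psi> y))"
  proof (rule Bochner_Integration.integral_cong[OF refl])
    fix \<tau> :: real
    show "(LINT \<xi>|lborel. ?k \<xi> \<tau>) = complex_of_real (dens \<tau>) * (LINT y|lborel. complex_of_real (heat [] \<tau> (x - y)) * \<psi> y)"
    proof (cases "\<tau> > 0")
      case True
      have "(LINT \<xi>|lborel. ?k \<xi> \<tau>) = (LINT \<xi>|lborel. complex_of_real (dens \<tau>) * (complex_of_real (exp (- (4 * pi\<^sup>2 * \<tau> * (norm \<xi>)\<^sup>2))) * ?\<chi> \<xi> * cis (- (2 * pi * (\<xi> \<bullet> x)))))"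
        by (intro Bochner_Integration.integral_cong) (simp_all only: of_real_mult mult.assoc)
      also have "\<dots> = complex_of_real (dens \<tau>) * fourier (\<lambda>\<xi>. complex_of_real (exp (- (4 * pi\<^sup>2 * \<tau> * (norm \<xi>)\<^sup>2))) * ?\<chi> \<xi>) x"
        unfolding fourier_def by (rule integral_mult_right_zero)
      finally show ?thesis
        unfolding fourier_gauss_inv_fourier[OF rapid0_integrable[OF schwartz_rapid0[OF \<psi>]] True] .
    qed (simp add: dens_def)
  qed
  finally show ?thesis .
qed

text \<open>Fubini's theorem on time and two copies of space, with absolute convergence provided by
  \<open>kern_integrable\<close>; the heat kernel is even, so the convolution can be moved from \<open>g\<close> to \<open>\<psi>\<close>.\<close>

lemma rep_pairing:
  assumes g: "g \<in> Lp p" and \<psi>: "\<psi> \<in> schwartz"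
  shows "(LINT x|lborel. g x * fourier (\<lambda>\<xi>. log_power lam (- s) (- 1) \<xi> * inv_fourier \<psi> \<xi>) x) = (LINT y|lborel. rep g [] y * \<psi> y)"
proof -
  let ?N = "lborel \<Otimes>\<^sub>M lborel :: (real \<times> (real^'n)) measure"
  interpret N: sigma_finite_measure ?N
    by (rule sigma_finite_pair_measure) (rule lborel.sigma_finite_measure_axioms)+
  interpret P: pair_sigma_finite "lborel :: (real^'n) measure" ?N ..
  note [measurable] = Lp_measurable[OF g] rapid0_measurable[OF schwartz_rapid0[OF \<psi>]]
  obtain C where C: "\<And>y. integrable ?N (kern g [] y)" "\<And>y. (LINT z|?N. norm (kern g [] y z)) \<le> C * Lp_norm p g"
    using kern_integrable[of "[]"] g by auto
  let ?F = "\<lambda>y z. kern g [] y z * \<psi> y"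
  have Fm [measurable]: "case_prod ?F \<in> borel_measurable (lborel \<Otimes>\<^sub>M ?N)"
    unfolding kern_def by measurable
  have Fi: "integrable (lborel \<Otimes>\<^sub>M ?N) (case_prod ?F)"
  proof (rule P.Fubini_integrable[OF Fm])
    have "integrable lborel (\<lambda>y. C * Lp_norm p g * norm (\<psi> y))"
      using rapid0_integrable[OF schwartz_rapid0[OF \<psi>]] by (intro integrable_mult_right integrable_norm)
    thus "integrable lborel (\<lambda>y. LINT z|?N. norm (case_prod ?F (y, z)))"
    proof (rule Bochner_Integration.integrable_bound)
      show "(\<lambda>y. LINT z|?N. norm (case_prod ?F (y, z))) \<in> borel_measurable lborel" by measurable
      have "norm (LINT z|?N. norm (case_prod ?F (y, z))) \<le> norm (C * Lp_norm p g * norm (\<psi> y))" for y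
      proof -
        have "norm (LINT z|?N. norm (case_prod ?F (y, z))) = (LINT z|?N. norm (kern g [] y z)) * norm (\<psi> y)"
          by (simp add: norm_mult)
        also have "\<dots> \<le> C * Lp_norm p g * norm (\<psi> y)" by (intro mult_right_mono C) auto
        finally show ?thesis by simp
      qed
      thus "AE y in lborel. norm (LINT z|?N. norm (case_prod ?F (y, z))) \<le> norm (C * Lp_norm p g * norm (\<psi> y))" by simp
    qed
    show "AE y in lborel. integrable ?N (\<lambda>z. case_prod ?F (y, z))"
      using C(1) by simp
  qed
  let ?H = "\<lambda>\<tau> x. LINT y|lborel. ?F y (\<tau>, x)"
  have Hi: "integrable ?N (case_prod ?H)"
    using P.integrable_snd[OF Fi] by (simp add: split_def)
  have "(LINT y|lborel. rep g [] y * \<psi> y) = (LINT y|lborel. LINT z|?N. ?F y z)"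
    unfolding rep_def by (simp only: integral_mult_left_zero)
  also have "\<dots> = (LINT z|?N. LINT y|lborel. ?F y z)" by (rule P.Fubini_integral[OF Fi, symmetric])
  also have "\<dots> = (LINT z|?N. case_prod ?H z)" by (simp add: split_def)
  also have "\<dots> = (LINT x|lborel. LINT \<tau>|lborel. ?H \<tau> x)" by (rule lborel_pair.integral_snd[OF Hi, symmetric])
  also have "\<dots> = (LINT x|lborel. g x * fourier (\<lambda>\<xi>. log_power lam (- s) (- 1) \<xi> * inv_fourier \<psi> \<xi>) x)"
  proof (rule Bochner_Integration.integral_cong[OF refl])
    fix x :: "real^'n"
    have "?H \<tau> x = g x * (complex_of_real (dens \<tau>) * (LINT y|lborel. complex_of_real (heat [] \<tau> (x - y)) * \<psi> y))" for \<tau>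
    proof -
      have "?F y (\<tau>, x) = (g x * complex_of_real (dens \<tau>)) * (complex_of_real (heat [] \<tau> (x - y)) * \<psi> y)" for y
        using heat_minus[of \<tau> "x - y"] unfolding kern_def by (simp add: mult_ac)
      hence "?H \<tau> x = (g x * complex_of_real (dens \<tau>)) * (LINT y|lborel. complex_of_real (heat [] \<tau> (x - y)) * \<psi> y)"
        by (simp only: integral_mult_right_zero)
      thus ?thesis by (simp only: mult.assoc)
    qed
    thus "(LINT \<tau>|lborel. ?H \<tau> x) = g x * fourier (\<lambda>\<xi>. log_power lam (- s) (- 1) \<xi> * inv_fourier \<psi> \<xi>) x"
      unfolding fourier_inverse_symbol[OF \<psi>] by (simp only: integral_mult_right_zero)
  qed
  finally show ?thesis by simp
qed

text \<open>The operator is tested on the Schwartz function that its transpose maps to \<open>\<psi>\<close>, namely the Fourier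
  transform of the inverse symbol times \<open>inv_fourier \<psi>\<close>.\<close>

lemma log_bessel_potential_eq_rep:
  assumes u: "u \<in> tempered" and op: "log_bessel_op s lam u = fun_distr g" and g: "g \<in> Lp p"
  shows "u = fun_distr (rep g [])"
proof
  fix \<psi> :: "'n scalar_field"
  show "u \<psi> = fun_distr (rep g []) \<psi>"
  proof (cases "\<psi> \<in> schwartz")
    case False
    thus ?thesis using u unfolding tempered_def fun_distr_def by (auto simp: extensional_def)
  next
    case \<psi>: True
    let ?\<eta> = "\<lambda>\<xi>. log_power lam (- s) (- 1) \<xi> * inv_fourier \<psi> \<xi>"
    have \<chi>: "inv_fourier \<psi> \<in> schwartz" by (rule inv_fourier_schwartz[OF \<psi>])
    have \<eta>: "?\<eta> \<in> schwartz" by (rule schwartz_slow_mult[OF ctrl_slow_log_power[OF lam] \<chi>])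
    have \<phi>: "fourier ?\<eta> \<in> schwartz" by (rule fourier_schwartz[OF \<eta>])
    have s\<eta>: "(\<lambda>\<xi>. log_symbol s lam \<xi> * ?\<eta> \<xi>) = inv_fourier \<psi>"
      by (simp add: fun_eq_iff mult.assoc[symmetric] log_symbol_mult_inverse[OF lam])
    have "log_bessel_op s lam u (fourier ?\<eta>) = u (fourier (\<lambda>\<xi>. log_symbol s lam \<xi> * inv_fourier (fourier ?\<eta>) \<xi>))"
      unfolding log_bessel_op_def fourier_multiplier_def inv_fourier_distr_def mult_distr_def fourier_distr_def
      using \<phi> \<eta> \<chi> s\<eta> by (simp add: inv_fourier_fourier_schwartz)
    also have "\<dots> = u \<psi>"
      unfolding inv_fourier_fourier_schwartz[OF \<eta>] s\<eta> fourier_inv_fourier_schwartz[OF \<psi>] ..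
    finally have "u \<psi> = fun_distr g (fourier ?\<eta>)" unfolding op by simp
    also have "\<dots> = (LINT x|lborel. g x * fourier ?\<eta> x)" unfolding fun_distr_def using \<phi> by simp
    also have "\<dots> = (LINT y|lborel. rep g [] y * \<psi> y)" by (rule rep_pairing[OF g \<psi>])
    also have "\<dots> = fun_distr (rep g []) \<psi>" unfolding fun_distr_def using \<psi> by simp
    finally show ?thesis .
  qed
qed

lemma foldr_partial_schwartz: "\<phi> \<in> schwartz \<Longrightarrow> foldr partial_deriv ds \<phi> \<in> schwartz"
  unfolding schwartz_iff using ctrl_foldr_partial by blast

lemma rep_cong_count:
  assumes "\<And>i. count_list ds i = count_list es i"
  shows "rep g ds = rep g es"
  unfolding rep_def[abs_def] kern_def heat_def by (simp add: assms)

lemma rep_integration_by_parts: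
  assumes g: "g \<in> Lp p" and \<phi>: "\<phi> \<in> schwartz" and "length ds < m"
  shows "(LINT x|lborel. rep g ds x * partial_deriv i \<phi> x) = - (LINT x|lborel. rep g (i # ds) x * \<phi> x)"
proof -
  have l: "length ds \<le> m" "length (i # ds) \<le> m" using assms(3) by auto
  obtain \<phi>' where \<phi>': "has_pd \<phi> i \<phi>'" "rapid0 \<phi>'" using schwartz_imp_ctrl[OF \<phi>, of 1] by auto
  obtain B where B: "\<And>x. norm (rep g ds x) \<le> B * Lp_norm p g" using rep_bound[OF l(1)] g by blast
  obtain B' where B': "\<And>x. norm (rep g (i # ds) x) \<le> B' * Lp_norm p g" using rep_bound[OF l(2)] g by blast
  have "(LINT x|lborel. rep g (i # ds) x * \<phi> x) = - (LINT x|lborel. rep g ds x * \<phi>' x)"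
    by (rule integration_by_parts[OF \<phi>'(1) rep_has_pd[OF assms(3) g] schwartz_rapid0[OF \<phi>] \<phi>'(2)
          continuous_rep[OF l(1) g] continuous_rep[OF l(2) g] B B'])
  thus ?thesis unfolding has_pd_partial_deriv[OF \<phi>'(1)] by simp
qed

text \<open>Moving derivatives one by one onto the potential reverses their order, which \<open>rep_cong_count\<close> makes
  irrelevant.\<close>

lemma rep_iterated_parts:
  assumes g: "g \<in> Lp p" and \<phi>: "\<phi> \<in> schwartz"
  shows "length es + length ds \<le> m \<Longrightarrow>
    (LINT x|lborel. rep g ds x * foldr partial_deriv es \<phi> x) = (-1) ^ length es * (LINT x|lborel. rep g (rev es @ ds) x * \<phi> x)"
proof (induction es arbitrary: ds)
  case (Cons i es)
  have "(LINT x|lborel. rep g ds x * foldr partial_deriv (i # es) \<phi> x) = - (LINT x|lborel. rep g (i # ds) x * foldr partial_deriv es \<phi> x)"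
    using rep_integration_by_parts[OF g foldr_partial_schwartz[OF \<phi>, of es], of ds i] Cons.prems by simp
  also have "(LINT x|lborel. rep g (i # ds) x * foldr partial_deriv es \<phi> x) = (-1) ^ length es * (LINT x|lborel. rep g (rev es @ i # ds) x * \<phi> x)"
    using Cons.prems by (intro Cons.IH) simp
  finally show ?case by simp
qed simp

lemma weak_deriv_rep:
  assumes g: "g \<in> Lp p" and \<gamma>: "mi_order \<gamma> \<le> m"
  shows "weak_deriv \<gamma> (fun_distr (rep g [])) = fun_distr (rep g (mi_list \<gamma>))"
proof
  fix \<phi> :: "'n scalar_field"
  show "weak_deriv \<gamma> (fun_distr (rep g [])) \<phi> = fun_distr (rep g (mi_list \<gamma>)) \<phi>"
  proof (cases "\<phi> \<in> schwartz")
    case True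
    have "fun_distr (rep g []) (mi_deriv \<gamma> \<phi>) = (LINT x|lborel. rep g [] x * foldr partial_deriv (mi_list \<gamma>) \<phi> x)"
      unfolding mi_deriv_foldr fun_distr_def using foldr_partial_schwartz[OF True] by simp
    also have "\<dots> = (-1) ^ mi_order \<gamma> * (LINT x|lborel. rep g (rev (mi_list \<gamma>) @ []) x * \<phi> x)"
      unfolding length_mi_list[symmetric] by (rule rep_iterated_parts[OF g True]) (use \<gamma> in \<open>simp add: length_mi_list\<close>)
    also have "rep g (rev (mi_list \<gamma>) @ []) = rep g (mi_list \<gamma>)" by (rule rep_cong_count) (simp add: count_list_rev)
    finally show ?thesis
      unfolding weak_deriv_def using True by (simp add: fun_distr_def power_add[symmetric] mult.assoc[symmetric] power_mult_distrib[symmetric])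
  qed (simp add: weak_deriv_def fun_distr_def)
qed

section \<open>The embedding and the modulus of continuity\<close>

text \<open>The norm is defined through one particular representative \<open>g\<close>, and the potential is formed from the
  same one.\<close>

lemma log_bessel_space_rep:
  assumes "u \<in> log_bessel_space p s lam"
  shows "\<exists>g \<in> Lp p. u = fun_distr (rep g []) \<and> Lp_norm p g = log_bessel_norm p s lam u"
proof -
  define g where "g = (SOME g. g \<in> Lp p \<and> log_bessel_op s lam u = fun_distr g)"
  have "\<exists>g. g \<in> Lp p \<and> log_bessel_op s lam u = fun_distr g"
    using assms unfolding log_bessel_space_def by auto
  from someI_ex[OF this] have "g \<in> Lp p" "log_bessel_op s lam u = fun_distr g" unfolding g_def by auto
  moreover have "u = fun_distr (rep g [])"
    by (rule log_bessel_potential_eq_rep) (use assms calculation in \<open>auto simp: log_bessel_space_def\<close>)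
  ultimately show ?thesis unfolding log_bessel_norm_def g_def by blast
qed

lemma sup_norm_le: "(\<And>x. norm (f x) \<le> B) \<Longrightarrow> sup_norm f \<le> B"
  unfolding sup_norm_def by (rule cSUP_least) auto

lemma C0m_embedding:
  "\<exists>C>0. \<forall>u \<in> (log_bessel_space p s lam :: 'n functional set).
    \<exists>f \<in> C0m m. u = fun_distr f \<and> C0m_norm m f \<le> C * log_bessel_norm p s lam u"
proof -
  obtain B where B: "\<And>ds :: 'n list. length ds \<le> m \<Longrightarrow> B ds > 0"
    "\<And>ds g x. length ds \<le> m \<Longrightarrow> g \<in> Lp p \<Longrightarrow> norm (rep g ds x) \<le> B ds * Lp_norm p g"
    using rep_bound by metis
  let ?G = "{\<gamma> :: 'n multi_index. mi_order \<gamma> \<le> m}"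
  define C where "C = (\<Sum>\<gamma>\<in>?G. B (mi_list \<gamma>)) + 1"
  have B0: "B (mi_list \<gamma>) > 0" if "\<gamma> \<in> ?G" for \<gamma> using that by (intro B(1)) (simp add: length_mi_list)
  have "(\<Sum>\<gamma>\<in>?G. B (mi_list \<gamma>)) \<ge> 0" using B0 by (intro sum_nonneg) (simp add: less_imp_le)
  hence C: "C > 0" unfolding C_def by simp
  moreover have "\<exists>f \<in> C0m m. u = fun_distr f \<and> C0m_norm m f \<le> C * log_bessel_norm p s lam u"
    if u: "u \<in> (log_bessel_space p s lam :: 'n functional set)" for u
  proof -
    obtain g where g: "g \<in> Lp p" "u = fun_distr (rep g [])" "Lp_norm p g = log_bessel_norm p s lam u"
      using log_bessel_space_rep[OF u] by blast
    have "C0m_norm m (rep g []) \<le> (\<Sum>\<gamma>\<in>?G. B (mi_list \<gamma>) * Lp_norm p g)"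
      unfolding C0m_norm_def
    proof (rule sum_mono)
      fix \<gamma> assume \<gamma>: "\<gamma> \<in> ?G"
      show "sup_norm (mi_deriv \<gamma> (rep g [])) \<le> B (mi_list \<gamma>) * Lp_norm p g"
        using \<gamma> g(1) by (intro sup_norm_le) (auto simp: mi_deriv_rep length_mi_list intro!: B(2))
    qed
    also have "\<dots> \<le> C * Lp_norm p g" unfolding C_def by (simp add: sum_distrib_right distrib_right)
    finally show ?thesis using g rep_C0m[OF g(1)] by metis
  qed
  ultimately show ?thesis by blast
qed

lemma finite_mi_order: "finite {\<gamma> :: 'n multi_index. mi_order \<gamma> = m}"
proof (rule finite_subset)
  show "{\<gamma> :: 'n multi_index. mi_order \<gamma> = m} \<subseteq> Pi UNIV (\<lambda>_. {..m})"
    unfolding mi_order_def using member_le_sum[of _ "UNIV :: 'n set"] by fastforce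
  show "finite (Pi (UNIV :: 'n set) (\<lambda>_. {..m}))"
    using finite_PiE[of "UNIV :: 'n set" "\<lambda>_. {..m}"] by (simp add: PiE_def)
qed

lemma log_modulus:
  "\<exists>C>0. \<exists>\<epsilon>>0. \<forall>u \<in> (log_bessel_space p s lam :: 'n functional set).
    \<forall>\<gamma> :: 'n multi_index. mi_order \<gamma> = m \<longrightarrow>
      (\<exists>g \<in> C0. weak_deriv \<gamma> u = fun_distr g \<and>
        (\<forall>h. 0 < norm h \<and> norm h < \<epsilon> \<longrightarrow>
          sup_norm (\<lambda>x. g (x + h) - g x) \<le> C * log_bessel_norm p s lam u * \<bar>ln (norm h)\<bar> powr (- (1 / p))))"
proof -
  obtain B where B: "\<And>ds :: 'n list. length ds \<le> m \<Longrightarrow> B ds > 0"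
    "\<And>ds g x h. length ds \<le> m \<Longrightarrow> g \<in> Lp p \<Longrightarrow> 0 < norm h \<Longrightarrow> norm h < 1/2 \<Longrightarrow>
      norm (rep g ds (x + h) - rep g ds x) \<le> B ds * Lp_norm p g * ln (1 / norm h) powr (- (1 / p))"
    using rep_modulus by metis
  let ?G = "{\<gamma> :: 'n multi_index. mi_order \<gamma> = m}"
  define C where "C = (\<Sum>\<gamma>\<in>?G. B (mi_list \<gamma>)) + 1"
  have B0: "B (mi_list \<gamma>) > 0" if "\<gamma> \<in> ?G" for \<gamma> using that by (intro B(1)) (simp add: length_mi_list)
  have BC: "B (mi_list \<gamma>) \<le> C" if "\<gamma> \<in> ?G" for \<gamma>
    unfolding C_def using member_le_sum[OF that _ finite_mi_order, of "\<lambda>\<gamma>. B (mi_list \<gamma>)"] B0 by (simp add: less_imp_le)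
  have "(\<Sum>\<gamma>\<in>?G. B (mi_list \<gamma>)) \<ge> 0" using B0 by (intro sum_nonneg) (simp add: less_imp_le)
  hence C: "C > 0" unfolding C_def by simp
  have "\<exists>f \<in> C0. weak_deriv \<gamma> u = fun_distr f \<and>
        (\<forall>h. 0 < norm h \<and> norm h < 1/2 \<longrightarrow>
          sup_norm (\<lambda>x. f (x + h) - f x) \<le> C * log_bessel_norm p s lam u * \<bar>ln (norm h)\<bar> powr (- (1 / p)))"
    if u: "u \<in> (log_bessel_space p s lam :: 'n functional set)" and \<gamma>: "mi_order \<gamma> = m" for u and \<gamma> :: "'n multi_index"
  proof -
    obtain g where g: "g \<in> Lp p" "u = fun_distr (rep g [])" "Lp_norm p g = log_bessel_norm p s lam u"
      using log_bessel_space_rep[OF u] by blast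
    have l: "length (mi_list \<gamma>) \<le> m" using \<gamma> by (simp add: length_mi_list)
    have "sup_norm (\<lambda>x. rep g (mi_list \<gamma>) (x + h) - rep g (mi_list \<gamma>) x) \<le> C * log_bessel_norm p s lam u * \<bar>ln (norm h)\<bar> powr (- (1 / p))"
      if h: "0 < norm h" "norm h < 1/2" for h
    proof (rule sup_norm_le)
      fix x
      have ln: "ln (1 / norm h) = \<bar>ln (norm h)\<bar>" using h by (simp add: ln_div)
      have "norm (rep g (mi_list \<gamma>) (x + h) - rep g (mi_list \<gamma>) x) \<le> B (mi_list \<gamma>) * Lp_norm p g * ln (1 / norm h) powr (- (1 / p))"
        by (rule B(2)[OF l g(1) h])
      also have "\<dots> \<le> C * Lp_norm p g * ln (1 / norm h) powr (- (1 / p))"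
        using BC[of \<gamma>] \<gamma> by (intro mult_right_mono) auto
      finally show "norm (rep g (mi_list \<gamma>) (x + h) - rep g (mi_list \<gamma>) x) \<le> C * log_bessel_norm p s lam u * \<bar>ln (norm h)\<bar> powr (- (1 / p))"
        unfolding g(3) ln .
    qed
    moreover have "weak_deriv \<gamma> u = fun_distr (rep g (mi_list \<gamma>))"
      unfolding g(2) by (rule weak_deriv_rep[OF g(1)]) (simp add: \<gamma>)
    ultimately show ?thesis using rep_C0[OF l g(1)] by blast
  qed
  hence "C > 0 \<and> (1/2 :: real) > 0 \<and> (\<forall>u \<in> (log_bessel_space p s lam :: 'n functional set).
    \<forall>\<gamma> :: 'n multi_index. mi_order \<gamma> = m \<longrightarrow>
      (\<exists>g \<in> C0. weak_deriv \<gamma> u = fun_distr g \<and>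
        (\<forall>h. 0 < norm h \<and> norm h < 1/2 \<longrightarrow>
          sup_norm (\<lambda>x. g (x + h) - g x) \<le> C * log_bessel_norm p s lam u * \<bar>ln (norm h)\<bar> powr (- (1 / p)))))"
    using C by simp
  thus ?thesis by blast
qed

end

theorem theorem1p14:
  fixes s p lam :: real and m :: nat
  assumes "s > 0" and "1 < p" and "lam > 1"
    and "s = 1 / 2 * (real CARD('n::finite) / p + real m)"
  shows
    "(\<exists>C>0. \<forall>u \<in> (log_bessel_space p s lam :: 'n functional set).
        \<exists>f \<in> C0m m. u = fun_distr f \<and> C0m_norm m f \<le> C * log_bessel_norm p s lam u)
   \<and> (\<exists>C>0. \<exists>\<delta>>0. \<forall>u \<in> (log_bessel_space p s lam :: 'n functional set).
        \<forall>\<gamma> :: 'n multi_index. mi_order \<gamma> = m \<longrightarrow>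
          (\<exists>g \<in> C0. weak_deriv \<gamma> u = fun_distr g \<and>
            (\<forall>h. 0 < norm h \<and> norm h < \<delta> \<longrightarrow>
              sup_norm (\<lambda>x. g (x + h) - g x)
                \<le> C * log_bessel_norm p s lam u * \<bar>ln (norm h)\<bar> powr (- (1 / p)))))"
proof -
  interpret critical_log_bessel s p lam m "TYPE('n)"
    by unfold_locales (use assms in auto)
  show ?thesis by (intro conjI C0m_embedding log_modulus)
qed

end
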